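(* The $\zeta$-condition $$\lim_{\tau\to\infty}\frac1\tau\int_{\frac{x^n+y^n}{z^n}\frac{\tau}{1-c}}^{\left[\frac{x^n+y^n}{z^n}\frac{\tau}{1-c}\right]^1}\left|\zeta\left(\tfrac12+it\right)\right|^2dt\neq1$$ on the class of all Fermat's rationals $$\left\{\frac{x^n+y^n}{z^n}\right\},\quad \forall\, x,y,z,n\in\mathbb{N},$$ represents the $\zeta$-equivalent of (that is, it is equivalent to) the Fermat-Wiles theorem.
   Context: $\zeta$ is the Riemann zeta-function, $c$ is Euler's constant, and $\mathbb{N}$ is the set of positive integers. The Fermat-Wiles theorem states that the equation $x^n+y^n=z^n$ is not solvable in positive integers $x,y,z$ for any $n\ge3$. For sufficiently large $T$, $[T]^1=\varphi_1^{-1}(T)$ is the first reverse iteration of the Jacob's ladder $\varphi_1$, which is defined as follows. Let $\mu$ be a fixed smooth, increasing, unbounded function on some $[y_0,\infty)$ with $\mu(y)\ge 7y\ln y$. For all sufficiently large $T$ let $\varphi(T)$ be the solution $x=\varphi(T)$, increasing to infinity in $T$, of the integral equation $\int_0^{\mu(x)}|\zeta(\frac12+it)|^2e^{-2t/x}\,dt=\int_0^{T}|\zeta(\frac12+it)|^2\,dt$. The Jacob's ladder is $\varphi_1(T)=\frac12\varphi(T)$; it is strictly increasing for all sufficiently large $T$ and tends to infinity, and $\varphi_1^{-1}$ denotes its inverse function there.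
   Formalization: The condition is imposed only on Fermat's rationals with n ≥ 3, not for all n in N: with n = 1, x = y = 1, z = 2 the rational is 1, the limit equals 1, and the stated equivalence with the Fermat-Wiles theorem would fail. *)

theory Defs
  imports "HOL-Complex_Analysis.Complex_Analysis"
begin

(* The analytic continuation of the Dirichlet series to the plane without the pole 1.
   It is unique by the identity theorem; the value at 1 is a dummy that makes the
   total function unique. *)
definition zeta :: "complex \<Rightarrow> complex" where
  "zeta = (THE f. f holomorphic_on - {1} \<and>
                  (\<forall>s. Re s > 1 \<longrightarrow> (\<lambda>k. 1 / of_nat (Suc k) powr s) sums f s) \<and>
                  f 1 = 0)"

definition zeta_sq :: "real \<Rightarrow> real" where
  "zeta_sq t = (cmod (zeta (Complex (1/2) t)))\<^sup>2"

(* All derivatives exist on the closed half-line; at the endpoint they are one-sided. *)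
definition smooth_on_ray :: "real \<Rightarrow> (real \<Rightarrow> real) \<Rightarrow> bool" where
  "smooth_on_ray a f \<longleftrightarrow>
     (\<exists>D :: nat \<Rightarrow> real \<Rightarrow> real. D 0 = f \<and>
        (\<forall>k. \<forall>x\<ge>a. (D k has_real_derivative D (Suc k) x) (at x within {a..})))"

(* Positivity of the left endpoint keeps ln y and exp (-2 t / x) meaningful on the
   whole half-line.  mono_on is the weak sense of "increasing". *)
definition jacob_weight :: "real \<Rightarrow> (real \<Rightarrow> real) \<Rightarrow> bool" where
  "jacob_weight y0 \<mu> \<longleftrightarrow>
     y0 > 0 \<and> smooth_on_ray y0 \<mu> \<and> mono_on {y0..} \<mu> \<and> filterlim \<mu> at_top at_top \<and>
     (\<forall>y\<ge>y0. \<mu> y \<ge> 7 * y * ln y)"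

(* The left-hand side is strictly increasing in x wherever it is positive, and it is
   continuous and unbounded; so for every sufficiently large T there is exactly one
   solution x, and it increases to infinity with T.  For smaller T the value may be
   unspecified. *)
definition jacob_phi :: "real \<Rightarrow> (real \<Rightarrow> real) \<Rightarrow> real \<Rightarrow> real" where
  "jacob_phi y0 \<mu> T =
     (THE x. x \<ge> y0 \<and>
        integral {0..\<mu> x} (\<lambda>t. zeta_sq t * exp (- 2 * t / x)) = integral {0..T} zeta_sq)"

definition jacob_ladder :: "real \<Rightarrow> (real \<Rightarrow> real) \<Rightarrow> real \<Rightarrow> real" where
  "jacob_ladder y0 \<mu> T = jacob_phi y0 \<mu> T / 2"

(* The inverse of the restriction of the ladder to [T0, infinity), meant for T0 such that
   the ladder is strictly increasing there. *)
definition reverse_iter :: "real \<Rightarrow> (real \<Rightarrow> real) \<Rightarrow> real \<Rightarrow> real \<Rightarrow> real" where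
  "reverse_iter y0 \<mu> T0 = the_inv_into {T0..} (jacob_ladder y0 \<mu>)"

definition fermat_rational :: "nat \<Rightarrow> nat \<Rightarrow> nat \<Rightarrow> nat \<Rightarrow> real" where
  "fermat_rational x y z n = (real x ^ n + real y ^ n) / real z ^ n"

definition zeta_mean :: "real \<Rightarrow> (real \<Rightarrow> real) \<Rightarrow> real \<Rightarrow> real \<Rightarrow> real \<Rightarrow> real" where
  "zeta_mean y0 \<mu> T0 q \<tau> =
     (let U = q * (\<tau> / (1 - euler_mascheroni))
      in 1 / \<tau> * integral {U..reverse_iter y0 \<mu> T0 U} zeta_sq)"

definition fermat_wiles :: bool where
  "fermat_wiles \<longleftrightarrow>
     (\<forall>n\<ge>3. \<not> (\<exists>x y z :: nat. x > 0 \<and> y > 0 \<and> z > 0 \<and> x ^ n + y ^ n = z ^ n))"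

end

theory Submission
  imports Defs "HOL-Probability.Probability" "HOL-Real_Asymp.Real_Asymp"
begin

text \<open>
  Write \<open>I(T)\<close> for the integral of \<open>zeta_sq\<close> over \<open>[0, T]\<close> and \<open>c\<close> for Euler's constant.  If \<open>T'\<close> is the
  first reverse iteration of \<open>U\<close>, the defining equation of the ladder turns the integral of \<open>zeta_sq\<close>
  over \<open>[U, T']\<close> into the difference between an Abelian mean (weight \<open>exp (- t / U)\<close>) of \<open>zeta_sq\<close>
  and \<open>I(U)\<close>.  As soon as \<open>I(T) = T ln T + b T + o(T)\<close> for some constant \<open>b\<close>, that difference is
  \<open>(1 - c) U + o(U)\<close>, because the integral of \<open>s ln s exp (- s)\<close> over the positive half-line is \<open>1 - c\<close>.
  Hence \<open>zeta_mean\<close> tends to the Fermat rational itself, and the condition says that it is never \<open>1\<close>.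

  The asymptotics of \<open>I\<close> come from the fact that \<open>- zeta s / s\<close>, on the critical line, is the Fourier
  transform of \<open>f u = frac (exp u) exp (- u / 2)\<close>.  By Plancherel, the integral of
  \<open>zeta_sq t / (1/4 + t^2) * (1 - cos (y t))\<close> is \<open>pi\<close> times the squared norm of \<open>f (u + y) - f u\<close>, which is
  elementary and equals \<open>y ln (1 / y) + C y + O(y powr (3/2))\<close>.  The density \<open>(ln t + a) / t^2\<close> has
  the same expansion for a suitable \<open>a\<close>; a Gaussian smoothing and the positivity of \<open>zeta_sq\<close> then give
  tails that agree up to \<open>o(1 / T)\<close>, and partial summation gives \<open>I\<close>.
\<close>

subsection \<open>Analytic continuation of the zeta-function\<close>

text \<open>The precision needed shapes the proof. \<open>I(U)\<close> has size
  \<open>U ln U\<close>, while the mean to be found has size \<open>U\<close>: the linear term of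
  \<open>I\<close> must be shown to exist, but its coefficient \<open>b\<close> then cancels, since
  the integral of \<open>s exp (- s)\<close> over the positive half-line is 1. Division of
  \<open>zeta s\<close> by \<open>s\<close> makes the function square integrable on the critical
  line, and on the Fourier side the demand becomes a remainder that is \<open>o(y)\<close>. The
  exponent 3/2 exceeds 1, which leaves room for a smoothing scale \<open>H\<close> well below
  \<open>T\<close> whose error \<open>H powr (- (3/2))\<close> is still \<open>o(1 / T)\<close>. The
  Tauberian obstacle is the return from smoothed to sharp tails, because no bound for
  \<open>zeta_dens\<close> near \<open>T\<close> is at hand. Its tail is monotone, however, so
  moving the cut-off by a margin traps it between two smoothed tails, and only the explicit model
  has to be small on the shell in between. The bound \<open>\<mu> y \<ge> 7 * y * ln y\<close> makes
  the truncation of the Laplace integral at \<open>\<mu>\<close> negligible.\<close>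

lemma holomorphic_on_suminf:
  fixes f :: "nat \<Rightarrow> complex \<Rightarrow> complex"
  assumes S: "open S"
    and hol: "\<And>n. f n holomorphic_on S"
    and bound: "\<And>z d. z \<in> S \<Longrightarrow> d > 0 \<Longrightarrow> cball z d \<subseteq> S \<Longrightarrow>
                  \<exists>M. summable M \<and> (\<forall>\<^sub>F n in sequentially. \<forall>w\<in>cball z d. norm (f n w) \<le> M n)"
  shows "(\<lambda>z. \<Sum>n. f n z) holomorphic_on S"
proof (rule holomorphic_uniform_sequence[OF S])
  show "(\<lambda>z. \<Sum>k<n. f k z) holomorphic_on S" for n
    by (intro holomorphic_intros hol)
next
  fix z assume z: "z \<in> S"
  then obtain d where d: "d > 0" "cball z d \<subseteq> S"
    using S open_contains_cball by blast
  obtain M where "summable M" "\<forall>\<^sub>F n in sequentially. \<forall>w\<in>cball z d. norm (f n w) \<le> M n"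
    using bound[OF z d] by blast
  then have "uniform_limit (cball z d) (\<lambda>n w. \<Sum>k<n. f k w) (\<lambda>w. \<Sum>k. f k w) sequentially"
    by (intro Weierstrass_m_test_ev)
  with d show "\<exists>d>0. cball z d \<subseteq> S \<and>
      uniform_limit (cball z d) (\<lambda>n w. \<Sum>k<n. f k w) (\<lambda>w. \<Sum>k. f k w) sequentially"
    by blast
qed

text \<open>The sum starts at 2: without the term 1 the series decays like
  \<open>2 powr (- Re s)\<close>, and this decay makes the series of \<open>zeta_step\<close>
  converge.\<close>

definition zeta_tail :: "complex \<Rightarrow> complex" where
  "zeta_tail s = (\<Sum>k. 1 / of_nat (k + 2) powr s)"

text \<open>
  Expanding \<open>(n - 1) powr (1 - s) = n powr (1 - s) * (1 - 1 / n) powr (1 - s)\<close> binomially and telescoping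
  over \<open>n \<ge> 2\<close> shows that \<open>(s - 1) * zeta_tail s\<close> is a fixed point of the following operator for
  \<open>Re s > 1\<close>.  Its value at \<open>s\<close> uses the argument only at \<open>s + 1, s + 2, \<dots>\<close>, so each
  application extends the function by a strip of width \<open>1\<close>; the factor \<open>s - 1\<close> removes all poles.
\<close>

definition zeta_step :: "(complex \<Rightarrow> complex) \<Rightarrow> complex \<Rightarrow> complex" where
  "zeta_step F s =
     1 - (\<Sum>j. pochhammer (s - 1) (Suc j) / fact (j + 2) * F (s + of_nat j + 1))"

text \<open>Meaningful only for \<open>Re s > 1 - real m\<close>; further left the innermost
  \<open>zeta_tail\<close> is evaluated where its series need not converge.\<close>

definition entire_iter :: "nat \<Rightarrow> complex \<Rightarrow> complex" where
  "entire_iter m = (zeta_step ^^ m) (\<lambda>s. (s - 1) * zeta_tail s)"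

lemma norm_nat_powr: "norm (1 / of_nat (Suc k) powr s :: complex) = real (Suc k) powr (- Re s)"
proof -
  have "norm (of_nat (Suc k) powr s :: complex) = real (Suc k) powr Re s"
    using norm_powr_real_powr[of "of_nat (Suc k)" s] by simp
  then show ?thesis
    by (simp only: norm_divide powr_minus divide_inverse norm_inverse norm_one mult_1)
qed

lemma summable_shift_powr:
  assumes "\<sigma> > (1::real)"
  shows "summable (\<lambda>k. real (k + m) powr (- \<sigma>))"
  using assms by (subst summable_iff_shift) (auto simp: summable_real_powr_iff)

lemma zeta_tail_holomorphic: "zeta_tail holomorphic_on {s. Re s > 1}"
  unfolding zeta_tail_def[abs_def]
proof (rule holomorphic_on_suminf)
  show "open {s. Re s > 1}" by (rule open_halfspace_Re_gt)
  show "(\<lambda>s. 1 / of_nat (n + 2) powr s) holomorphic_on {s. Re s > 1}" for n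
    by (auto intro!: holomorphic_intros)
  fix z d assume z: "z \<in> {s. Re s > 1}" and d: "d > (0::real)" "cball z d \<subseteq> {s. Re s > 1}"
  have "z - of_real d \<in> cball z d" using d by (simp add: dist_norm)
  then have "z - of_real d \<in> {s. Re s > 1}" using d by blast
  then have 1: "Re z - d > 1" by simp
  show "\<exists>M. summable M \<and> (\<forall>\<^sub>F n in sequentially. \<forall>w\<in>cball z d. norm (1 / of_nat (n + 2) powr w :: complex) \<le> M n)"
  proof (intro exI conjI always_eventually allI ballI)
    show "summable (\<lambda>n. real (n + 2) powr (- (Re z - d)))"
      by (rule summable_shift_powr[OF 1])
    fix n w assume "w \<in> cball z d"
    then have "Re z - d \<le> Re w"
      using abs_Re_le_cmod[of "z - w"] by (auto simp: dist_norm)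
    then show "norm (1 / of_nat (n + 2) powr w :: complex) \<le> real (n + 2) powr (- (Re z - d))"
      using norm_nat_powr[of "n + 1" w] by (simp add: powr_mono)
  qed
qed

text \<open>Splitting off \<open>real (k + 2) powr (-2)\<close> leaves a factor of at most
  \<open>2 powr (2 - Re s)\<close>. The bound is uniform in \<open>n\<close>, so it serves the full
  series and also dominates the passage to the limit in \<open>zeta_step_fixpoint\<close>.\<close>

lemma norm_zeta_tail_partial_le:
  "\<exists>C\<ge>0. \<forall>s n. Re s \<ge> 2 \<longrightarrow> norm (\<Sum>k<n. 1 / of_nat (k + 2) powr s :: complex) \<le> C * 2 powr (- Re s)"
proof (intro exI conjI allI impI)
  let ?C = "4 * (\<Sum>k. real (k + 2) powr (-2))"
  have sum2: "summable (\<lambda>k. real (k + 2) powr (-2))"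
    using summable_shift_powr[of 2 2] by simp
  show "0 \<le> ?C" by (intro mult_nonneg_nonneg suminf_nonneg sum2) auto
  fix s n assume s: "Re s \<ge> 2"
  have le: "norm (1 / of_nat (k + 2) powr s :: complex) \<le> 2 powr (2 - Re s) * real (k + 2) powr (-2)" for k
  proof -
    have "norm (1 / of_nat (k + 2) powr s :: complex) = real (k + 2) powr (2 - Re s) * real (k + 2) powr (-2)"
      using norm_nat_powr[of "k + 1" s] by (simp flip: powr_add)
    also have "real (k + 2) powr (2 - Re s) \<le> 2 powr (2 - Re s)"
      using s by (intro powr_mono2') auto
    finally show ?thesis by (simp add: mult_right_mono)
  qed
  have "norm (\<Sum>k<n. 1 / of_nat (k + 2) powr s :: complex) \<le> (\<Sum>k<n. 2 powr (2 - Re s) * real (k + 2) powr (-2))"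
    by (intro sum_norm_le le)
  also have "\<dots> = 2 powr (2 - Re s) * (\<Sum>k<n. real (k + 2) powr (-2))"
    by (simp add: sum_distrib_left)
  also have "\<dots> \<le> 2 powr (2 - Re s) * (\<Sum>k. real (k + 2) powr (-2))"
    by (intro mult_left_mono sum_le_suminf sum2) auto
  also have "2 powr (2 - Re s) = 4 * 2 powr (- Re s)"
    by (simp add: powr_diff powr_minus divide_inverse)
  finally show "norm (\<Sum>k<n. 1 / of_nat (k + 2) powr s :: complex) \<le> ?C * 2 powr (- Re s)"
    by (simp add: mult_ac)
qed

lemma zeta_tail_sums:
  assumes "Re s > 1"
  shows "(\<lambda>k. 1 / of_nat (k + 2) powr s) sums zeta_tail s"
proof -
  have "norm (1 / of_nat (k + 2) powr s :: complex) = real (k + 2) powr (- Re s)" for k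
    using norm_nat_powr[of "k + 1" s] by simp
  then have "summable (\<lambda>k. norm (1 / of_nat (k + 2) powr s :: complex))"
    using summable_shift_powr[OF assms, of 2] by (simp only:)
  then show ?thesis
    unfolding zeta_tail_def by (rule summable_sums[OF summable_norm_cancel])
qed

lemma norm_zeta_tail_le:
  "\<exists>C\<ge>0. \<forall>s. Re s \<ge> 2 \<longrightarrow> norm (zeta_tail s) \<le> C * 2 powr (- Re s)"
proof -
  obtain C where C: "C \<ge> 0" "\<And>s n. Re s \<ge> 2 \<Longrightarrow> norm (\<Sum>k<n. 1 / of_nat (k + 2) powr s :: complex) \<le> C * 2 powr (- Re s)"
    using norm_zeta_tail_partial_le by blast
  have "norm (zeta_tail s) \<le> C * 2 powr (- Re s)" if s: "Re s \<ge> 2" for s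
    using zeta_tail_sums[of s] C(2)[OF s] s unfolding sums_def
    by (intro Lim_norm_ubound[of sequentially]) auto
  with C(1) show ?thesis by blast
qed

lemma norm_pochhammer_le: "norm (pochhammer (s - 1) n :: complex) \<le> pochhammer (norm s + 1) n"
proof -
  have "norm (pochhammer (s - 1) n) = (\<Prod>i<n. norm (s - 1 + of_nat i))"
    by (simp add: pochhammer_prod prod_norm atLeast0LessThan)
  also have "\<dots> \<le> (\<Prod>i<n. norm s + 1 + of_nat i)"
  proof (intro prod_mono conjI)
    fix i
    have "norm (s - 1 + of_nat i) \<le> norm s + norm (1::complex) + norm (of_nat i :: complex)"
      by (meson add_mono norm_triangle_ineq norm_triangle_ineq4 norm_triangle_le order_refl order_trans)
    then show "norm (s - 1 + of_nat i) \<le> norm s + 1 + of_nat i" by simp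
  qed auto
  finally show ?thesis by (simp add: pochhammer_prod atLeast0LessThan)
qed

text \<open>The ratio of consecutive terms tends to 1/2: the quotient of pochhammer symbol and
  factorial grows only polynomially, and each step halves the power of 2. The ratio test is run with
  3/4.\<close>

lemma summable_pochhammer_majorant:
  fixes R :: real
  assumes "R \<ge> 0"
  shows "summable (\<lambda>j. pochhammer (R + 1) (Suc j) / fact (j + 2) * ((R + real j + 1) * 2 powr (R - (real j + 1))))"
proof -
  let ?f = "\<lambda>j. pochhammer (R + 1) (Suc j) / fact (j + 2) * ((R + real j + 1) * 2 powr (R - (real j + 1)))"
  have "((\<lambda>j::nat. ((R + real j + 2) / (real j + 3)) * ((R + real j + 2) / (R + real j + 1)) / 2) \<longlongrightarrow> 1/2) at_top"
    by real_asymp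
  then have "\<forall>\<^sub>F j in sequentially. ((R + real j + 2) / (real j + 3)) * ((R + real j + 2) / (R + real j + 1)) / 2 < 3/4"
    by (rule order_tendstoD) auto
  then obtain N where N: "\<And>j. j \<ge> N \<Longrightarrow> ((R + real j + 2) / (real j + 3)) * ((R + real j + 2) / (R + real j + 1)) / 2 < 3/4"
    by (auto simp: eventually_sequentially)
  have "norm (?f (Suc j)) \<le> 3/4 * norm (?f j)" if "j \<ge> N" for j
  proof -
    have pos: "?f j \<ge> 0" for j using assms by (auto intro!: mult_nonneg_nonneg divide_nonneg_nonneg pochhammer_nonneg)
    have "pochhammer (R + 1) (Suc (Suc j)) = pochhammer (R + 1) (Suc j) * (R + real j + 2)"
      by (subst pochhammer_Suc) (simp add: algebra_simps)
    moreover have "(fact (Suc j + 2) :: real) = fact (j + 2) * (real j + 3)"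
      by (simp add: algebra_simps)
    moreover have "2 powr (R - (real (Suc j) + 1)) = 2 powr (R - (real j + 1)) / 2"
      by (simp add: powr_diff powr_add algebra_simps)
    moreover have "R + real (Suc j) + 1 = (R + real j + 1) * ((R + real j + 2) / (R + real j + 1))"
      using assms by (simp add: field_simps)
    moreover have "p * a / (f * b) * (c * q * (w / 2)) = p / f * (c * w) * (a / b * q / 2)" for p a f b c q w :: real
      by (simp add: mult_ac)
    ultimately have "?f (Suc j) = ?f j * (((R + real j + 2) / (real j + 3)) * ((R + real j + 2) / (R + real j + 1)) / 2)"
      by (simp only:)
    also have "\<dots> \<le> ?f j * (3/4)"
      using N[OF that] pos[of j] by (intro mult_left_mono) auto
    finally show ?thesis using pos[of j] pos[of "Suc j"]
      by (simp only: real_norm_def abs_of_nonneg mult.commute)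
  qed
  then show ?thesis
    using summable_ratio_test[of "3/4" N ?f] by (simp add: add.commute)
qed

text \<open>For \<open>R + 1 \<le> real j\<close> the argument \<open>w + of_nat j + 1\<close> has
  real part at least 2, where the decay of \<open>F\<close> applies. Hence the majorant holds only
  from some index on, which is all that \<open>holomorphic_on_suminf\<close> asks for.\<close>

lemma zeta_step_bound:
  assumes F: "\<And>s. Re s \<ge> 2 \<Longrightarrow> norm (F s) \<le> norm (s - 1) * (C * 2 powr (- Re s))" and "C \<ge> 0"
    and R: "norm w \<le> R" "R + 1 \<le> real j"
  shows "norm (pochhammer (w - 1) (Suc j) / fact (j + 2) * F (w + of_nat j + 1))
      \<le> C * (pochhammer (R + 1) (Suc j) / fact (j + 2) * ((R + real j + 1) * 2 powr (R - (real j + 1))))"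
proof -
  have R0: "R \<ge> 0" using R(1) norm_ge_zero order_trans by blast
  have re: "Re w \<ge> - R" using abs_Re_le_cmod[of w] R by linarith
  then have re2: "Re (w + of_nat j + 1) \<ge> 2" using R by simp
  have "norm (F (w + of_nat j + 1)) \<le> norm (w + of_nat j) * (C * 2 powr (- Re (w + of_nat j + 1)))"
    using F[OF re2] by simp
  also have "\<dots> \<le> (R + real j + 1) * (C * 2 powr (R - (real j + 1)))"
  proof (rule mult_mono)
    show "norm (w + of_nat j) \<le> R + real j + 1"
      using norm_triangle_ineq[of w "of_nat j"] R by simp
    show "C * 2 powr (- Re (w + of_nat j + 1)) \<le> C * 2 powr (R - (real j + 1))"
      using re \<open>C \<ge> 0\<close> by (intro mult_left_mono powr_mono) auto
  qed (use R0 \<open>C \<ge> 0\<close> in auto)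
  finally have 1: "norm (F (w + of_nat j + 1)) \<le> (R + real j + 1) * (C * 2 powr (R - (real j + 1)))" .
  have 2: "norm (pochhammer (w - 1) (Suc j)) \<le> pochhammer (R + 1) (Suc j)"
  proof -
    have "pochhammer (norm w + 1) (Suc j) \<le> pochhammer (R + 1) (Suc j)"
      unfolding pochhammer_prod using R by (intro prod_mono) auto
    with norm_pochhammer_le[of w "Suc j"] show ?thesis by linarith
  qed
  have "norm (pochhammer (w - 1) (Suc j) / fact (j + 2) * F (w + of_nat j + 1)) =
     norm (pochhammer (w - 1) (Suc j)) / fact (j + 2) * norm (F (w + of_nat j + 1))"
    by (simp only: norm_mult norm_divide norm_fact)
  also have "\<dots> \<le> pochhammer (R + 1) (Suc j) / fact (j + 2) * ((R + real j + 1) * (C * 2 powr (R - (real j + 1))))"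
    using R0 by (intro mult_mono divide_right_mono 1 2 divide_nonneg_nonneg pochhammer_nonneg) auto
  finally show ?thesis by (simp only: mult_ac)
qed

lemma zeta_step_holomorphic:
  assumes hol: "F holomorphic_on {s. Re s > a}"
    and F: "\<And>s. Re s > 1 \<Longrightarrow> F s = (s - 1) * zeta_tail s"
  shows "zeta_step F holomorphic_on {s. Re s > a - 1}"
proof -
  obtain C where C: "C \<ge> 0" "\<And>s. Re s \<ge> 2 \<Longrightarrow> norm (zeta_tail s) \<le> C * 2 powr (- Re s)"
    using norm_zeta_tail_le by blast
  have bound: "norm (F s) \<le> norm (s - 1) * (C * 2 powr (- Re s))" if "Re s \<ge> 2" for s
    using C(2)[OF that] that by (subst F) (auto simp: norm_mult intro!: mult_left_mono)
  have "(\<lambda>s. \<Sum>j. pochhammer (s - 1) (Suc j) / fact (j + 2) * F (s + of_nat j + 1))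
          holomorphic_on {s. Re s > a - 1}"
  proof (rule holomorphic_on_suminf)
    show "open {s. Re s > a - 1}" by (rule open_halfspace_Re_gt)
    fix n
    have "(F \<circ> (\<lambda>s. s + of_nat n + 1)) holomorphic_on {s. Re s > a - 1}"
      by (rule holomorphic_on_compose_gen[OF _ hol]) (auto intro!: holomorphic_intros)
    then show "(\<lambda>s. pochhammer (s - 1) (Suc n) / fact (n + 2) * F (s + of_nat n + 1))
             holomorphic_on {s. Re s > a - 1}"
      unfolding pochhammer_prod o_def by (intro holomorphic_intros) auto
  next
    fix z :: complex and d :: real
    define R where "R = norm z + \<bar>d\<bar>"
    have R: "R \<ge> 0" by (simp add: R_def)
    show "\<exists>M. summable M \<and> (\<forall>\<^sub>F n in sequentially. \<forall>w\<in>cball z d.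
              norm (pochhammer (w - 1) (Suc n) / fact (n + 2) * F (w + of_nat n + 1)) \<le> M n)"
    proof (intro exI conjI)
      show "summable (\<lambda>j. C * (pochhammer (R + 1) (Suc j) / fact (j + 2) * ((R + real j + 1) * 2 powr (R - (real j + 1)))))"
        by (intro summable_mult summable_pochhammer_majorant R)
      show "\<forall>\<^sub>F n in sequentially. \<forall>w\<in>cball z d.
              norm (pochhammer (w - 1) (Suc n) / fact (n + 2) * F (w + of_nat n + 1))
              \<le> C * (pochhammer (R + 1) (Suc n) / fact (n + 2) * ((R + real n + 1) * 2 powr (R - (real n + 1))))"
        using eventually_ge_at_top[of "nat \<lceil>R + 1\<rceil>"]
      proof eventually_elim
        case (elim n)
        then have n: "R + 1 \<le> real n" by linarith
        show ?case
        proof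
          fix w assume "w \<in> cball z d"
          then have "norm w \<le> R"
            using norm_triangle_ineq[of z "w - z"] by (auto simp: R_def dist_norm norm_minus_commute)
          then show "norm (pochhammer (w - 1) (Suc n) / fact (n + 2) * F (w + of_nat n + 1))
              \<le> C * (pochhammer (R + 1) (Suc n) / fact (n + 2) * ((R + real n + 1) * 2 powr (R - (real n + 1))))"
            using n by (intro zeta_step_bound bound C)
        qed
      qed
    qed
  qed
  then show ?thesis
    unfolding zeta_step_def[abs_def] by (intro holomorphic_intros)
qed

text \<open>The telescoping is done for the partial sums \<open>P n\<close>, where it is a finite
  sum of binomial series. Tannery's theorem then lets \<open>n\<close> tend to infinity under the
  sum over \<open>j\<close>, with the majorant of \<open>zeta_step_bound\<close>.\<close>

lemma zeta_step_fixpoint: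
  assumes s: "Re s > 1"
  shows "zeta_step (\<lambda>s. (s - 1) * zeta_tail s) s = (s - 1) * zeta_tail s"
proof -
  define d where "d j = pochhammer (s - 1) (Suc j) / fact (j + 2)" for j
  define P where "P n w = (w - 1) * (\<Sum>k<n. 1 / of_nat (k + 2) powr w :: complex)" for n w
  define lim where "lim w = (w - 1) * zeta_tail w" for w
  \<comment> \<open>Binomial series of \<open>(i + 1) powr (1 - s)\<close> around
    \<open>i + 2\<close>, with its first two terms moved to the right. The coefficient of index
    \<open>j + 2\<close> factors as \<open>d j * (s + of_nat j)\<close>, and the second factor is
    the \<open>w - 1\<close> of \<open>P\<close> at \<open>w = s + of_nat j + 1\<close>.\<close>
  have ser: "(\<lambda>j. d j * ((s + of_nat j) * (1 / of_nat (i + 2) powr (s + of_nat j + 1)))) sums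
      (of_nat (i + 1) powr (1 - s) - of_nat (i + 2) powr (1 - s) - (s - 1) * (1 / of_nat (i + 2) powr s))" for i
  proof -
    define x :: complex where "x = of_nat (i + 2)"
    have "real (i + 2) + (-1) = real (i + 1)" by simp
    then have "(\<lambda>n. ((1 - s) gchoose n) * x powr ((1 - s) - of_nat n) * (-1) ^ n) sums of_nat (i + 1) powr (1 - s)"
      using gen_binomial_complex''[of "-1" "real (i + 2)" "1 - s"] by (simp add: x_def)
    also have "(\<lambda>n. ((1 - s) gchoose n) * x powr ((1 - s) - of_nat n) * (-1) ^ n) =
        (\<lambda>n. pochhammer (s - 1) n / fact n * x powr ((1 - s) - of_nat n))"
    proof
      fix n
      have "(- 1) ^ n * (- 1) ^ n = (1 :: complex)" by (simp flip: power_mult_distrib)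
      moreover have "e * p / f * y * e = (e * e) * (p / f * y)" for e p f y :: complex by (simp add: mult_ac)
      ultimately show "((1 - s) gchoose n) * x powr ((1 - s) - of_nat n) * (-1) ^ n =
          pochhammer (s - 1) n / fact n * x powr ((1 - s) - of_nat n)"
        by (simp only: gbinomial_pochhammer minus_diff_eq mult_1)
    qed
    finally have "(\<lambda>n. pochhammer (s - 1) n / fact n * x powr ((1 - s) - of_nat n)) sums of_nat (i + 1) powr (1 - s)" .
    from sums_split_initial_segment[OF this, of 2]
    have 1: "(\<lambda>j. pochhammer (s - 1) (j + 2) / fact (j + 2) * x powr ((1 - s) - of_nat (j + 2))) sums
      (of_nat (i + 1) powr (1 - s) - x powr (1 - s) - (s - 1) * x powr (- s))"
      by (simp add: numeral_2_eq_2 algebra_simps)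
    have "pochhammer (s - 1) (j + 2) = pochhammer (s - 1) (Suc j) * (s + of_nat j)" for j
      using pochhammer_Suc[of "s - 1" "Suc j"] by (simp add: algebra_simps)
    moreover have "x powr ((1 - s) - of_nat (j + 2)) = 1 / x powr (s + of_nat j + 1)" for j
    proof -
      have "(1 - s) - of_nat (j + 2) = - (s + of_nat j + 1)" by simp
      then show ?thesis by (simp only: powr_minus divide_inverse mult_1)
    qed
    moreover have "x powr (- s) = 1 / x powr s" by (simp only: powr_minus divide_inverse mult_1)
    ultimately show ?thesis using 1 unfolding d_def x_def by (simp only: times_divide_eq_left times_divide_eq_right mult_1_right mult.assoc)
  qed
  have part: "(\<lambda>j. d j * P n (s + of_nat j + 1)) sums
      (1 - of_nat (n + 1) powr (1 - s) - P n s)" for n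
  proof -
    have "(\<lambda>j. \<Sum>i<n. d j * ((s + of_nat j) * (1 / of_nat (i + 2) powr (s + of_nat j + 1)))) sums
      (\<Sum>i<n. of_nat (i + 1) powr (1 - s) - of_nat (i + 2) powr (1 - s) - (s - 1) * (1 / of_nat (i + 2) powr s))"
      by (intro sums_sum ser)
    also have "(\<Sum>i<n. of_nat (i + 1) powr (1 - s) - of_nat (i + 2) powr (1 - s) - (s - 1) * (1 / of_nat (i + 2) powr s))
       = (\<Sum>i<n. of_nat (i + 1) powr (1 - s) - of_nat (Suc i + 1) powr (1 - s)) - P n s"
      by (simp add: sum_subtractf P_def sum_distrib_left)
    also have "(\<Sum>i<n. of_nat (i + 1) powr (1 - s) - of_nat (Suc i + 1) powr (1 - s)) = 1 - of_nat (n + 1) powr (1 - s)"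
      by (subst sum_lessThan_telescope') simp
    finally show ?thesis
      by (simp add: P_def sum_distrib_left mult.assoc)
  qed
  obtain C where C: "C \<ge> 0" "\<And>s n. Re s \<ge> 2 \<Longrightarrow> norm (\<Sum>k<n. 1 / of_nat (k + 2) powr s :: complex) \<le> C * 2 powr (- Re s)"
    using norm_zeta_tail_partial_le by blast
  have P_bound: "norm (P n w) \<le> norm (w - 1) * (C * 2 powr (- Re w))" if "Re w \<ge> 2" for n w
    using C(2)[OF that, of n] by (auto simp: P_def norm_mult intro!: mult_left_mono)
  have P_lim: "(\<lambda>n. P n w) \<longlonglongrightarrow> lim w" if "Re w > 1" for w
    unfolding P_def lim_def using zeta_tail_sums[OF that] by (intro tendsto_intros) (simp add: sums_def)
  let ?M = "\<lambda>j. C * (pochhammer (norm s + 1) (Suc j) / fact (j + 2) * ((norm s + real j + 1) * 2 powr (norm s - (real j + 1))))"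
  have ev: "\<forall>\<^sub>F j in sequentially. \<forall>n. norm (d j * P n (s + of_nat j + 1)) \<le> ?M j"
    using eventually_ge_at_top[of "nat \<lceil>norm s + 1\<rceil>"]
  proof eventually_elim
    case (elim j)
    then have "norm s + 1 \<le> real j" by linarith
    then show ?case
      unfolding d_def by (intro allI zeta_step_bound P_bound C) auto
  qed
  have ev2: "\<forall>\<^sub>F (j, n) in sequentially \<times>\<^sub>F sequentially. norm (d j * P n (s + of_nat j + 1)) \<le> ?M j"
    using ev by (subst (asm) eventually_prod1[of sequentially, symmetric]) (auto elim!: eventually_mono)
  have M: "summable ?M" by (intro summable_mult summable_pochhammer_majorant) auto
  have "(\<lambda>n. \<Sum>j. d j * P n (s + of_nat j + 1)) \<longlonglongrightarrow> (\<Sum>j. d j * lim (s + of_nat j + 1))"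
    using s by (intro tannerys_theorem[THEN conjunct2, THEN conjunct2, OF _ ev2 M] tendsto_intros P_lim) auto
  also have "(\<lambda>n. \<Sum>j. d j * P n (s + of_nat j + 1)) = (\<lambda>n. 1 - of_nat (n + 1) powr (1 - s) - P n s)"
    using part by (auto simp: sums_iff)
  finally have 1: "(\<lambda>n. 1 - of_nat (n + 1) powr (1 - s) - P n s) \<longlonglongrightarrow> (\<Sum>j. d j * lim (s + of_nat j + 1))" .
  have "(\<lambda>n. real (n + 1) powr (1 - Re s)) \<longlonglongrightarrow> 0"
    using s by real_asymp
  moreover have "norm (of_nat (n + 1) powr (1 - s) :: complex) = real (n + 1) powr (1 - Re s)" for n
    using norm_powr_real_powr[of "of_nat (n + 1)" "1 - s"] by simp
  ultimately have "(\<lambda>n. of_nat (n + 1) powr (1 - s) :: complex) \<longlonglongrightarrow> 0"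
    by (auto intro: tendsto_norm_zero_cancel)
  then have "(\<lambda>n. 1 - of_nat (n + 1) powr (1 - s) - P n s) \<longlonglongrightarrow> 1 - 0 - lim s"
    by (intro tendsto_intros P_lim s)
  with 1 have "(\<Sum>j. d j * lim (s + of_nat j + 1)) = 1 - lim s"
    using LIMSEQ_unique by fastforce
  then show ?thesis
    by (simp add: zeta_step_def d_def lim_def)
qed

lemma entire_iter_eq:
  assumes "Re s > 1 - real m"
  shows "entire_iter (Suc m) s = entire_iter m s"
  using assms
proof (induction m arbitrary: s)
  case 0
  then show ?case using zeta_step_fixpoint[of s] by (simp add: entire_iter_def)
next
  case (Suc m)
  have "zeta_step (entire_iter (Suc m)) s = zeta_step (entire_iter m) s"
    unfolding zeta_step_def using Suc.prems by (intro arg_cong[of _ _ "\<lambda>x. 1 - x"] suminf_cong) (simp add: Suc.IH)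
  then show ?case by (simp add: entire_iter_def)
qed

lemma entire_iter_eq_le:
  assumes "m \<le> n" "Re s > 1 - real m"
  shows "entire_iter n s = entire_iter m s"
  using assms(1)
proof (induction n rule: dec_induct)
  case (step n)
  then show ?case using entire_iter_eq[of n s] assms(2) by simp
qed simp

lemma entire_iter_holomorphic: "entire_iter m holomorphic_on {s. Re s > 1 - real m}"
proof (induction m)
  case 0
  then show ?case
    unfolding entire_iter_def by (auto intro!: holomorphic_intros zeta_tail_holomorphic)
next
  case (Suc m)
  have "entire_iter m s = (s - 1) * zeta_tail s" if "Re s > 1" for s
    using entire_iter_eq_le[of 0 m s] that by (simp add: entire_iter_def)
  from zeta_step_holomorphic[OF Suc this] show ?case
    by (simp add: entire_iter_def algebra_simps)
qed

lemma zeta_exists: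
  "\<exists>f. f holomorphic_on - {1} \<and> (\<forall>s. Re s > 1 \<longrightarrow> (\<lambda>k. 1 / of_nat (Suc k) powr s) sums f s) \<and> f 1 = 0"
proof -
  \<comment> \<open>The condition \<open>m \<ge> 2 - Re s\<close> puts \<open>s\<close> at distance
    at least 1 inside the half-plane where iterate \<open>m\<close> is valid; all iterates valid at
    \<open>s\<close> agree there.\<close>
  define E where "E s = entire_iter (nat \<lceil>2 - Re s\<rceil>) s" for s
  have E_eq: "E s = entire_iter m s" if "Re s > 1 - real m" for s m
  proof -
    have "Re s > 1 - real (nat \<lceil>2 - Re s\<rceil>)" by linarith
    with that show ?thesis
      unfolding E_def using entire_iter_eq_le[of m "nat \<lceil>2 - Re s\<rceil>" s] entire_iter_eq_le[of "nat \<lceil>2 - Re s\<rceil>" m s]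
      by (metis nat_le_linear)
  qed
  have "E holomorphic_on {s. Re s > 1 - real m}" for m
    using entire_iter_holomorphic[of m] by (rule holomorphic_transform) (simp add: E_eq)
  then have "E holomorphic_on (\<Union>m. {s. Re s > 1 - real m})"
    by (intro holomorphic_on_UN_open open_halfspace_Re_gt)
  also have "(\<Union>m. {s. Re s > 1 - real m}) = UNIV"
  proof -
    have "\<exists>m. Re s > 1 - real m" for s
      using reals_Archimedean2[of "1 - Re s"] by (auto simp: algebra_simps)
    then show ?thesis by auto
  qed
  finally have E: "E holomorphic_on UNIV" .
  \<comment> \<open>Undoes the two normalisations: the term 1 omitted from \<open>zeta_tail\<close>,
    and the factor \<open>s - 1\<close> that removed the pole.\<close>
  define f where "f s = (if s = 1 then 0 else 1 + E s / (s - 1))" for s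
  have "(\<lambda>s. 1 + E s / (s - 1)) holomorphic_on - {1}"
    by (intro holomorphic_intros holomorphic_on_subset[OF E]) auto
  then have "f holomorphic_on - {1}"
    by (rule holomorphic_transform) (auto simp: f_def)
  moreover have "(\<lambda>k. 1 / of_nat (Suc k) powr s) sums f s" if s: "Re s > 1" for s
  proof -
    have "E s = (s - 1) * zeta_tail s" "s \<noteq> 1"
      using E_eq[of 0 s] s by (auto simp: entire_iter_def)
    then have "f s = 1 + zeta_tail s" by (simp add: f_def)
    moreover have "(\<lambda>k. 1 / of_nat (Suc (Suc k)) powr s) sums zeta_tail s"
      using zeta_tail_sums[OF s] by simp
    ultimately show ?thesis
      using sums_Suc[of "\<lambda>k. 1 / of_nat (Suc k) powr s" "zeta_tail s"] by (simp add: add.commute)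
  qed
  ultimately show ?thesis by (intro exI[of _ f]) (auto simp: f_def)
qed

text \<open>The definite description needs uniqueness: the punctured plane is connected, so
  agreement of two continuations spreads from the half-plane of convergence, and the prescribed
  value at 1 settles the remaining point.\<close>

lemma zeta_properties:
  shows zeta_holomorphic: "zeta holomorphic_on - {1}"
    and zeta_sums: "\<And>s. Re s > 1 \<Longrightarrow> (\<lambda>k. 1 / of_nat (Suc k) powr s) sums zeta s"
proof -
  let ?P = "\<lambda>f. f holomorphic_on - {1} \<and> (\<forall>s. Re s > 1 \<longrightarrow> (\<lambda>k. 1 / of_nat (Suc k) powr s) sums f s) \<and> f 1 = 0"
  have "\<exists>!f. ?P f"
  proof (rule ex_ex1I[OF zeta_exists])
    fix f g assume f: "?P f" and g: "?P g"
    have "f s = g s" if "s \<in> - {1}" for s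
    proof (rule analytic_continuation_open[of "{s. Re s > 1}" "- {1}" f g])
      show "open {s. Re s > 1}" by (rule open_halfspace_Re_gt)
      have "2 \<in> {s. Re s > 1}" by simp
      then show "{s. Re s > 1} \<noteq> {}" by blast
      show "connected (- {1::complex})" by (rule connected_punctured_universe) simp
      show "f z = g z" if "z \<in> {s. Re s > 1}" for z
        using f g that sums_unique2 by blast
    qed (use f g that in auto)
    with f g show "f = g" by (intro ext) (metis ComplI singletonD)
  qed
  from theI'[OF this] have "?P zeta" unfolding zeta_def .
  then show "zeta holomorphic_on - {1}" "\<And>s. Re s > 1 \<Longrightarrow> (\<lambda>k. 1 / of_nat (Suc k) powr s) sums zeta s"
    by auto
qed

subsection \<open>The zeta-function as a Fourier transform\<close>

text \<open>The integral of \<open>(exp u - n) * exp (- s * u)\<close> over \<open>[ln n, ln (n + 1)]\<close>.\<close>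

definition frac_cell :: "nat \<Rightarrow> complex \<Rightarrow> complex" where
  "frac_cell n s = (of_nat (n + 1) powr (1 - s) - of_nat n powr (1 - s)) / (1 - s) +
                   of_nat n * (of_nat (n + 1) powr (- s) - of_nat n powr (- s)) / s"

lemma exp_ln_powr:
  assumes "n > 0"
  shows "exp (a * complex_of_real (ln (real n))) = of_nat n powr a"
  using assms by (simp add: powr_def Ln_of_nat)

lemma has_integral_frac_cell:
  assumes n: "n > 0" and s: "s \<noteq> 0" "s \<noteq> 1"
  shows "((\<lambda>u. of_real (frac (exp u)) * exp (- s * of_real u)) has_integral frac_cell n s)
           {ln (real n)..ln (real (n + 1))}"
proof -
  let ?G = "\<lambda>u. exp ((1 - s) * of_real u) / (1 - s) + of_nat n * (exp (- s * of_real u) / s)"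
  have "((\<lambda>u. (of_real (exp u) - of_nat n) * exp (- s * of_real u)) has_integral
          (?G (ln (real (n + 1))) - ?G (ln (real n)))) {ln (real n)..ln (real (n + 1))}"
  proof (rule fundamental_theorem_of_calculus)
    show "ln (real n) \<le> ln (real (n + 1))" using n by simp
    fix u
    have "((\<lambda>z. exp ((1 - s) * z) / (1 - s) + of_nat n * (exp (- s * z) / s)) has_field_derivative
             (exp ((1 - s) * of_real u) - of_nat n * exp (- s * of_real u))) (at (of_real u))"
      using s by (auto intro!: derivative_eq_intros)
    also have "exp ((1 - s) * of_real u) - of_nat n * exp (- s * of_real u)
        = (of_real (exp u) - of_nat n) * exp (- s * of_real u)"
    proof -
      have "(1 - s) * of_real u = of_real u + - s * of_real u" by (simp add: algebra_simps)
      then show ?thesis by (simp only: exp_add exp_of_real left_diff_distrib)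
    qed
    finally show "(?G has_vector_derivative (of_real (exp u) - of_nat n) * exp (- s * of_real u))
       (at u within {ln (real n)..ln (real (n + 1))})"
      by (rule has_vector_derivative_real_field)
  qed
  also have "?G (ln (real (n + 1))) - ?G (ln (real n)) = frac_cell n s"
    unfolding exp_ln_powr[OF n] exp_ln_powr[OF add_pos_nonneg[OF n zero_le]] frac_cell_def
    by (simp add: diff_divide_distrib ring_distribs)
  finally show ?thesis
  proof (rule has_integral_spike[rotated 2])
    show "negligible {ln (real (n + 1))}" by simp
    fix u assume u: "u \<in> {ln (real n)..ln (real (n + 1))} - {ln (real (n + 1))}"
    then have "exp u < real (n + 1)" "real n \<le> exp u"
      using n exp_less_cancel_iff[of u "ln (real (n + 1))"] exp_le_cancel_iff[of "ln (real n)" u] by auto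
    then have "\<lfloor>exp u\<rfloor> = int n" by linarith
    then show "of_real (frac (exp u)) * exp (- s * of_real u) = (of_real (exp u) - of_nat n) * exp (- s * of_real u)"
      by (simp add: frac_def)
  qed
qed

text \<open>The cell has length at most \<open>1 / n\<close>, and \<open>frac\<close> is at most 1.
  The gain of \<open>1 / n\<close> over the Dirichlet series makes the sum over cells converge for
  \<open>Re s > 0\<close>, past the critical line.\<close>

lemma norm_frac_cell_le:
  assumes n: "n > 0" and s: "Re s > 0" "s \<noteq> 1"
  shows "norm (frac_cell n s) \<le> real n powr (- Re s - 1)"
proof -
  have "norm (frac_cell n s) \<le> real n powr (- Re s) * measure lborel {ln (real n)..ln (real (n + 1))}"
  proof (rule has_integral_bound_real[OF _ _ has_integral_frac_cell])
    fix u assume "u \<in> {ln (real n)..ln (real (n + 1))} - {}"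
    then have "- Re s * u \<le> - Re s * ln (real n)"
      using s by (auto intro!: mult_left_mono)
    then have "exp (- Re s * u) \<le> real n powr (- Re s)"
      using n by (simp add: powr_def)
    then have "\<bar>frac (exp u)\<bar> * exp (- Re s * u) \<le> 1 * real n powr (- Re s)"
      using frac_lt_1[of "exp u"] by (intro mult_mono) auto
    then show "norm (of_real (frac (exp u)) * exp (- s * of_real u)) \<le> real n powr (- Re s)"
      by (simp add: norm_mult)
  qed (use n s in auto)
  also have "measure lborel {ln (real n)..ln (real (n + 1))} \<le> 1 / real n"
    using n ln_diff_le[of "real (n + 1)" "real n"] by simp
  finally show ?thesis
    using n by (simp add: powr_diff mult_left_mono)
qed

text \<open>Writing \<open>m powr (1 - s)\<close> as \<open>m * m powr (- s)\<close>, the terms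
  weighted by \<open>n\<close> combine with part of the difference quotient. What is left
  telescopes, apart from one term of the Dirichlet series.\<close>

lemma s_frac_cell:
  assumes n: "n > 0" and s: "s \<noteq> 0" "s \<noteq> 1"
  shows "s * frac_cell n s = (of_nat (n + 1) powr (1 - s) - of_nat n powr (1 - s)) / (1 - s) - of_nat (n + 1) powr (- s)"
proof -
  have 1: "(of_nat m :: complex) powr (1 - s) = of_nat m * of_nat m powr (- s)" if "m > 0" for m
    using that powr_add[of "of_nat m :: complex" 1 "- s"] by simp
  define X where "X = of_nat (n + 1) * of_nat (n + 1) powr (- s) - of_nat n * of_nat n powr (- s)"
  have "s * (X / (1 - s)) = X / (1 - s) - X"
    using s by (simp add: field_simps)
  moreover have "of_nat n * (of_nat (n + 1) powr (- s) - of_nat n powr (- s)) - X = - (of_nat (n + 1) powr (- s))"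
    by (simp add: X_def algebra_simps)
  ultimately show ?thesis
    unfolding frac_cell_def 1[OF n] 1[OF add_pos_nonneg[OF n zero_le]] X_def[symmetric] using s
    by (simp add: distrib_left)
qed

text \<open>Truncated form of \<open>zeta s = s / (s - 1) - s * J\<close>, where \<open>J\<close> is
  the integral of \<open>frac x * x powr (- s - 1)\<close> over \<open>x \<ge> 1\<close>, taken in
  the variable \<open>u = ln x\<close>.\<close>

lemma sum_frac_cell:
  assumes s: "s \<noteq> 0" "s \<noteq> 1"
  shows "s * (\<Sum>n<N. frac_cell (Suc n) s) =
     s / (s - 1) + of_nat (N + 1) powr (1 - s) / (1 - s) - (\<Sum>k<N+1. 1 / of_nat (Suc k) powr s)"
proof (induction N)
  case 0
  have "1 / (1 - s) = - (1 / (s - 1))"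
    using minus_divide_right[of 1 "s - 1"] by simp
  moreover have "s / (s - 1) - 1 / (s - 1) = 1"
    using s by (simp flip: diff_divide_distrib)
  ultimately show ?case by simp
next
  case (Suc N)
  have "s * (\<Sum>n<Suc N. frac_cell (Suc n) s) = s * (\<Sum>n<N. frac_cell (Suc n) s) + s * frac_cell (Suc N) s"
    by (simp add: distrib_left)
  also have "s * frac_cell (Suc N) s = of_nat (Suc N + 1) powr (1 - s) / (1 - s) - of_nat (N + 1) powr (1 - s) / (1 - s)
      - 1 / of_nat (Suc (N + 1)) powr s"
    using s by (subst s_frac_cell) (auto simp: powr_minus divide_inverse algebra_simps)
  finally show ?case unfolding Suc.IH by simp
qed

lemma powr_one_minus_tendsto_0:
  assumes "Re s > 1"
  shows "(\<lambda>n. of_nat (n + 1) powr (1 - s) :: complex) \<longlonglongrightarrow> 0"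
proof (rule tendsto_norm_zero_cancel)
  have "norm (of_nat (n + 1) powr (1 - s) :: complex) = real (n + 1) powr (1 - Re s)" for n
    using norm_powr_real_powr[of "of_nat (n + 1)" "1 - s"] by simp
  moreover have "(\<lambda>n. real (n + 1) powr (1 - Re s)) \<longlonglongrightarrow> 0"
    using assms by real_asymp
  ultimately show "(\<lambda>n. norm (of_nat (n + 1) powr (1 - s) :: complex)) \<longlonglongrightarrow> 0"
    by (simp only:)
qed

text \<open>For \<open>Re s > 1\<close> the boundary term of \<open>sum_frac_cell\<close> vanishes
  in the limit. Both sides are holomorphic on the half-plane \<open>Re s > 0\<close> without 1,
  which is connected, so the identity reaches the critical line.\<close>

lemma frac_cell_sums:
  assumes s: "Re s > 0" "s \<noteq> 1"
  shows "(\<lambda>n. frac_cell (Suc n) s) sums (1 / (s - 1) - zeta s / s)"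
proof -
  define D where "D = {s. Re s > 0} - {1::complex}"
  have "open D" unfolding D_def by (intro open_Diff open_halfspace_Re_gt) auto
  have "connected D"
    unfolding D_def by (rule connected_open_delete[OF open_halfspace_Re_gt convex_connected[OF convex_halfspace_Re_gt]]) simp
  have summ: "summable (\<lambda>n. frac_cell (Suc n) s)" if "s \<in> D" for s
  proof (rule summable_comparison_test')
    show "summable (\<lambda>k. real (k + 1) powr (- (Re s + 1)))"
      using that by (intro summable_shift_powr) (auto simp: D_def)
    show "norm (frac_cell (Suc n) s) \<le> real (n + 1) powr (- (Re s + 1))" if "n \<ge> 0" for n
      using norm_frac_cell_le[of "Suc n" s] \<open>s \<in> D\<close> by (simp add: D_def)
  qed
  have "(\<lambda>s. \<Sum>n. frac_cell (Suc n) s) holomorphic_on D"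
  proof (rule holomorphic_on_suminf[OF \<open>open D\<close>])
    show "frac_cell (Suc n) holomorphic_on D" for n
      unfolding frac_cell_def[abs_def] D_def by (auto intro!: holomorphic_intros)
    fix z d assume z: "z \<in> D" and d: "d > 0" "cball z d \<subseteq> D"
    have "z - of_real d \<in> cball z d" using d by (simp add: dist_norm)
    then have "z - of_real d \<in> D" using d by blast
    then have pos: "Re z - d > 0" by (simp add: D_def)
    show "\<exists>M. summable M \<and> (\<forall>\<^sub>F n in sequentially. \<forall>w\<in>cball z d. norm (frac_cell (Suc n) w) \<le> M n)"
    proof (intro exI conjI always_eventually allI ballI)
      show "summable (\<lambda>n. real (n + 1) powr (- (Re z - d + 1)))"
        using pos by (intro summable_shift_powr) simp
      fix n w assume w: "w \<in> cball z d"
      then have "w \<in> D" using d by blast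
      have "Re z - d \<le> Re w"
        using abs_Re_le_cmod[of "z - w"] w by (auto simp: dist_norm)
      have "norm (frac_cell (Suc n) w) \<le> real (Suc n) powr (- Re w - 1)"
        using \<open>w \<in> D\<close> by (intro norm_frac_cell_le) (auto simp: D_def)
      also have "\<dots> \<le> real (n + 1) powr (- (Re z - d + 1))"
        using \<open>Re z - d \<le> Re w\<close> by (auto intro!: powr_mono)
      finally show "norm (frac_cell (Suc n) w) \<le> real (n + 1) powr (- (Re z - d + 1))" .
    qed
  qed
  then have hol: "(\<lambda>s. s / (s - 1) - s * (\<Sum>n. frac_cell (Suc n) s)) holomorphic_on D"
    by (intro holomorphic_intros) (auto simp: D_def)
  have eq: "z / (z - 1) - z * (\<Sum>n. frac_cell (Suc n) z) = zeta z" if z: "z \<in> {s. Re s > 1}" for z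
  proof -
    have z': "z \<noteq> 0" "z \<noteq> 1" "z \<in> D" using z by (auto simp: D_def)
    have "(\<lambda>N. z * (\<Sum>n<N. frac_cell (Suc n) z)) \<longlonglongrightarrow> z * (\<Sum>n. frac_cell (Suc n) z)"
      by (intro tendsto_intros summable_LIMSEQ summ z')
    moreover have "(\<lambda>N. z * (\<Sum>n<N. frac_cell (Suc n) z)) \<longlonglongrightarrow> z / (z - 1) + 0 / (1 - z) - zeta z"
    proof -
      have "(\<lambda>N. \<Sum>k<N+1. 1 / of_nat (Suc k) powr z) \<longlonglongrightarrow> zeta z"
        using zeta_sums[of z] z LIMSEQ_ignore_initial_segment[of _ _ 1] unfolding sums_def by blast
      then show ?thesis
        unfolding sum_frac_cell[OF z'(1,2)] using z z'
        by (intro tendsto_intros powr_one_minus_tendsto_0) auto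
    qed
    ultimately have "z * (\<Sum>n. frac_cell (Suc n) z) = z / (z - 1) + 0 / (1 - z) - zeta z"
      by (rule LIMSEQ_unique)
    then show ?thesis by simp
  qed
  have "s \<in> D" using s by (simp add: D_def)
  have "s / (s - 1) - s * (\<Sum>n. frac_cell (Suc n) s) = zeta s"
  proof (rule analytic_continuation_open[of "{s. Re s > 1}" D "\<lambda>s. s / (s - 1) - s * (\<Sum>n. frac_cell (Suc n) s)" zeta])
    show "open {s. Re s > 1}" by (rule open_halfspace_Re_gt)
    have "2 \<in> {s. Re s > 1}" by simp
    then show "{s. Re s > 1} \<noteq> {}" by blast
    show "zeta holomorphic_on D"
      by (rule holomorphic_on_subset[OF zeta_holomorphic]) (auto simp: D_def)
  qed (use \<open>open D\<close> \<open>connected D\<close> \<open>s \<in> D\<close> hol eq in \<open>auto simp: D_def\<close>)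
  moreover have "s \<noteq> 0" using s by auto
  ultimately have "(\<Sum>n. frac_cell (Suc n) s) = 1 / (s - 1) - zeta s / s"
    using s by (simp add: field_simps)
  with summable_sums[OF summ[OF \<open>s \<in> D\<close>]] show ?thesis by simp
qed

definition frac_exp :: "real \<Rightarrow> real" where
  "frac_exp u = frac (exp u) * exp (- u / 2)"

lemma frac_exp_measurable [measurable]: "frac_exp \<in> borel_measurable borel"
  unfolding frac_exp_def[abs_def] frac_def by measurable

lemma frac_exp_nonneg: "frac_exp u \<ge> 0"
  by (simp add: frac_exp_def)

lemma frac_exp_le: "frac_exp u \<le> exp (- \<bar>u\<bar> / 2)"
proof (cases "u \<ge> 0")
  case True
  then show ?thesis
    using frac_lt_1[of "exp u"] by (simp add: frac_exp_def)
next
  case False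
  then have "frac (exp u) = exp u" by (subst frac_eq) auto
  then show ?thesis using False by (simp add: frac_exp_def flip: exp_add)
qed

lemma integrable_exp_abs:
  assumes "a > 0"
  shows "integrable lborel (\<lambda>u::real. exp (- \<bar>u\<bar> * a))"
proof -
  have 1: "integrable lborel (\<lambda>u. indicator {0<..} u *\<^sub>R exp (- (u * a)))"
    using integrable_I0i_exp_mscale[OF assms] by (simp add: set_integrable_def)
  have 2: "integrable lborel (\<lambda>u. indicator {0<..} (- u) *\<^sub>R exp (- (- u * a)))"
    using lborel_integrable_real_affine[OF 1, of "-1" 0] by simp
  have "integrable lborel (\<lambda>u. indicator {0<..} u *\<^sub>R exp (- (u * a)) + indicator {0<..} (- u) *\<^sub>R exp (- (- u * a)))"
    by (intro Bochner_Integration.integrable_add 1 2)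
  then show ?thesis
  proof (rule integrable_cong_AE_imp)
    show "AE u in lborel. indicator {0<..} u *\<^sub>R exp (- (u * a)) + indicator {0<..} (- u) *\<^sub>R exp (- (- u * a)) = exp (- \<bar>u\<bar> * a)"
      using AE_lborel_singleton[of "0::real"] by eventually_elim (auto simp: indicator_def)
  qed simp
qed

lemma integrable_frac_exp: "integrable lborel frac_exp"
proof (rule Bochner_Integration.integrable_bound[OF integrable_exp_abs[of "1/2"]])
  show "AE u in lborel. norm (frac_exp u) \<le> norm (exp (- \<bar>u\<bar> * (1/2)))"
    using frac_exp_le frac_exp_nonneg by simp
qed auto

text \<open>Without a normalising factor; hence the \<open>2 * pi\<close> in
  \<open>plancherel\<close>.\<close>

definition fourier :: "(real \<Rightarrow> real) \<Rightarrow> real \<Rightarrow> complex" where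
  "fourier g t = (LINT u|lborel. of_real (g u) * cis (- t * u))"

lemma integrable_mult_cis:
  assumes "integrable lborel g"
  shows "integrable lborel (\<lambda>u. complex_of_real (g u) * cis (a * u))"
proof (rule Bochner_Integration.integrable_bound[OF assms])
  show "(\<lambda>u. complex_of_real (g u) * cis (a * u)) \<in> borel_measurable lborel"
    using assms by (auto simp: cis_conv_exp)
qed (auto simp: norm_mult)

lemma frac_exp_mult_cis:
  "of_real (frac_exp u) * cis (- t * u) = of_real (frac (exp u)) * exp (- Complex (1/2) t * of_real u)"
proof -
  have "exp (- Complex (1/2) t * of_real u) = of_real (exp (- u / 2)) * cis (- t * u)"
    by (simp add: exp_eq_polar complex_eq_iff)
  then show ?thesis by (simp only: frac_exp_def of_real_mult mult.assoc)
qed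

text \<open>On \<open>u > 0\<close> the integral is the series of cells,
  \<open>1 / (s - 1) - zeta s / s\<close>. On \<open>u < 0\<close> the fractional part of
  \<open>exp u\<close> is \<open>exp u\<close> itself, and the integral is
  \<open>1 / (1 - s)\<close>. The two rational terms cancel.\<close>

lemma fourier_frac_exp:
  "fourier frac_exp t = - zeta (Complex (1/2) t) / Complex (1/2) t"
proof -
  define s where "s = Complex (1/2) t"
  have s: "s \<noteq> 0" "s \<noteq> 1" "Re s = 1/2" by (auto simp: s_def complex_eq_iff)
  define g where "g u = complex_of_real (frac (exp u)) * exp (- s * of_real u)" for u
  have g_eq: "g u = of_real (frac_exp u) * cis (- t * u)" for u
    by (simp only: g_def s_def frac_exp_mult_cis)
  have int: "integrable lborel g"
    using integrable_mult_cis[OF integrable_frac_exp, of "- t"] by (simp add: g_eq[abs_def])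
  \<comment> \<open>Truncation points on cell boundaries, so that the integral from 0 to
    \<open>L N\<close> is a partial sum of cells.\<close>
  define L where "L N = ln (real (N + 1))" for N
  have pos: "(g has_integral (\<Sum>n<N. frac_cell (Suc n) s)) {0..L N}" for N
  proof (induction N)
    case (Suc N)
    have "(g has_integral frac_cell (Suc N) s) {L N..L (Suc N)}"
      using has_integral_frac_cell[of "Suc N" s] s by (simp add: g_def[abs_def] L_def)
    from has_integral_combine[OF _ _ Suc this] show ?case by (simp add: L_def)
  qed (simp add: L_def has_integral_refl)
  have neg: "(g has_integral (1 - of_nat (N + 1) powr (- (1 - s))) / (1 - s)) {- L N..0}" for N
  proof -
    have "((\<lambda>u. exp ((1 - s) * of_real u)) has_integral
        (exp ((1 - s) * of_real 0) / (1 - s) - exp ((1 - s) * of_real (- L N)) / (1 - s))) {- L N..0}"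
    proof (rule fundamental_theorem_of_calculus)
      show "- L N \<le> 0" by (simp add: L_def)
      fix u
      have "((\<lambda>z. exp ((1 - s) * z) / (1 - s)) has_field_derivative exp ((1 - s) * of_real u)) (at (of_real u))"
        using s by (auto intro!: derivative_eq_intros)
      then show "((\<lambda>x. exp ((1 - s) * of_real x) / (1 - s)) has_vector_derivative
            exp ((1 - s) * of_real u)) (at u within {- L N..0})"
        by (rule has_vector_derivative_real_field)
    qed
    also have "exp ((1 - s) * of_real 0) / (1 - s) - exp ((1 - s) * of_real (- L N)) / (1 - s)
        = (1 - of_nat (N + 1) powr (- (1 - s))) / (1 - s)"
      using exp_ln_powr[of "N + 1" "- (1 - s)"] by (simp add: L_def diff_divide_distrib algebra_simps)
    finally show ?thesis
    proof (rule has_integral_spike[rotated 2])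
      show "negligible {0::real}" by simp
      fix u :: real assume "u \<in> {- L N..0} - {0}"
      then have "frac (exp u) = exp u" by (subst frac_eq) auto
      then show "g u = exp ((1 - s) * of_real u)"
      proof -
        have "(1 - s) * of_real u = of_real u + - s * of_real u" by (simp add: algebra_simps)
        with \<open>frac (exp u) = exp u\<close> show ?thesis by (simp only: g_def exp_add exp_of_real)
      qed
    qed
  qed
  have both: "(LINT u|lborel. indicator {- L N..L N} u *\<^sub>R g u) =
      (1 - of_nat (N + 1) powr (- (1 - s))) / (1 - s) + (\<Sum>n<N. frac_cell (Suc n) s)" for N
  proof -
    have "(g has_integral (1 - of_nat (N + 1) powr (- (1 - s))) / (1 - s) + (\<Sum>n<N. frac_cell (Suc n) s)) {- L N..L N}"
      by (rule has_integral_combine[OF _ _ neg pos]) (auto simp: L_def)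
    moreover have "set_integrable lborel {- L N..L N} g"
      using integrable_mult_indicator[OF _ int, of "{- L N..L N}"] by (simp add: set_integrable_def)
    ultimately show ?thesis
      using set_borel_integral_eq_integral(2)[of "{- L N..L N}" g]
      by (simp add: integral_unique set_lebesgue_integral_def)
  qed
  have "(\<lambda>N. LINT u|lborel. indicator {- L N..L N} u *\<^sub>R g u) \<longlonglongrightarrow> (LINT u|lborel. g u)"
  proof (rule integral_dominated_convergence)
    show "integrable lborel (\<lambda>u. norm (g u))" using int by simp
    show "AE u in lborel. (\<lambda>N. indicator {- L N..L N} u *\<^sub>R g u) \<longlonglongrightarrow> g u"
    proof (rule AE_I2)
      fix u
      have "filterlim L at_top sequentially"
        unfolding L_def[abs_def] by real_asymp
      then have "\<forall>\<^sub>F N in sequentially. L N \<ge> \<bar>u\<bar>" by (simp add: filterlim_at_top)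
      then have "\<forall>\<^sub>F N in sequentially. indicator {- L N..L N} u *\<^sub>R g u = g u"
        by eventually_elim (auto simp: indicator_def)
      then show "(\<lambda>N. indicator {- L N..L N} u *\<^sub>R g u) \<longlonglongrightarrow> g u"
        by (rule tendsto_eventually)
    qed
    show "AE u in lborel. norm (indicator {- L N..L N} u *\<^sub>R g u) \<le> norm (g u)" for N
      by (auto simp: indicator_def)
  qed (use int in auto)
  moreover have "(\<lambda>N. (1 - of_nat (N + 1) powr (- (1 - s))) / (1 - s) + (\<Sum>n<N. frac_cell (Suc n) s))
     \<longlonglongrightarrow> (1 - 0) / (1 - s) + (1 / (s - 1) - zeta s / s)"
  proof (intro tendsto_intros)
    show "(\<lambda>N. of_nat (N + 1) powr (- (1 - s)) :: complex) \<longlonglongrightarrow> 0"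
      using powr_one_minus_tendsto_0[of "2 - s"] s by simp
    show "(\<lambda>N. \<Sum>n<N. frac_cell (Suc n) s) \<longlonglongrightarrow> 1 / (s - 1) - zeta s / s"
      using frac_cell_sums[of s] s by (simp add: sums_def)
  qed (use s in auto)
  ultimately have "(LINT u|lborel. g u) = (1 - 0) / (1 - s) + (1 / (s - 1) - zeta s / s)"
    unfolding both by (rule LIMSEQ_unique)
  also have "(1 - 0) / (1 - s) = - (1 / (s - 1))"
    by (metis diff_zero minus_diff_eq minus_divide_right)
  finally show ?thesis
    by (simp add: fourier_def g_eq s_def)
qed

lemma norm_fourier_frac_exp: "(norm (fourier frac_exp t))\<^sup>2 = zeta_sq t / (1/4 + t\<^sup>2)"
proof -
  have "(norm (Complex (1/2) t))\<^sup>2 = 1/4 + t\<^sup>2"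
    unfolding cmod_power2 by (simp add: power2_eq_square)
  then show ?thesis
    by (simp add: fourier_frac_exp norm_divide power_divide zeta_sq_def)
qed

lemma continuous_on_zeta_sq: "continuous_on A zeta_sq"
proof -
  have "continuous_on (- {1}) zeta"
    by (rule holomorphic_on_imp_continuous_on[OF zeta_holomorphic])
  then have "continuous_on A (\<lambda>t. zeta (Complex (1/2) t))"
    by (rule continuous_on_compose2) (auto simp: complex_eq_iff Complex_eq intro!: continuous_intros)
  then show ?thesis
    unfolding zeta_sq_def[abs_def] by (intro continuous_intros)
qed

subsection \<open>Plancherel's theorem\<close>

lemma Fubini_lborel_dominated:
  fixes F :: "real \<Rightarrow> real \<Rightarrow> 'a :: {banach, second_countable_topology}"
  assumes meas [measurable]: "case_prod F \<in> borel_measurable (lborel \<Otimes>\<^sub>M lborel)"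
    and A: "integrable lborel A" and B: "integrable lborel B"
    and bound: "\<And>x y. norm (F x y) \<le> A x * B y"
  shows "(LINT x|lborel. LINT y|lborel. F x y) = (LINT y|lborel. LINT x|lborel. F x y)"
    and "integrable lborel (\<lambda>x. LINT y|lborel. F x y)"
proof -
  have [measurable]: "A \<in> borel_measurable borel" "B \<in> borel_measurable borel"
    using A B by auto
  have int_y: "integrable lborel (F x)" for x
    by (rule Bochner_Integration.integrable_bound[of _ "\<lambda>y. A x * B y"])
       (use bound[of x] B in \<open>auto intro: order_trans[OF _ abs_ge_self]\<close>)
  have "integrable (lborel \<Otimes>\<^sub>M lborel) (case_prod F)"
  proof (rule lborel_pair.Fubini_integrable[OF meas])
    show "integrable lborel (\<lambda>x. LINT y|lborel. norm (case (x, y) of (x, y) \<Rightarrow> F x y))"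
    proof (rule Bochner_Integration.integrable_bound[of _ "\<lambda>x. A x * (LINT y|lborel. B y)"])
      show "AE x in lborel. norm (LINT y|lborel. norm (case (x, y) of (x, y) \<Rightarrow> F x y)) \<le> norm (A x * (LINT y|lborel. B y))"
      proof (rule AE_I2)
        fix x
        have "(LINT y|lborel. norm (F x y)) \<le> (LINT y|lborel. A x * B y)"
          by (intro integral_mono bound integrable_norm int_y) (use B in auto)
        moreover have "(LINT y|lborel. norm (F x y)) \<ge> 0" by (intro integral_nonneg_AE) auto
        ultimately show "norm (LINT y|lborel. norm (case (x, y) of (x, y) \<Rightarrow> F x y)) \<le> norm (A x * (LINT y|lborel. B y))"
          by simp
      qed
    qed (use A in auto)
    show "AE x in lborel. integrable lborel (\<lambda>y. case (x, y) of (x, y) \<Rightarrow> F x y)"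
      using int_y by simp
  qed
  from lborel_pair.Fubini_integral[OF this] lborel_pair.integrable_fst'[OF this]
  show "(LINT x|lborel. LINT y|lborel. F x y) = (LINT y|lborel. LINT x|lborel. F x y)"
    and "integrable lborel (\<lambda>x. LINT y|lborel. F x y)" by simp_all
qed

lemma integrable_gauss:
  assumes "H > 0"
  shows "integrable lborel (\<lambda>y::real. exp (- H\<^sup>2 * y\<^sup>2 / 2))"
proof -
  have "integrable lborel (\<lambda>y. sqrt (2 * pi * (1 / H)\<^sup>2) * normal_density 0 (1 / H) y)"
    using assms by (intro integrable_mult_right integrable_normal_density) simp
  also have "(\<lambda>y. sqrt (2 * pi * (1 / H)\<^sup>2) * normal_density 0 (1 / H) y) = (\<lambda>y. exp (- H\<^sup>2 * y\<^sup>2 / 2))"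
    using assms by (auto simp: normal_density_def field_simps)
  finally show ?thesis .
qed

text \<open>This is the characteristic function of the standard normal distribution, rescaled by
  \<open>1 / H\<close>.\<close>

lemma gauss_fourier:
  assumes H: "H > 0"
  shows "(LINT y|lborel. of_real (exp (- H\<^sup>2 * y\<^sup>2 / 2)) * cis (y * x)) = of_real (2 * pi * normal_density 0 H x)"
proof -
  have char: "(LINT s|lborel. of_real (std_normal_density s) * cis (v * s)) = of_real (exp (- v\<^sup>2 / 2))" for v
  proof -
    have "(LINT s|lborel. of_real (std_normal_density s) * cis (v * s)) = char std_normal_distribution v"
      unfolding char_def by (subst integral_density) (auto simp: cis_conv_exp scaleR_conv_of_real)
    then show ?thesis by (simp add: char_std_normal_distribution)
  qed
  have "(LINT y|lborel. of_real (exp (- H\<^sup>2 * y\<^sup>2 / 2)) * cis (y * x))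
      = \<bar>1 / H\<bar> *\<^sub>R (LINT s|lborel. of_real (exp (- H\<^sup>2 * (0 + 1 / H * s)\<^sup>2 / 2)) * cis ((0 + 1 / H * s) * x))"
    using H by (intro lborel_integral_real_affine) simp
  also have "(\<lambda>s. of_real (exp (- H\<^sup>2 * (0 + 1 / H * s)\<^sup>2 / 2)) * cis ((0 + 1 / H * s) * x))
      = (\<lambda>s. of_real (sqrt (2 * pi)) * (of_real (std_normal_density s) * cis (x / H * s)))"
    using H by (auto simp: std_normal_density_def power_mult_distrib power_divide mult_ac)
  also have "(LINT s|lborel. of_real (sqrt (2 * pi)) * (of_real (std_normal_density s) * cis (x / H * s)))
      = complex_of_real (sqrt (2 * pi)) * of_real (exp (- (x / H)\<^sup>2 / 2))"
    by (simp only: integral_mult_right_zero char)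
  also have "\<bar>1 / H\<bar> *\<^sub>R (complex_of_real (sqrt (2 * pi)) * of_real (exp (- (x / H)\<^sup>2 / 2)))
      = of_real (1 / H * sqrt (2 * pi) * exp (- (x / H)\<^sup>2 / 2))"
    using H by (simp add: scaleR_conv_of_real)
  also have "1 / H * sqrt (2 * pi) * exp (- (x / H)\<^sup>2 / 2) = 2 * pi * normal_density 0 H x"
    using H by (simp add: normal_density_def real_sqrt_mult power_divide field_simps)
  finally show ?thesis .
qed

lemma fourier_measurable [measurable]:
  assumes [measurable]: "g \<in> borel_measurable borel"
  shows "fourier g \<in> borel_measurable borel"
  unfolding fourier_def[abs_def] cis_conv_exp by measurable

lemma norm_fourier_le: "norm (fourier g t) \<le> (LINT u|lborel. \<bar>g u\<bar>)"
proof -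
  have "norm (fourier g t) \<le> (LINT u|lborel. norm (of_real (g u) * cis (- t * u)))"
    unfolding fourier_def by (rule integral_norm_bound)
  then show ?thesis by (simp add: norm_mult)
qed

context
  fixes g :: "real \<Rightarrow> real"
  assumes g: "integrable lborel g" and g2: "integrable lborel (\<lambda>u. (g u)\<^sup>2)"
begin

lemma shift_square_integrable:
  "integrable lborel (\<lambda>u. (g (u + h))\<^sup>2)" "(LINT u|lborel. (g (u + h))\<^sup>2) = (LINT u|lborel. (g u)\<^sup>2)"
  using lborel_integrable_real_affine[OF g2, of 1 h] lborel_integral_real_affine[of 1 "\<lambda>u. (g u)\<^sup>2" h]
  by (simp_all add: add.commute)

lemma shift_product_integrable: "integrable lborel (\<lambda>u. g u * g (u + h))"
proof (rule Bochner_Integration.integrable_bound[of _ "\<lambda>u. (g u)\<^sup>2 + (g (u + h))\<^sup>2"])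
  have [measurable]: "g \<in> borel_measurable borel" using g by auto
  show "(\<lambda>u. g u * g (u + h)) \<in> borel_measurable lborel" by measurable
  have "\<bar>a * b\<bar> \<le> a\<^sup>2 + b\<^sup>2" for a b :: real
    using sum_squares_bound[of a b] sum_squares_bound[of a "- b"] by (auto simp: abs_if)
  then show "AE u in lborel. norm (g u * g (u + h)) \<le> norm ((g u)\<^sup>2 + (g (u + h))\<^sup>2)" by simp
qed (intro Bochner_Integration.integrable_add g2 shift_square_integrable)

text \<open>Polarisation, with translation invariance of the norm. The autocorrelation is rewritten
  through the squared difference because that is the quantity whose behaviour at 0 can be
  computed.\<close>

lemma shift_diff_square_integrable: "integrable lborel (\<lambda>u. (g (u + h) - g u)\<^sup>2)"
  and autocorrelation_eq: "(LINT u|lborel. g u * g (u + h)) =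
         (LINT u|lborel. (g u)\<^sup>2) - (LINT u|lborel. (g (u + h) - g u)\<^sup>2) / 2"
proof -
  have eq: "(\<lambda>u. (g (u + h) - g u)\<^sup>2) = (\<lambda>u. (g (u + h))\<^sup>2 + (g u)\<^sup>2 - 2 * (g u * g (u + h)))"
    by (auto simp: power2_diff)
  show "integrable lborel (\<lambda>u. (g (u + h) - g u)\<^sup>2)"
    unfolding eq by (intro Bochner_Integration.integrable_diff Bochner_Integration.integrable_add
        integrable_mult_right g2 shift_square_integrable shift_product_integrable)
  have "(LINT u|lborel. (g (u + h) - g u)\<^sup>2) =
      (LINT u|lborel. (g (u + h))\<^sup>2) + (LINT u|lborel. (g u)\<^sup>2) - 2 * (LINT u|lborel. g u * g (u + h))"
    unfolding eq using g2 shift_square_integrable(1)[of h] shift_product_integrable[of h] by simp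
  then show "(LINT u|lborel. g u * g (u + h)) =
         (LINT u|lborel. (g u)\<^sup>2) - (LINT u|lborel. (g (u + h) - g u)\<^sup>2) / 2"
    by (simp add: shift_square_integrable diff_divide_distrib)
qed

lemma shift_diff_square_le:
  "(LINT u|lborel. (g (u + h) - g u)\<^sup>2) \<le> 4 * (LINT u|lborel. (g u)\<^sup>2)"
proof -
  have "(LINT u|lborel. (g (u + h) - g u)\<^sup>2) \<le> (LINT u|lborel. 2 * (g (u + h))\<^sup>2 + 2 * (g u)\<^sup>2)"
  proof (intro integral_mono shift_diff_square_integrable Bochner_Integration.integrable_add
        integrable_mult_right g2 shift_square_integrable)
    fix u show "(g (u + h) - g u)\<^sup>2 \<le> 2 * (g (u + h))\<^sup>2 + 2 * (g u)\<^sup>2"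
      using zero_le_power2[of "g (u + h) + g u"] by (simp add: power2_sum power2_diff)
  qed
  also have "\<dots> = 4 * (LINT u|lborel. (g u)\<^sup>2)"
    by (subst Bochner_Integration.integral_add)
       (auto intro!: g2 shift_square_integrable simp: shift_square_integrable(2))
  finally show ?thesis .
qed

text \<open>The Gaussian factor makes the multiple integrals absolutely convergent, so that their
  order can be changed. It turns the inversion integral into an average of translates of
  \<open>g\<close> under a normal law of standard deviation \<open>e\<close>.\<close>

lemma fourier_gauss_integral:
  assumes e: "e > 0"
  shows "integrable lborel (\<lambda>t. (norm (fourier g t))\<^sup>2 * exp (- e\<^sup>2 * t\<^sup>2 / 2))"
    and "(LINT t|lborel. (norm (fourier g t))\<^sup>2 * exp (- e\<^sup>2 * t\<^sup>2 / 2)) =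
           2 * pi * (LINT z|lborel. std_normal_density z * (LINT u|lborel. g u * g (u + e * z)))"
proof -
  have [measurable]: "g \<in> borel_measurable borel" using g by auto
  define \<gamma> where "\<gamma> t = exp (- e\<^sup>2 * t\<^sup>2 / 2)" for t :: real
  have [measurable]: "\<gamma> \<in> borel_measurable borel" unfolding \<gamma>_def by measurable
  have \<gamma>: "integrable lborel \<gamma>" "\<And>t. \<gamma> t > 0"
    using integrable_gauss[OF e] by (auto simp: \<gamma>_def[abs_def])
  have [measurable]: "cnj \<in> borel_measurable borel"
    by (intro borel_measurable_continuous_onI continuous_intros)
  define M where "M = (LINT u|lborel. \<bar>g u\<bar>)"
  have M: "norm (fourier g t) \<le> M" for t unfolding M_def by (rule norm_fourier_le)
  have M0: "M \<ge> 0" unfolding M_def by simp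
  have M2: "(norm (fourier g t))\<^sup>2 \<le> M\<^sup>2" for t by (rule power_mono[OF M]) simp
  show "integrable lborel (\<lambda>t. (norm (fourier g t))\<^sup>2 * exp (- e\<^sup>2 * t\<^sup>2 / 2))"
    unfolding \<gamma>_def[symmetric]
  proof (rule Bochner_Integration.integrable_bound[of _ "\<lambda>t. M\<^sup>2 * \<gamma> t"])
    show "AE t in lborel. norm ((norm (fourier g t))\<^sup>2 * \<gamma> t) \<le> norm (M\<^sup>2 * \<gamma> t)"
      using M2 \<gamma>(2) by (auto simp: abs_mult less_imp_le intro!: mult_right_mono)
  qed (use \<gamma> in auto)
  \<comment> \<open>Smoothed Fourier inversion: the integral over \<open>t\<close> is a normal
    density in \<open>v - u\<close>, and \<open>v = u + e * z\<close> makes it standard.\<close>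
  have inner: "(LINT t|lborel. of_real (\<gamma> t) * cnj (fourier g t) * cis (- t * u)) =
      of_real (2 * pi * (LINT z|lborel. std_normal_density z * g (u + e * z)))" for u
  proof -
    have "(LINT t|lborel. of_real (\<gamma> t) * cnj (fourier g t) * cis (- t * u)) =
        (LINT t|lborel. LINT v|lborel. of_real (\<gamma> t) * of_real (g v) * cis (t * (v - u)))"
    proof (rule Bochner_Integration.integral_cong[OF refl])
      fix t
      have "cnj (fourier g t) = (LINT v|lborel. cnj (of_real (g v) * cis (- t * v)))"
        unfolding fourier_def by (rule Bochner_Integration.integral_cnj[symmetric])
      also have "\<dots> = (LINT v|lborel. of_real (g v) * cis (t * v))"
        by (simp add: cis_cnj)
      finally have "of_real (\<gamma> t) * cnj (fourier g t) * cis (- t * u) =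
          (of_real (\<gamma> t) * cis (- t * u)) * (LINT v|lborel. of_real (g v) * cis (t * v))"
        by (simp add: mult_ac)
      also have "\<dots> = (LINT v|lborel. (of_real (\<gamma> t) * cis (- t * u)) * (of_real (g v) * cis (t * v)))"
        by (rule integral_mult_right_zero[symmetric])
      also have "\<dots> = (LINT v|lborel. of_real (\<gamma> t) * of_real (g v) * cis (t * (v - u)))"
      proof (rule Bochner_Integration.integral_cong[OF refl])
        fix v
        have "t * (v - u) = - t * u + t * v" by (simp add: algebra_simps)
        then show "(of_real (\<gamma> t) * cis (- t * u)) * (of_real (g v) * cis (t * v)) =
            of_real (\<gamma> t) * of_real (g v) * cis (t * (v - u))"
          by (simp only: cis_mult[symmetric] mult_ac)
      qed
      finally show "of_real (\<gamma> t) * cnj (fourier g t) * cis (- t * u) =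
          (LINT v|lborel. of_real (\<gamma> t) * of_real (g v) * cis (t * (v - u)))" .
    qed
    also have "\<dots> = (LINT v|lborel. LINT t|lborel. of_real (\<gamma> t) * of_real (g v) * cis (t * (v - u)))"
    proof (rule Fubini_lborel_dominated(1)[of _ \<gamma> "\<lambda>v. \<bar>g v\<bar>"])
      show "case_prod (\<lambda>t v. complex_of_real (\<gamma> t) * complex_of_real (g v) * cis (t * (v - u)))
          \<in> borel_measurable (lborel \<Otimes>\<^sub>M lborel)"
        unfolding cis_conv_exp by measurable
    qed (use \<gamma> g in \<open>auto simp: norm_mult less_imp_le\<close>)
    also have "\<dots> = (LINT v|lborel. of_real (g v * (2 * pi * normal_density 0 e (v - u))))"
    proof (rule Bochner_Integration.integral_cong[OF refl])
      fix v
      have "(LINT t|lborel. of_real (\<gamma> t) * of_real (g v) * cis (t * (v - u))) =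
         (LINT t|lborel. of_real (g v) * (of_real (\<gamma> t) * cis (t * (v - u))))"
        by (simp add: mult_ac)
      also have "\<dots> = of_real (g v) * of_real (2 * pi * normal_density 0 e (v - u))"
        unfolding \<gamma>_def by (simp only: integral_mult_right_zero gauss_fourier[OF e])
      finally show "(LINT t|lborel. of_real (\<gamma> t) * of_real (g v) * cis (t * (v - u))) =
         of_real (g v * (2 * pi * normal_density 0 e (v - u)))" by simp
    qed
    also have "\<dots> = of_real (LINT v|lborel. g v * (2 * pi * normal_density 0 e (v - u)))"
      by (rule integral_complex_of_real)
    also have "(LINT v|lborel. g v * (2 * pi * normal_density 0 e (v - u))) =
        \<bar>e\<bar> *\<^sub>R (LINT z|lborel. g (u + e * z) * (2 * pi * normal_density 0 e ((u + e * z) - u)))"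
      using e by (intro lborel_integral_real_affine) simp
    also have "\<dots> = 2 * pi * (LINT z|lborel. std_normal_density z * g (u + e * z))"
    proof -
      have "normal_density 0 e ((u + e * z) - u) = std_normal_density z / e" for z
        using e by (simp add: normal_density_def real_sqrt_mult power_mult_distrib field_simps)
      then have "(LINT z|lborel. g (u + e * z) * (2 * pi * normal_density 0 e ((u + e * z) - u))) =
           (LINT z|lborel. (2 * pi / e) * (std_normal_density z * g (u + e * z)))"
        by (simp add: mult_ac)
      also have "\<dots> = (2 * pi / e) * (LINT z|lborel. std_normal_density z * g (u + e * z))"
        by (rule integral_mult_right_zero)
      finally show ?thesis using e by simp
    qed
    finally show ?thesis .
  qed
  have "complex_of_real (LINT t|lborel. (norm (fourier g t))\<^sup>2 * \<gamma> t) =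
      (LINT t|lborel. of_real ((norm (fourier g t))\<^sup>2 * \<gamma> t))"
    by (rule integral_complex_of_real[symmetric])
  also have "\<dots> = (LINT t|lborel. LINT u|lborel. of_real (g u) * (of_real (\<gamma> t) * cnj (fourier g t) * cis (- t * u)))"
  proof (rule Bochner_Integration.integral_cong[OF refl])
    fix t
    have "complex_of_real ((norm (fourier g t))\<^sup>2 * \<gamma> t) = (of_real (\<gamma> t) * cnj (fourier g t)) * fourier g t"
      using complex_norm_square[of "fourier g t"] by (simp add: mult_ac)
    also have "\<dots> = (LINT u|lborel. (of_real (\<gamma> t) * cnj (fourier g t)) * (of_real (g u) * cis (- t * u)))"
      by (subst (2) fourier_def) (rule integral_mult_right_zero[symmetric])
    finally show "complex_of_real ((norm (fourier g t))\<^sup>2 * \<gamma> t) =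
        (LINT u|lborel. of_real (g u) * (of_real (\<gamma> t) * cnj (fourier g t) * cis (- t * u)))"
      by (simp add: mult_ac)
  qed
  also have "\<dots> = (LINT u|lborel. LINT t|lborel. of_real (g u) * (of_real (\<gamma> t) * cnj (fourier g t) * cis (- t * u)))"
  proof (rule Fubini_lborel_dominated(1)[of _ "\<lambda>t. M * \<gamma> t" "\<lambda>v. \<bar>g v\<bar>"])
    show "case_prod (\<lambda>t u. of_real (g u) * (of_real (\<gamma> t) * cnj (fourier g t) * cis (- t * u)))
        \<in> borel_measurable (lborel \<Otimes>\<^sub>M lborel)"
      unfolding cis_conv_exp minus_mult_left[symmetric] by measurable
    fix t u
    have "norm (of_real (g u) * (of_real (\<gamma> t) * cnj (fourier g t) * cis (- t * u))) = \<bar>g u\<bar> * (\<gamma> t * norm (fourier g t))"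
      using \<gamma>(2)[of t] by (simp add: norm_mult)
    also have "\<dots> \<le> \<bar>g u\<bar> * (\<gamma> t * M)"
      using \<gamma>(2)[of t] M by (intro mult_left_mono) auto
    finally show "norm (of_real (g u) * (of_real (\<gamma> t) * cnj (fourier g t) * cis (- t * u))) \<le> M * \<gamma> t * \<bar>g u\<bar>"
      by (simp add: mult_ac)
  qed (use \<gamma> g in auto)
  also have "\<dots> = (LINT u|lborel. of_real (g u * (2 * pi * (LINT z|lborel. std_normal_density z * g (u + e * z)))))"
    by (simp only: integral_mult_right_zero inner of_real_mult)
  also have "\<dots> = of_real (LINT u|lborel. g u * (2 * pi * (LINT z|lborel. std_normal_density z * g (u + e * z))))"
    by (rule integral_complex_of_real)
  finally have "(LINT t|lborel. (norm (fourier g t))\<^sup>2 * \<gamma> t) =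
      (LINT u|lborel. g u * (2 * pi * (LINT z|lborel. std_normal_density z * g (u + e * z))))"
    by (simp only: of_real_eq_iff)
  also have "\<dots> = 2 * pi * (LINT u|lborel. LINT z|lborel. std_normal_density z * (g u * g (u + e * z)))"
    by (simp only: integral_mult_right_zero[symmetric] mult_ac)
  also have "(LINT u|lborel. LINT z|lborel. std_normal_density z * (g u * g (u + e * z))) =
      (LINT z|lborel. LINT u|lborel. std_normal_density z * (g u * g (u + e * z)))"
  \<comment> \<open>No product majorant fits here, since \<open>g u * g (u + e * z)\<close> couples
    the variables. The integral over \<open>u\<close> is taken first and is bounded by the squared
    norm uniformly in \<open>z\<close>.\<close>
  proof (rule lborel_pair.Fubini_integral)
    show "integrable (lborel \<Otimes>\<^sub>M lborel) (\<lambda>(z, u). std_normal_density z * (g u * g (u + e * z)))"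
    proof (rule lborel_pair.Fubini_integrable)
      show "(\<lambda>(z, u). std_normal_density z * (g u * g (u + e * z))) \<in> borel_measurable (lborel \<Otimes>\<^sub>M lborel)"
        by measurable
      show "AE z in lborel. integrable lborel (\<lambda>u. case (z, u) of (z, u) \<Rightarrow> std_normal_density z * (g u * g (u + e * z)))"
        using shift_product_integrable by simp
      show "integrable lborel (\<lambda>z. LINT u|lborel. norm (case (z, u) of (z, u) \<Rightarrow> std_normal_density z * (g u * g (u + e * z))))"
      proof (rule Bochner_Integration.integrable_bound[of _ "\<lambda>z. std_normal_density z * (LINT u|lborel. (g u)\<^sup>2)"])
        show "AE z in lborel. norm (LINT u|lborel. norm (case (z, u) of (z, u) \<Rightarrow> std_normal_density z * (g u * g (u + e * z))))
           \<le> norm (std_normal_density z * (LINT u|lborel. (g u)\<^sup>2))"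
        proof (rule AE_I2)
          fix z
          have "(LINT u|lborel. \<bar>g u * g (u + e * z)\<bar>) \<le> (LINT u|lborel. ((g u)\<^sup>2 + (g (u + e * z))\<^sup>2) / 2)"
          proof (intro integral_mono)
            have "\<bar>a * b\<bar> \<le> (a\<^sup>2 + b\<^sup>2) / 2" for a b :: real
              using sum_squares_bound[of a b] sum_squares_bound[of a "- b"] by (auto simp: abs_if)
            then show "\<bar>g u * g (u + e * z)\<bar> \<le> ((g u)\<^sup>2 + (g (u + e * z))\<^sup>2) / 2" for u .
          qed (use shift_product_integrable g2 shift_square_integrable in auto)
          also have "\<dots> = (LINT u|lborel. (g u)\<^sup>2)"
            using g2 shift_square_integrable[of "e * z"] by simp
          finally have "(LINT u|lborel. \<bar>g u * g (u + e * z)\<bar>) \<le> (LINT u|lborel. (g u)\<^sup>2)" .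
          moreover have "(LINT u|lborel. \<bar>g u * g (u + e * z)\<bar>) \<ge> 0" by simp
          ultimately show "norm (LINT u|lborel. norm (case (z, u) of (z, u) \<Rightarrow> std_normal_density z * (g u * g (u + e * z))))
           \<le> norm (std_normal_density z * (LINT u|lborel. (g u)\<^sup>2))"
            by (auto simp: abs_mult intro!: mult_left_mono)
        qed
      qed auto
    qed
  qed
  finally show "(LINT t|lborel. (norm (fourier g t))\<^sup>2 * exp (- e\<^sup>2 * t\<^sup>2 / 2)) =
           2 * pi * (LINT z|lborel. std_normal_density z * (LINT u|lborel. g u * g (u + e * z)))"
    by (simp only: \<gamma>_def integral_mult_right_zero)
qed

text \<open>As \<open>e n\<close> decreases to 0 the Gaussian factors increase to 1, and monotone
  convergence handles the left side. On the right \<open>cont\<close>, the continuity of translation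
  in mean square, sends the averaged autocorrelation to the squared norm.\<close>

theorem plancherel:
  assumes cont: "((\<lambda>h. LINT u|lborel. (g (u + h) - g u)\<^sup>2) \<longlongrightarrow> 0) (at 0)"
  shows "has_bochner_integral lborel (\<lambda>t. (norm (fourier g t))\<^sup>2) (2 * pi * (LINT u|lborel. (g u)\<^sup>2))"
proof -
  have [measurable]: "g \<in> borel_measurable borel" using g by auto
  define D where "D h = (LINT u|lborel. (g (u + h) - g u)\<^sup>2)" for h
  have [measurable]: "D \<in> borel_measurable borel" unfolding D_def[abs_def] by measurable
  define S where "S = (LINT u|lborel. (g u)\<^sup>2)"
  define e :: "nat \<Rightarrow> real" where "e n = 1 / real (n + 1)" for n
  have e: "e n > 0" "e (Suc n) \<le> e n" for n by (simp_all add: e_def field_simps)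
  have e_lim: "e \<longlonglongrightarrow> 0" unfolding e_def[abs_def] by real_asymp
  have D_lim: "(\<lambda>n. D (e n * z)) \<longlonglongrightarrow> 0" for z
  proof (cases "z = 0")
    case False
    have "filterlim (\<lambda>n. e n * z) (at 0) sequentially"
      unfolding filterlim_at using False e(1) e_lim
      by (auto intro!: tendsto_mult_left_zero always_eventually simp: less_imp_neq[symmetric])
    from filterlim_compose[OF cont this] show ?thesis by (simp add: D_def)
  qed (simp add: D_def)
  have "(\<lambda>n. LINT z|lborel. std_normal_density z * (S - D (e n * z) / 2)) \<longlonglongrightarrow>
      (LINT z|lborel. std_normal_density z * (S - 0 / 2))"
  proof (rule integral_dominated_convergence)
    show "integrable lborel (\<lambda>z. std_normal_density z * (3 * S))" by auto
    show "AE z in lborel. (\<lambda>n. std_normal_density z * (S - D (e n * z) / 2)) \<longlonglongrightarrow> std_normal_density z * (S - 0 / 2)"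
      by (intro AE_I2 tendsto_intros D_lim) simp
    show "AE z in lborel. norm (std_normal_density z * (S - D (e n * z) / 2)) \<le> std_normal_density z * (3 * S)" for n
    proof (rule AE_I2)
      fix z
      have "0 \<le> D (e n * z)" "D (e n * z) \<le> 4 * S"
        unfolding D_def S_def by (auto intro: shift_diff_square_le)
      then have "\<bar>S - D (e n * z) / 2\<bar> \<le> 3 * S" by linarith
      then show "norm (std_normal_density z * (S - D (e n * z) / 2)) \<le> std_normal_density z * (3 * S)"
        by (simp add: abs_mult mult_left_mono)
    qed
  qed auto
  then have "(\<lambda>n. 2 * pi * (LINT z|lborel. std_normal_density z * (S - D (e n * z) / 2))) \<longlonglongrightarrow> 2 * pi * S"
    by (intro tendsto_mult_left) simp
  then have lim: "(\<lambda>n. LINT t|lborel. (norm (fourier g t))\<^sup>2 * exp (- (e n)\<^sup>2 * t\<^sup>2 / 2)) \<longlonglongrightarrow> 2 * pi * S"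
    by (simp only: fourier_gauss_integral(2)[OF e(1)] autocorrelation_eq D_def S_def)
  show ?thesis
    unfolding S_def[symmetric]
  proof (rule has_bochner_integral_monotone_convergence[OF fourier_gauss_integral(1)[OF e(1)] _ _ lim])
    show "AE t in lborel. mono (\<lambda>n. (norm (fourier g t))\<^sup>2 * exp (- (e n)\<^sup>2 * t\<^sup>2 / 2))"
    proof (rule AE_I2, rule incseq_SucI)
      fix t n
      have "(e (Suc n))\<^sup>2 \<le> (e n)\<^sup>2" using e(1)[of "Suc n"] e(2)[of n] by (intro power_mono) auto
      then have "(e (Suc n))\<^sup>2 * t\<^sup>2 \<le> (e n)\<^sup>2 * t\<^sup>2" by (rule mult_right_mono) simp
      then show "(norm (fourier g t))\<^sup>2 * exp (- (e n)\<^sup>2 * t\<^sup>2 / 2) \<le> (norm (fourier g t))\<^sup>2 * exp (- (e (Suc n))\<^sup>2 * t\<^sup>2 / 2)"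
        by (intro mult_left_mono) auto
    qed
    show "AE t in lborel. (\<lambda>n. (norm (fourier g t))\<^sup>2 * exp (- (e n)\<^sup>2 * t\<^sup>2 / 2)) \<longlonglongrightarrow> (norm (fourier g t))\<^sup>2"
    proof (rule AE_I2)
      fix t
      have "(\<lambda>n. (norm (fourier g t))\<^sup>2 * exp (- (e n)\<^sup>2 * t\<^sup>2 / 2)) \<longlonglongrightarrow> (norm (fourier g t))\<^sup>2 * exp (- 0\<^sup>2 * t\<^sup>2 / 2)"
        by (intro tendsto_intros e_lim) simp
      then show "(\<lambda>n. (norm (fourier g t))\<^sup>2 * exp (- (e n)\<^sup>2 * t\<^sup>2 / 2)) \<longlonglongrightarrow> (norm (fourier g t))\<^sup>2" by simp
    qed
  qed auto
qed

end

subsection \<open>Dilations of the fractional part\<close>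

definition saw :: "real \<Rightarrow> real" where
  "saw x = frac x * (1 - frac x)"

text \<open>For \<open>x = exp u\<close> and \<open>1 + h = exp y\<close>, the translation of
  \<open>u\<close> by \<open>y\<close> becomes the dilation of \<open>x\<close> by
  \<open>1 + h\<close>.\<close>

definition dilation_sq :: "real \<Rightarrow> real \<Rightarrow> real" where
  "dilation_sq h x = (frac ((1 + h) * x) - frac x)\<^sup>2"

lemma frac_measurable [measurable]: "(frac :: real \<Rightarrow> real) \<in> borel_measurable borel"
  unfolding frac_def[abs_def] by measurable

lemma saw_measurable [measurable]: "saw \<in> borel_measurable borel"
  unfolding saw_def[abs_def] by measurable

lemma dilation_sq_measurable [measurable]: "dilation_sq h \<in> borel_measurable borel"
  unfolding dilation_sq_def[abs_def] by measurable

lemma saw_nonneg: "saw x \<ge> 0" and saw_le: "saw x \<le> 1"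
proof -
  have "frac x \<ge> 0" "frac x \<le> 1" using frac_lt_1[of x] by auto
  then show "saw x \<ge> 0" "saw x \<le> 1" unfolding saw_def by (auto intro: mult_le_one)
qed

lemma frac_diff_abs_le: "\<bar>frac x - frac y\<bar> \<le> 1" for x y :: real
  using frac_lt_1[of x] frac_lt_1[of y] frac_ge_0[of x] frac_ge_0[of y] by linarith

lemma dilation_sq_nonneg: "dilation_sq h x \<ge> 0" and dilation_sq_le: "dilation_sq h x \<le> 1"
  using frac_diff_abs_le abs_square_le_1 by (auto simp: dilation_sq_def)

lemma frac_shift_cell:
  fixes x t :: real
  assumes "\<lfloor>x\<rfloor> = n"
  shows "x < n + 1 - frac t \<Longrightarrow> frac (x + t) - frac x = frac t \<and> \<lfloor>x + t\<rfloor> = n + \<lfloor>t\<rfloor>"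
    and "x \<ge> n + 1 - frac t \<Longrightarrow> frac (x + t) - frac x = frac t - 1 \<and> \<lfloor>x + t\<rfloor> = n + \<lfloor>t\<rfloor> + 1"
  using assms frac_add[of x t] floor_add[of x t] by (auto simp: frac_def split: if_splits)

lemma has_integral_two_pieces:
  fixes f :: "real \<Rightarrow> real"
  assumes "a \<le> b" "b \<le> c"
    and "\<And>x. a \<le> x \<Longrightarrow> x < b \<Longrightarrow> f x = p" and "\<And>x. b \<le> x \<Longrightarrow> x < c \<Longrightarrow> f x = q"
  shows "(f has_integral p * (b - a) + q * (c - b)) {a..c}"
proof (rule has_integral_combine[OF assms(1,2)])
  have "((\<lambda>x. p) has_integral p * (b - a)) {a..b}"
    using has_integral_const_real[of p a b] assms by (simp add: mult.commute)
  then show "(f has_integral p * (b - a)) {a..b}"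
    by (rule has_integral_spike[of "{b}", rotated 2]) (use assms in auto)
  have "((\<lambda>x. q) has_integral q * (c - b)) {b..c}"
    using has_integral_const_real[of q b c] assms by (simp add: mult.commute)
  then show "(f has_integral q * (c - b)) {b..c}"
    by (rule has_integral_spike[of "{c}", rotated 2]) (use assms in auto)
qed

text \<open>Thus \<open>saw t\<close> is the mean of the squared difference over a unit cell when the shift is constant;
  in \<open>dilation_sq h\<close> the shift \<open>h * x\<close> varies by at most \<open>h\<close> over a cell.\<close>

lemma has_integral_frac_shift_sq:
  "((\<lambda>x. (frac (x + t) - frac x)\<^sup>2) has_integral saw t) {real n..real n + 1}"
proof -
  have "((\<lambda>x. (frac (x + t) - frac x)\<^sup>2) has_integral
      (frac t)\<^sup>2 * ((real n + 1 - frac t) - real n) + (frac t - 1)\<^sup>2 * ((real n + 1) - (real n + 1 - frac t))) {real n..real n + 1}"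
  proof (rule has_integral_two_pieces)
    fix x
    show "(frac (x + t) - frac x)\<^sup>2 = (frac t)\<^sup>2" if "real n \<le> x" "x < real n + 1 - frac t"
      using that frac_shift_cell(1)[of x "int n" t] frac_ge_0[of t] by (auto simp: floor_eq_iff)
    show "(frac (x + t) - frac x)\<^sup>2 = (frac t - 1)\<^sup>2" if "real n + 1 - frac t \<le> x" "x < real n + 1"
      using that frac_shift_cell(2)[of x "int n" t] frac_lt_1[of t] by (auto simp: floor_eq_iff)
  qed (use frac_ge_0[of t] frac_lt_1[of t] in auto)
  then show ?thesis
    by (simp add: saw_def power2_eq_square algebra_simps)
qed

lemma has_integral_floor_shift:
  "((\<lambda>x. real_of_int \<lfloor>x + t\<rfloor>) has_integral real n + t) {real n..real n + 1}"
proof -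
  have "((\<lambda>x. real_of_int \<lfloor>x + t\<rfloor>) has_integral
      (real n + real_of_int \<lfloor>t\<rfloor>) * ((real n + 1 - frac t) - real n) + (real n + real_of_int \<lfloor>t\<rfloor> + 1) * ((real n + 1) - (real n + 1 - frac t))) {real n..real n + 1}"
  proof (rule has_integral_two_pieces)
    fix x
    show "real_of_int \<lfloor>x + t\<rfloor> = real n + real_of_int \<lfloor>t\<rfloor>" if "real n \<le> x" "x < real n + 1 - frac t"
    proof -
      have "\<lfloor>x\<rfloor> = int n" using that frac_ge_0[of t] unfolding floor_eq_iff of_int_of_nat_eq by linarith
      with frac_shift_cell(1)[of x "int n" t] that show ?thesis by simp
    qed
    show "real_of_int \<lfloor>x + t\<rfloor> = real n + real_of_int \<lfloor>t\<rfloor> + 1" if "real n + 1 - frac t \<le> x" "x < real n + 1"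
    proof -
      have "\<lfloor>x\<rfloor> = int n" using that frac_lt_1[of t] unfolding floor_eq_iff of_int_of_nat_eq by linarith
      with frac_shift_cell(2)[of x "int n" t] that show ?thesis by simp
    qed
  qed (use frac_ge_0[of t] frac_lt_1[of t] in auto)
  moreover have "(real n + real_of_int \<lfloor>t\<rfloor>) * ((real n + 1 - frac t) - real n) + (real n + real_of_int \<lfloor>t\<rfloor> + 1) * ((real n + 1) - (real n + 1 - frac t)) = real n + t"
    by (simp add: frac_def algebra_simps)
  ultimately show ?thesis by simp
qed

text \<open>A change of shift by \<open>d\<close> alters the fractional part by \<open>d\<close> and
  a possible jump of the floor. The jump is not small pointwise, but by
  \<open>has_integral_floor_shift\<close> its mean over a cell is exactly the increment
  \<open>e\<close> of the shift.\<close>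

lemma frac_shift_sq_diff_le:
  fixes x :: real
  assumes "0 \<le> d" "d \<le> e"
  shows "\<bar>(frac (x + (t + d)) - frac x)\<^sup>2 - (frac (x + t) - frac x)\<^sup>2\<bar>
     \<le> 2 * (e + (real_of_int \<lfloor>x + (t + e)\<rfloor> - real_of_int \<lfloor>x + t\<rfloor>))"
proof -
  let ?a = "frac (x + (t + d)) - frac x" and ?b = "frac (x + t) - frac x"
  have "\<bar>?a + ?b\<bar> \<le> 2"
    using frac_diff_abs_le[of "x + (t + d)" x] frac_diff_abs_le[of "x + t" x] by linarith
  moreover have "\<lfloor>x + t\<rfloor> \<le> \<lfloor>x + (t + d)\<rfloor>" "\<lfloor>x + (t + d)\<rfloor> \<le> \<lfloor>x + (t + e)\<rfloor>"
    using assms by (auto intro!: floor_mono)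
  then have "\<bar>?a - ?b\<bar> \<le> e + (real_of_int \<lfloor>x + (t + e)\<rfloor> - real_of_int \<lfloor>x + t\<rfloor>)"
    using assms unfolding frac_def by linarith
  ultimately have "\<bar>?a + ?b\<bar> * \<bar>?a - ?b\<bar> \<le> 2 * (e + (real_of_int \<lfloor>x + (t + e)\<rfloor> - real_of_int \<lfloor>x + t\<rfloor>))"
    by (intro mult_mono) auto
  moreover have "?a\<^sup>2 - ?b\<^sup>2 = (?a + ?b) * (?a - ?b)" by (simp add: power2_eq_square algebra_simps)
  ultimately show ?thesis by (simp only: abs_mult)
qed

lemma abs_integral_diff_le:
  fixes f g k :: "real \<Rightarrow> real"
  assumes f: "f integrable_on S" and "(g has_integral I) S" and "(k has_integral K) S"
    and "\<And>x. x \<in> S \<Longrightarrow> \<bar>f x - g x\<bar> \<le> k x"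
  shows "\<bar>integral S f - I\<bar> \<le> K"
proof -
  have "norm (integral S (\<lambda>x. f x - g x)) \<le> integral S k"
    using assms by (intro integral_norm_bound_integral integrable_diff) auto
  then show ?thesis
    using assms by (simp add: Henstock_Kurzweil_Integration.integral_diff has_integral_integrable integral_unique)
qed

text \<open>As \<open>saw\<close> is a cell mean of squared differences, integrating
  \<open>frac_shift_sq_diff_le\<close> over one cell gives \<open>2 * (d + d)\<close>.\<close>

lemma saw_lipschitz:
  assumes "0 \<le> d"
  shows "\<bar>saw (t + d) - saw t\<bar> \<le> 4 * d"
proof -
  have "\<bar>integral {real 0..real 0 + 1} (\<lambda>x. (frac (x + (t + d)) - frac x)\<^sup>2) - saw t\<bar>
     \<le> 2 * (d * (real 0 + 1 - real 0) + ((real 0 + (t + d)) - (real 0 + t)))"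
  proof (rule abs_integral_diff_le[OF _ has_integral_frac_shift_sq])
    show "((\<lambda>x. 2 * (d + (real_of_int \<lfloor>x + (t + d)\<rfloor> - real_of_int \<lfloor>x + t\<rfloor>))) has_integral
       2 * (d * (real 0 + 1 - real 0) + ((real 0 + (t + d)) - (real 0 + t)))) {real 0..real 0 + 1}"
      using has_integral_const_real[of d "real 0" "real 0 + 1"]
      by (intro has_integral_mult_right has_integral_add has_integral_diff has_integral_floor_shift) (simp add: mult.commute)
    show "(\<lambda>x. (frac (x + (t + d)) - frac x)\<^sup>2) integrable_on {real 0..real 0 + 1}"
      using has_integral_frac_shift_sq by (rule has_integral_integrable)
  qed (use assms frac_shift_sq_diff_le in auto)
  then show ?thesis
    using integral_unique[OF has_integral_frac_shift_sq[of "t + d" 0]] by simp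
qed

lemma bounded_set_integrable:
  fixes f :: "real \<Rightarrow> real"
  assumes [measurable]: "f \<in> borel_measurable borel" and "\<And>x. x \<in> {a..b} \<Longrightarrow> \<bar>f x\<bar> \<le> C"
  shows "set_integrable lborel {a..b} f"
  unfolding set_integrable_def
proof (rule Bochner_Integration.integrable_bound[of _ "\<lambda>x. indicator {a..b} x *\<^sub>R C"])
  show "integrable lborel (\<lambda>x. indicator {a..b} x *\<^sub>R C)"
    by (intro integrable_scaleR_left integrable_real_indicator) (auto simp: emeasure_lborel_Icc_eq)
  show "AE x in lborel. norm (indicator {a..b} x *\<^sub>R f x) \<le> norm (indicator {a..b} x *\<^sub>R C)"
    using assms(2) by (auto simp: indicator_def) fastforce
qed measurable

lemma bounded_integrable_on:
  fixes f :: "real \<Rightarrow> real"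
  assumes "f \<in> borel_measurable borel" and "\<And>x. x \<in> {a..b} \<Longrightarrow> \<bar>f x\<bar> \<le> C"
  shows "f integrable_on {a..b}"
  using set_borel_integral_eq_integral(1)[OF bounded_set_integrable[OF assms]] .

text \<open>The deviation of \<open>dilation_sq\<close> from its local mean; bounded by 1 pointwise,
  but cancelling to order \<open>h\<close> over each unit cell.\<close>

definition cell_err :: "real \<Rightarrow> real \<Rightarrow> real" where
  "cell_err h x = dilation_sq h x - saw (h * x)"

lemma cell_err_measurable [measurable]: "cell_err h \<in> borel_measurable borel"
  unfolding cell_err_def[abs_def] by measurable

lemma abs_cell_err_le: "\<bar>cell_err h x\<bar> \<le> 1"
  using saw_nonneg[of "h * x"] saw_le[of "h * x"] dilation_sq_nonneg[of h x] dilation_sq_le[of h x]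
  unfolding cell_err_def by linarith

text \<open>Each half costs \<open>4 * h\<close>: freezing the shift \<open>h * x\<close> at the
  left end of the cell changes the mean square by at most that much, and so does freezing the
  argument of \<open>saw\<close>.\<close>

lemma cell_err_integral_le:
  assumes h: "h \<ge> 0"
  shows "\<bar>integral {real n..real n + 1} (cell_err h)\<bar> \<le> 8 * h"
proof -
  let ?I = "{real n..real n + 1}" and ?t = "h * real n"
  have int: "dilation_sq h integrable_on ?I" "(\<lambda>x. saw (h * x)) integrable_on ?I"
    using saw_nonneg saw_le dilation_sq_nonneg dilation_sq_le
    by (auto intro!: bounded_integrable_on[of _ _ _ 1])
  have "\<bar>integral ?I (dilation_sq h) - saw ?t\<bar>
     \<le> 2 * (h * (real n + 1 - real n) + ((real n + (?t + h)) - (real n + ?t)))"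
  proof (rule abs_integral_diff_le[OF int(1) has_integral_frac_shift_sq])
    show "((\<lambda>x. 2 * (h + (real_of_int \<lfloor>x + (?t + h)\<rfloor> - real_of_int \<lfloor>x + ?t\<rfloor>))) has_integral
       2 * (h * (real n + 1 - real n) + ((real n + (?t + h)) - (real n + ?t)))) ?I"
      using has_integral_const_real[of h "real n" "real n + 1"]
      by (intro has_integral_mult_right has_integral_add has_integral_diff has_integral_floor_shift) (simp add: mult.commute)
    fix x assume x: "x \<in> ?I"
    have "0 \<le> h * (x - real n)" "h * (x - real n) \<le> h * 1"
      using x h mult_left_mono[of "x - real n" 1 h] by auto
    moreover have "(1 + h) * x = x + (?t + h * (x - real n))" by (simp add: algebra_simps)
    ultimately show "\<bar>dilation_sq h x - (frac (x + ?t) - frac x)\<^sup>2\<bar> \<le>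
        2 * (h + (real_of_int \<lfloor>x + (?t + h)\<rfloor> - real_of_int \<lfloor>x + ?t\<rfloor>))"
      using frac_shift_sq_diff_le[of "h * (x - real n)" h x ?t] by (simp add: dilation_sq_def)
  qed
  moreover have "\<bar>integral ?I (\<lambda>x. saw (h * x)) - saw ?t\<bar> \<le> 4 * h"
  proof (rule abs_integral_diff_le[OF int(2), of "\<lambda>_. saw ?t" _ "\<lambda>_. 4 * h"])
    show "((\<lambda>_. saw ?t) has_integral saw ?t) ?I" "((\<lambda>_. 4 * h) has_integral 4 * h) ?I"
      using has_integral_const_real[of _ "real n" "real n + 1"] by auto
    fix x assume x: "x \<in> ?I"
    then have "0 \<le> h * (x - real n)" "h * (x - real n) \<le> h * 1"
      using h mult_left_mono[of "x - real n" 1 h] by auto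
    moreover have "h * x = ?t + h * (x - real n)" by (simp add: algebra_simps)
    ultimately show "\<bar>saw (h * x) - saw ?t\<bar> \<le> 4 * h"
      using saw_lipschitz[of "h * (x - real n)" ?t] by simp
  qed
  ultimately have "\<bar>integral ?I (dilation_sq h) - integral ?I (\<lambda>x. saw (h * x))\<bar> \<le> 8 * h"
    by (simp add: algebra_simps abs_le_iff)
  then show ?thesis
    using Henstock_Kurzweil_Integration.integral_diff[OF int] by (simp add: cell_err_def[abs_def])
qed

text \<open>Cancellation inside the cell can be used only with a constant weight, so
  \<open>1 / x\<^sup>2\<close> is frozen at the left end. The price is the variation of the weight
  over the cell, which telescopes when cells are summed.\<close>

lemma cell_err_weighted_le:
  assumes h: "h \<ge> 0" and n: "n > 0"
  shows "\<bar>integral {real n..real n + 1} (\<lambda>x. cell_err h x / x\<^sup>2)\<bar>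
      \<le> 8 * h / (real n)\<^sup>2 + (1 / (real n)\<^sup>2 - 1 / (real n + 1)\<^sup>2)"
proof -
  let ?I = "{real n..real n + 1}"
  have sq: "1 / (real n + 1)\<^sup>2 \<le> 1 / x\<^sup>2" "1 / x\<^sup>2 \<le> 1 / (real n)\<^sup>2" if "x \<in> ?I" for x
    using that n by (auto intro!: divide_left_mono power_mono mult_pos_pos)
  have int: "(\<lambda>x. cell_err h x / x\<^sup>2) integrable_on ?I"
  proof (rule bounded_integrable_on[of _ _ _ 1])
    fix x assume x: "x \<in> ?I"
    then have "x\<^sup>2 \<ge> 1" using n by (auto intro!: one_le_power)
    then show "\<bar>cell_err h x / x\<^sup>2\<bar> \<le> 1"
      using abs_cell_err_le[of h x] by (auto simp: divide_le_eq)
  qed measurable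
  have int': "cell_err h integrable_on ?I"
    using abs_cell_err_le by (intro bounded_integrable_on) auto
  have "\<bar>integral ?I (\<lambda>x. cell_err h x / x\<^sup>2) - integral ?I (cell_err h) / (real n)\<^sup>2\<bar>
      \<le> (1 / (real n)\<^sup>2 - 1 / (real n + 1)\<^sup>2)"
  proof (rule abs_integral_diff_le[OF int])
    show "((\<lambda>x. cell_err h x / (real n)\<^sup>2) has_integral integral ?I (cell_err h) / (real n)\<^sup>2) ?I"
      by (intro has_integral_divide integrable_integral int')
    show "((\<lambda>_. 1 / (real n)\<^sup>2 - 1 / (real n + 1)\<^sup>2) has_integral (1 / (real n)\<^sup>2 - 1 / (real n + 1)\<^sup>2)) ?I"
      using has_integral_const_real[of _ "real n" "real n + 1"] by auto
    fix x assume x: "x \<in> ?I"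
    have "\<bar>cell_err h x / x\<^sup>2 - cell_err h x / (real n)\<^sup>2\<bar> = \<bar>cell_err h x\<bar> * \<bar>1 / x\<^sup>2 - 1 / (real n)\<^sup>2\<bar>"
      by (simp add: abs_mult[symmetric] right_diff_distrib)
    also have "\<dots> \<le> 1 * (1 / (real n)\<^sup>2 - 1 / (real n + 1)\<^sup>2)"
      using sq[OF x] abs_cell_err_le by (intro mult_mono) auto
    finally show "\<bar>cell_err h x / x\<^sup>2 - cell_err h x / (real n)\<^sup>2\<bar> \<le> 1 / (real n)\<^sup>2 - 1 / (real n + 1)\<^sup>2" by simp
  qed
  moreover have "\<bar>integral ?I (cell_err h) / (real n)\<^sup>2\<bar> \<le> 8 * h / (real n)\<^sup>2"
    using cell_err_integral_le[OF h, of n] by (simp add: divide_right_mono)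
  ultimately show ?thesis by linarith
qed

text \<open>Since \<open>1 / n\<^sup>2\<close> is at most twice \<open>1 / n - 1 / (n + 1)\<close>,
  both errors telescope, and \<open>8 * h\<close> becomes \<open>16 * h\<close>. For
  \<open>N\<close> near \<open>1 / h\<close> both totals are of order
  \<open>h\<^sup>2\<close>.\<close>

lemma cell_err_tail_le:
  assumes h: "h \<ge> 0" and N: "N > 0"
  shows "\<bar>integral {real N..real (N + k)} (\<lambda>x. cell_err h x / x\<^sup>2)\<bar>
      \<le> 16 * h * (1 / real N - 1 / real (N + k)) + (1 / (real N)\<^sup>2 - 1 / (real (N + k))\<^sup>2)"
proof (induction k)
  case 0
  then show ?case by simp
next
  case (Suc k)
  define n where "n = N + k"
  have n: "n > 0" using N by (simp add: n_def)
  have "integral {real N..real n} (\<lambda>x. cell_err h x / x\<^sup>2) + integral {real n..real n + 1} (\<lambda>x. cell_err h x / x\<^sup>2)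
     = integral {real N..real n + 1} (\<lambda>x. cell_err h x / x\<^sup>2)"
  proof (rule Henstock_Kurzweil_Integration.integral_combine)
    show "(\<lambda>x. cell_err h x / x\<^sup>2) integrable_on {real N..real n + 1}"
    proof (rule bounded_integrable_on[of _ _ _ 1])
      fix x assume x: "x \<in> {real N..real n + 1}"
      then have "x\<^sup>2 \<ge> 1" using N by (auto intro!: one_le_power)
      then show "\<bar>cell_err h x / x\<^sup>2\<bar> \<le> 1"
        using abs_cell_err_le[of h x] by (auto simp: divide_le_eq)
    qed measurable
  qed (auto simp: n_def)
  moreover have "8 * h / (real n)\<^sup>2 \<le> 16 * h * (1 / real n - 1 / (real n + 1))"
  proof -
    have "1 / (real n)\<^sup>2 \<le> 2 * (1 / real n - 1 / (real n + 1))"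
    proof -
      have "real n * 1 \<le> real n * real n" using n by (intro mult_left_mono) auto
      then have "2 / (2 * (real n)\<^sup>2) \<le> 2 / (real n * (real n + 1))"
        using n by (intro divide_left_mono) (auto simp: power2_eq_square algebra_simps intro!: mult_pos_pos add_pos_pos)
      also have "2 / (real n * (real n + 1)) = 2 * (1 / real n - 1 / (real n + 1))"
        using n by (simp add: divide_simps)
      finally show ?thesis by simp
    qed
    then have "8 * h * (1 / (real n)\<^sup>2) \<le> 8 * h * (2 * (1 / real n - 1 / (real n + 1)))"
      using h by (intro mult_left_mono) auto
    then show ?thesis by (simp add: algebra_simps)
  qed
  ultimately have "\<bar>integral {real N..real n + 1} (\<lambda>x. cell_err h x / x\<^sup>2)\<bar> \<le>
      16 * h * (1 / real N - 1 / real n) + (1 / (real N)\<^sup>2 - 1 / (real n)\<^sup>2) +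
      (16 * h * (1 / real n - 1 / (real n + 1)) + (1 / (real n)\<^sup>2 - 1 / (real n + 1)\<^sup>2))"
    using Suc.IH cell_err_weighted_le[OF h n] unfolding n_def[symmetric] by linarith
  then show ?case by (simp add: n_def algebra_simps)
qed

text \<open>For \<open>x \<le> 1 / h\<close> the product \<open>(1 + h) * x\<close> passes exactly one integer in each cell, at
  \<open>x = (n + 1) / (1 + h)\<close>, so the integral is explicit there.\<close>

lemma has_integral_dilation_cell:
  assumes h: "0 < h" and nh: "real (n + 1) * h \<le> 1"
  shows "((\<lambda>x. dilation_sq h x / x\<^sup>2) has_integral (h\<^sup>2 - 2 * h * ln (1 + h) + h / real (n + 1)))
           {real n..real (n + 1)}"
proof -
  define b where "b = real (n + 1) / (1 + h)"
  have b: "real n \<le> b" "b \<le> real (n + 1)" "b > 0" "(1 + h) * b = real (n + 1)"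
    using h nh by (auto simp: b_def field_simps)
  have "((\<lambda>x. dilation_sq h x / x\<^sup>2) has_integral h\<^sup>2 * (b - real n)) {real n..b}"
  proof (rule has_integral_spike[of "{0, b}" _ _ "\<lambda>_. h\<^sup>2"])
    fix x assume x: "x \<in> {real n..b} - {0, b}"
    then have "(1 + h) * x < real n + 1"
      using b h mult_strict_left_mono[of x b "1 + h"] by auto
    moreover have "real n \<le> (1 + h) * x"
    proof -
      have "0 \<le> x" using x order_trans[of 0 "real n" x] by auto
      then have "0 \<le> h * x" using h by simp
      moreover have "real n \<le> x" using x by simp
      ultimately show ?thesis by (simp add: distrib_right)
    qed
    moreover have "x < real n + 1" using x b by auto
    ultimately have "\<lfloor>x\<rfloor> = int n" "\<lfloor>(1 + h) * x\<rfloor> = int n" using x by (auto simp: floor_eq_iff)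
    then have "frac ((1 + h) * x) - frac x = h * x" by (simp add: frac_def algebra_simps)
    then show "dilation_sq h x / x\<^sup>2 = h\<^sup>2"
      using x by (simp add: dilation_sq_def power_mult_distrib)
  next
    show "((\<lambda>_. h\<^sup>2) has_integral h\<^sup>2 * (b - real n)) {real n..b}"
      using has_integral_const_real[of "h\<^sup>2" "real n" b] b by (simp add: mult.commute)
  qed auto
  moreover have "((\<lambda>x. dilation_sq h x / x\<^sup>2) has_integral
       (h\<^sup>2 * real (n + 1) - 2 * h * ln (real (n + 1)) - 1 / real (n + 1)) -
       (h\<^sup>2 * b - 2 * h * ln b - 1 / b)) {b..real (n + 1)}"
  proof (rule has_integral_spike[of "{real (n + 1)}" _ _ "\<lambda>x. h\<^sup>2 - 2 * h * (1 / x) + 1 / x\<^sup>2"])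
    fix x assume x: "x \<in> {b..real (n + 1)} - {real (n + 1)}"
    have "real n + 1 \<le> (1 + h) * x"
      using b h x mult_left_mono[of b x "1 + h"] by auto
    moreover have "(1 + h) * x < real n + 2"
    proof -
      have "h * x < h * real (n + 1)" using x h by (intro mult_strict_left_mono) auto
      then have "h * x < 1" using nh by (simp add: mult.commute)
      then show ?thesis using x by (simp add: algebra_simps)
    qed
    ultimately have "\<lfloor>x\<rfloor> = int n" "\<lfloor>(1 + h) * x\<rfloor> = int n + 1" using x b by (auto simp: floor_eq_iff)
    then have "frac ((1 + h) * x) - frac x = h * x - 1" by (simp add: frac_def algebra_simps)
    then have "dilation_sq h x = (h * x - 1)\<^sup>2" by (simp only: dilation_sq_def)
    then show "dilation_sq h x / x\<^sup>2 = h\<^sup>2 - 2 * h * (1 / x) + 1 / x\<^sup>2"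
      using x b by (simp add: field_simps power2_eq_square)
  next
    show "((\<lambda>x. h\<^sup>2 - 2 * h * (1 / x) + 1 / x\<^sup>2) has_integral
       (h\<^sup>2 * real (n + 1) - 2 * h * ln (real (n + 1)) - 1 / real (n + 1)) -
       (h\<^sup>2 * b - 2 * h * ln b - 1 / b)) {b..real (n + 1)}"
    proof (rule fundamental_theorem_of_calculus)
      fix x assume "x \<in> {b..real (n + 1)}"
      then have "x > 0" using b by auto
      then have "((\<lambda>x. h\<^sup>2 * x - 2 * h * ln x - 1 / x) has_real_derivative (h\<^sup>2 - 2 * h * (1 / x) + 1 / x\<^sup>2)) (at x within {b..real (n + 1)})"
        by (auto intro!: derivative_eq_intros simp: power2_eq_square)
      then show "((\<lambda>x. h\<^sup>2 * x - 2 * h * ln x - 1 / x) has_vector_derivative (h\<^sup>2 - 2 * h * (1 / x) + 1 / x\<^sup>2)) (at x within {b..real (n + 1)})"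
        by (simp add: has_real_derivative_iff_has_vector_derivative)
    qed (use b in auto)
  qed auto
  ultimately have "((\<lambda>x. dilation_sq h x / x\<^sup>2) has_integral h\<^sup>2 * (b - real n) +
       ((h\<^sup>2 * real (n + 1) - 2 * h * ln (real (n + 1)) - 1 / real (n + 1)) -
       (h\<^sup>2 * b - 2 * h * ln b - 1 / b))) {real n..real (n + 1)}"
    by (intro has_integral_combine[OF b(1,2)])
  also have "ln b = ln (real (n + 1)) - ln (1 + h)"
    using h by (simp add: b_def ln_div)
  also have "1 / b = 1 / real (n + 1) + h / real (n + 1)"
    by (simp only: b_def divide_divide_eq_right mult_1 add_divide_distrib)
  finally show ?thesis by (simp add: algebra_simps)
qed

text \<open>The terms \<open>h / (n + 1)\<close> of the cells add up to the harmonic number, the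
  origin of the main term \<open>h * ln (1 / h)\<close>.\<close>

lemma has_integral_dilation_head:
  assumes h: "0 < h" and Nh: "real N * h \<le> 1"
  shows "((\<lambda>x. dilation_sq h x / x\<^sup>2) has_integral (real N * (h\<^sup>2 - 2 * h * ln (1 + h)) + h * harm N)) {0..real N}"
  using Nh
proof (induction N)
  case 0
  then show ?case by (simp add: harm_def has_integral_refl)
next
  case (Suc N)
  have "real N * h \<le> 1" using Suc.prems h by (simp add: algebra_simps)
  from has_integral_combine[OF _ _ Suc.IH[OF this] has_integral_dilation_cell[of h N]] h Suc.prems
  have "((\<lambda>x. dilation_sq h x / x\<^sup>2) has_integral (real N * (h\<^sup>2 - 2 * h * ln (1 + h)) + h * harm N) +
     (h\<^sup>2 - 2 * h * ln (1 + h) + h / real (N + 1))) {0..real (N + 1)}"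
    by simp
  then show ?case by (simp add: harm_Suc algebra_simps inverse_eq_divide)
qed

section \<open>The substitution \<open>x = exp u\<close> and the asymptotics of dilations\<close>

lemma exp_substitution:
  fixes f :: "real \<Rightarrow> real"
  assumes f [measurable]: "f \<in> borel_measurable borel"
    and int: "integrable lborel (\<lambda>u. exp u * f (exp u))"
  shows "set_integrable lborel {0<..} f"
    and "(LINT x:{0<..}|lborel. f x) = (LINT u|lborel. exp u * f (exp u))"
proof -
  have int': "integrable lebesgue (\<lambda>u. exp u * f (exp u))"
    by (subst integrable_completion) (use int in auto)
  have "((\<lambda>u. \<bar>exp u\<bar> * f (exp u)) absolutely_integrable_on UNIV \<and>
           integral UNIV (\<lambda>u. \<bar>exp u\<bar> * f (exp u)) = (LINT u|lborel. exp u * f (exp u)))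
     \<longleftrightarrow> f absolutely_integrable_on (exp ` UNIV) \<and> integral (exp ` UNIV) f = (LINT u|lborel. exp u * f (exp u))"
    by (rule has_absolute_integral_change_of_variables_1') (auto intro: DERIV_exp inj_onI)
  moreover have "(\<lambda>u. \<bar>exp u\<bar> * f (exp u)) absolutely_integrable_on UNIV"
    using int' by (simp add: set_integrable_def)
  moreover have "integral UNIV (\<lambda>u. \<bar>exp u\<bar> * f (exp u)) = (LINT u|lborel. exp u * f (exp u))"
    using integral_unique[OF has_integral_integral_lborel[OF int]] by simp
  moreover have "exp ` (UNIV :: real set) = {0<..}"
    by (auto simp: image_iff) (metis exp_ln)
  ultimately have *: "f absolutely_integrable_on {0<..}" "integral {0<..} f = (LINT u|lborel. exp u * f (exp u))"
    by auto
  show set: "set_integrable lborel {0<..} f"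
    using *(1) unfolding set_integrable_def by (subst (asm) integrable_completion) auto
  show "(LINT x:{0<..}|lborel. f x) = (LINT u|lborel. exp u * f (exp u))"
    using set_borel_integral_eq_integral(2)[OF set] *(2) by simp
qed

text \<open>If \<open>exp u < 1/2\<close>, neither point reaches 1 and the difference of the
  fractional parts is exactly \<open>h * exp u\<close>. For \<open>1/2 \<le> exp u < 1\<close> the
  bound 1 is already below \<open>4 * (exp u)\<^sup>2\<close>.\<close>

lemma dilation_sq_exp_le:
  assumes h: "0 < h" "h \<le> 1"
  shows "dilation_sq h (exp u) / exp u \<le> 4 * exp (- \<bar>u\<bar> * 1)"
proof (cases "u \<ge> 0")
  case True
  then have "dilation_sq h (exp u) / exp u \<le> 1 / exp u"
    using dilation_sq_le by (intro divide_right_mono) auto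
  also have "1 / exp u = exp (- u)" by (simp add: exp_minus inverse_eq_divide)
  also have "exp (- u) \<le> 4 * exp (- u)" by simp
  finally show ?thesis using True by simp
next
  case False
  have "dilation_sq h (exp u) \<le> 4 * (exp u)\<^sup>2"
  proof (cases "exp u < 1/2")
    case True
    have "(1 + h) * exp u < 2 * (1/2)" using True h by (intro mult_le_less_imp_less) auto
    moreover have "0 < (1 + h) * exp u" using h by simp
    ultimately have "frac ((1 + h) * exp u) = (1 + h) * exp u" "frac (exp u) = exp u"
      using True False by (auto simp: frac_eq)
    then have "dilation_sq h (exp u) = (h * exp u)\<^sup>2" by (simp add: dilation_sq_def algebra_simps)
    also have "\<dots> \<le> (2 * exp u)\<^sup>2" using h by (intro power_mono mult_right_mono) auto
    finally show ?thesis by (simp add: power_mult_distrib)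
  next
    case False
    then have "(1/2)\<^sup>2 \<le> (exp u)\<^sup>2" by (intro power_mono) auto
    then show ?thesis using dilation_sq_le[of h "exp u"] by (simp add: power2_eq_square)
  qed
  then have "dilation_sq h (exp u) / exp u \<le> 4 * (exp u)\<^sup>2 / exp u"
    by (rule divide_right_mono) simp
  then show ?thesis using False by (simp add: power2_eq_square)
qed

lemma integrable_dilation_exp:
  assumes h: "0 < h" "h \<le> 1"
  shows "integrable lborel (\<lambda>u. dilation_sq h (exp u) / exp u)"
proof (rule Bochner_Integration.integrable_bound[of _ "\<lambda>u. 4 * exp (- \<bar>u\<bar> * 1)"])
  show "integrable lborel (\<lambda>u::real. 4 * exp (- \<bar>u\<bar> * 1))"
    by (intro integrable_mult_right integrable_exp_abs) simp
  show "AE u in lborel. norm (dilation_sq h (exp u) / exp u) \<le> norm (4 * exp (- \<bar>u\<bar> * 1))"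
    using dilation_sq_exp_le[OF h] dilation_sq_nonneg by (auto simp: abs_mult)
qed measurable

lemma dilation_exp_eq:
  assumes h: "0 < h" "h \<le> 1"
  shows "set_integrable lborel {0<..} (\<lambda>x. dilation_sq h x / x\<^sup>2)"
    and "(LINT u|lborel. dilation_sq h (exp u) / exp u) = (LINT x:{0<..}|lborel. dilation_sq h x / x\<^sup>2)"
proof -
  have eq: "exp u * (dilation_sq h (exp u) / (exp u)\<^sup>2) = dilation_sq h (exp u) / exp u" for u :: real
    by (simp add: power2_eq_square)
  have "integrable lborel (\<lambda>u. exp u * (dilation_sq h (exp u) / (exp u)\<^sup>2))"
    unfolding eq by (rule integrable_dilation_exp[OF h])
  moreover have "(\<lambda>x. dilation_sq h x / x\<^sup>2) \<in> borel_measurable borel" by measurable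
  ultimately show "set_integrable lborel {0<..} (\<lambda>x. dilation_sq h x / x\<^sup>2)"
    and "(LINT u|lborel. dilation_sq h (exp u) / exp u) = (LINT x:{0<..}|lborel. dilation_sq h x / x\<^sup>2)"
    using exp_substitution[of "\<lambda>x. dilation_sq h x / x\<^sup>2"] by (simp_all only: eq)
qed

lemma set_integrable_inverse_square:
  assumes a: "(a::real) > 0"
  shows "set_integrable lborel {a..} (\<lambda>x. 1 / x\<^sup>2)"
proof -
  have "integrable lborel (\<lambda>u. exp u * (indicator {a..} (exp u) / (exp u)\<^sup>2) :: real)"
  proof (rule Bochner_Integration.integrable_bound[of _ "\<lambda>u. exp (2 * \<bar>ln a\<bar>) * exp (- \<bar>u\<bar> * 1)"])
    show "integrable lborel (\<lambda>u::real. exp (2 * \<bar>ln a\<bar>) * exp (- \<bar>u\<bar> * 1))"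
      by (intro integrable_mult_right integrable_exp_abs) simp
    show "AE u in lborel. norm (exp u * (indicator {a..} (exp u) / (exp u)\<^sup>2)) \<le> norm (exp (2 * \<bar>ln a\<bar>) * exp (- \<bar>u\<bar> * 1))"
    proof (rule AE_I2)
      fix u :: real
      show "norm (exp u * (indicator {a..} (exp u) / (exp u)\<^sup>2)) \<le> norm (exp (2 * \<bar>ln a\<bar>) * exp (- \<bar>u\<bar> * 1))"
      proof (cases "a \<le> exp u")
        case True
        then have "ln a \<le> u" using a ln_le_cancel_iff[of a "exp u"] by simp
        then have "- u \<le> 2 * \<bar>ln a\<bar> - \<bar>u\<bar>" by linarith
        then have "exp (- u) \<le> exp (2 * \<bar>ln a\<bar> - \<bar>u\<bar>)" by simp
        then show ?thesis using True by (simp add: power2_eq_square exp_minus exp_diff inverse_eq_divide)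
      qed simp
    qed
  qed measurable
  from exp_substitution(1)[OF _ this] have "integrable lborel (\<lambda>x. indicator {0<..} x *\<^sub>R (indicator {a..} x / x\<^sup>2) :: real)"
    by (simp add: set_integrable_def)
  also have "(\<lambda>x. indicator {0<..} x *\<^sub>R (indicator {a..} x / x\<^sup>2) :: real) = (\<lambda>x. indicator {a..} x *\<^sub>R (1 / x\<^sup>2))"
    using a by (auto simp: indicator_def)
  finally show ?thesis by (simp add: set_integrable_def)
qed

lemma set_integrable_bounded_over_square:
  fixes f :: "real \<Rightarrow> real"
  assumes a: "a > 0" and [measurable]: "f \<in> borel_measurable borel" and f: "\<And>x. \<bar>f x\<bar> \<le> 1"
  shows "set_integrable lborel {a..} (\<lambda>x. f x / x\<^sup>2)"
proof (rule set_integrable_bound[OF set_integrable_inverse_square[OF a]])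
  show "AE x in lborel. x \<in> {a..} \<longrightarrow> norm (f x / x\<^sup>2) \<le> norm (1 / x\<^sup>2)"
    using f by (auto intro!: divide_right_mono)
qed (simp add: set_borel_measurable_def)

lemma cell_err_tail_integral_le:
  assumes h: "h \<ge> 0" and N: "N > 0"
  shows "\<bar>LINT x:{real N..}|lborel. cell_err h x / x\<^sup>2\<bar> \<le> 16 * h / real N + 1 / (real N)\<^sup>2"
proof -
  have int: "set_integrable lborel {real N..} (\<lambda>x. cell_err h x / x\<^sup>2)"
    using N abs_cell_err_le by (intro set_integrable_bounded_over_square) auto
  have "((\<lambda>b. LINT x:{real N..b}|lborel. cell_err h x / x\<^sup>2) \<longlongrightarrow> (LINT x:{real N..}|lborel. cell_err h x / x\<^sup>2)) at_top"
    by (intro tendsto_set_lebesgue_integral_at_top int) auto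
  moreover have "filterlim (\<lambda>k. real (N + k)) at_top sequentially" by real_asymp
  ultimately have lim: "(\<lambda>k. \<bar>LINT x:{real N..real (N + k)}|lborel. cell_err h x / x\<^sup>2\<bar>)
      \<longlonglongrightarrow> \<bar>LINT x:{real N..}|lborel. cell_err h x / x\<^sup>2\<bar>"
    by (intro tendsto_rabs) (rule filterlim_compose)
  show ?thesis
  proof (rule LIMSEQ_le_const2[OF lim], intro exI allI impI)
    fix k
    have eq: "(LINT x:{real N..real (N + k)}|lborel. cell_err h x / x\<^sup>2) = integral {real N..real (N + k)} (\<lambda>x. cell_err h x / x\<^sup>2)"
      by (intro set_borel_integral_eq_integral set_integrable_subset[OF int]) auto
    have "16 * h * (1 / real N - 1 / real (N + k)) \<le> 16 * h / real N"
      using h mult_left_mono[of "1 / real N - 1 / real (N + k)" "1 / real N" "16 * h"] by simp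
    moreover have "1 / (real N)\<^sup>2 - 1 / (real (N + k))\<^sup>2 \<le> 1 / (real N)\<^sup>2" by simp
    ultimately show "\<bar>LINT x:{real N..real (N + k)}|lborel. cell_err h x / x\<^sup>2\<bar> \<le> 16 * h / real N + 1 / (real N)\<^sup>2"
      unfolding eq using cell_err_tail_le[OF h N, of k] by linarith
  qed
qed

lemma saw_tail_scale:
  assumes h: "h > 0" and a: "a > 0"
  shows "(LINT x:{a..}|lborel. saw (h * x) / x\<^sup>2) = h * (LINT v:{h * a..}|lborel. saw v / v\<^sup>2)"
proof -
  have "(LINT v:{h * a..}|lborel. saw v / v\<^sup>2) =
      \<bar>h\<bar> *\<^sub>R (LINT x|lborel. indicator {h * a..} (0 + h * x) *\<^sub>R (saw (0 + h * x) / (0 + h * x)\<^sup>2))"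
    unfolding set_lebesgue_integral_def using h by (intro lborel_integral_real_affine) simp
  also have "(\<lambda>x. indicator {h * a..} (0 + h * x) *\<^sub>R (saw (0 + h * x) / (0 + h * x)\<^sup>2)) =
      (\<lambda>x. (1 / h\<^sup>2) * (indicator {a..} x *\<^sub>R (saw (h * x) / x\<^sup>2)))"
    using h by (auto simp: indicator_def power_mult_distrib)
  also have "\<bar>h\<bar> *\<^sub>R (LINT x|lborel. (1 / h\<^sup>2) * (indicator {a..} x *\<^sub>R (saw (h * x) / x\<^sup>2))) =
      (1 / h) * (LINT x:{a..}|lborel. saw (h * x) / x\<^sup>2)"
    unfolding set_lebesgue_integral_def integral_mult_right_zero using h by (simp add: power2_eq_square)
  finally show ?thesis using h by simp
qed

definition saw_const :: real where
  "saw_const = (LINT v:{1..}|lborel. saw v / v\<^sup>2)"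

text \<open>On \<open>v \<ge> 1/2\<close> the integrand is at most 4. The lemma is applied to
  \<open>c = h * real N\<close>, which misses 1 by at most \<open>h\<close>.\<close>

lemma saw_tail_le:
  assumes c: "1/2 \<le> c" "c \<le> 1"
  shows "\<bar>(LINT v:{c..}|lborel. saw v / v\<^sup>2) - saw_const\<bar> \<le> 4 * (1 - c)"
proof -
  have int: "set_integrable lborel {c..} (\<lambda>v. saw v / v\<^sup>2)"
    using c saw_nonneg saw_le by (intro set_integrable_bounded_over_square) auto
  have "{c..} = {c..1} \<union> {1..}" using c by auto
  then have "(LINT v:{c..}|lborel. saw v / v\<^sup>2) = (LINT v:{c..1} \<union> {1..}|lborel. saw v / v\<^sup>2)" by simp
  also have "\<dots> = (LINT v:{c..1}|lborel. saw v / v\<^sup>2) + saw_const"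
    unfolding saw_const_def
  proof (rule set_integral_Un_AE)
    show "AE x in lborel. \<not> (x \<in> {c..1} \<and> x \<in> {1..})"
      using AE_lborel_singleton[of 1] by eventually_elim auto
  qed (use c in \<open>auto intro: set_integrable_subset[OF int]\<close>)
  finally have eq: "(LINT v:{c..}|lborel. saw v / v\<^sup>2) - saw_const = (LINT v:{c..1}|lborel. saw v / v\<^sup>2)" by simp
  have "\<bar>LINT v:{c..1}|lborel. saw v / v\<^sup>2\<bar> \<le> (LINT v:{c..1}|lborel. 4)"
    unfolding set_lebesgue_integral_def real_norm_def[symmetric]
  proof (rule Bochner_Integration.integral_norm_bound_integral)
    show "integrable lborel (\<lambda>v. indicator {c..1} v *\<^sub>R (saw v / v\<^sup>2))"
      using set_integrable_subset[OF int, of "{c..1}"] by (auto simp: set_integrable_def)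
    show "integrable lborel (\<lambda>v. indicator {c..1} v *\<^sub>R (4::real))"
      by (intro integrable_scaleR_left integrable_real_indicator) (auto simp: emeasure_lborel_Icc_eq)
    fix v :: real
    have "saw v / v\<^sup>2 \<le> 1 / (1/2)\<^sup>2" if "c \<le> v"
      using saw_nonneg saw_le that c by (intro frac_le power_mono) auto
    then show "norm (indicator {c..1} v *\<^sub>R (saw v / v\<^sup>2)) \<le> indicator {c..1} v *\<^sub>R 4"
      using saw_nonneg by (auto simp: indicator_def power2_eq_square)
  qed
  also have "\<dots> = 4 * (1 - c)"
    using c by (simp add: set_lebesgue_integral_def measure_lborel_Icc)
  finally show ?thesis unfolding eq .
qed

lemma abs_harm_minus_ln_le:
  assumes "N > 0"
  shows "\<bar>harm N - ln (real N) - euler_mascheroni\<bar> \<le> 1 / real N"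
proof -
  have *: "euler_mascheroni \<in> {harm N - ln (real (Suc N)) + inverse (real (2 * (N + 1)))..harm N - ln (real (Suc N)) + inverse (real (2 * N))}"
    using euler_mascheroni_bounds[of N] assms by simp
  have "ln (real (Suc N)) - ln (real N) \<le> 1 / real N"
    using ln_diff_le[of "real (Suc N)" "real N"] assms by simp
  moreover have "ln (real N) \<le> ln (real (Suc N))" using assms by simp
  moreover have "inverse (real (2 * N)) \<le> 1 / real N" "inverse (real (2 * (N + 1))) \<ge> 0"
    using assms by (auto simp: field_simps)
  ultimately show ?thesis using * unfolding atLeastAtMost_iff by linarith
qed

text \<open>The half-line is cut at \<open>N\<close> close to \<open>1 / h\<close>. Below, every
  cell is explicit and the harmonic sum appears; above, \<open>dilation_sq\<close> is replaced by
  its local mean \<open>saw (h * x)\<close>, whose contribution scales to nearly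
  \<open>h * saw_const\<close>. The constant is
  \<open>C = euler_mascheroni + saw_const - 1\<close>.\<close>

lemma dilation_integral_asymp:
  "\<exists>C K. \<forall>h. 0 < h \<and> h \<le> 1 \<longrightarrow>
     \<bar>(LINT u|lborel. dilation_sq h (exp u) / exp u) - (h * ln (1 / h) + C * h)\<bar> \<le> K * h\<^sup>2"
proof (intro exI allI impI, elim conjE)
  fix h :: real assume h: "0 < h" "h \<le> 1"
  define N where "N = nat \<lfloor>1 / h\<rfloor>"
  have N1: "real N \<le> 1 / h" "1 / h < real N + 1" using h by (auto simp: N_def)
  have "1 \<le> 1 / h" using h by simp
  then have "N > 0" using N1 by (cases N) auto
  have Nh: "real N * h \<le> 1" "1 - real N * h \<le> h" using N1 h by (auto simp: field_simps)
  have "1 / h \<le> 2 * real N" using N1 \<open>N > 0\<close> by auto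
  then have N2: "1 / real N \<le> 2 * h" using \<open>N > 0\<close> h by (simp add: field_simps)
  let ?f = "\<lambda>x. dilation_sq h x / x\<^sup>2"
  have int: "set_integrable lborel {0<..} ?f" by (rule dilation_exp_eq[OF h])
  have Ns: "(LINT x:{0<..real N}|lborel. ?f x) = real N * (h\<^sup>2 - 2 * h * ln (1 + h)) + h * harm N"
  proof -
    have "(LINT x:{0<..real N}|lborel. ?f x) = integral {0<..real N} ?f"
      by (intro set_borel_integral_eq_integral set_integrable_subset[OF int]) auto
    also have "\<dots> = integral {0..real N} ?f"
      by (rule integral_spike_set) (auto intro: negligible_subset[of "{0}"])
    also have "\<dots> = real N * (h\<^sup>2 - 2 * h * ln (1 + h)) + h * harm N"
      by (rule integral_unique[OF has_integral_dilation_head[OF h(1) Nh(1)]])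
    finally show ?thesis .
  qed
  have tail: "(LINT x:{real N..}|lborel. ?f x) =
      (LINT x:{real N..}|lborel. cell_err h x / x\<^sup>2) + h * (LINT v:{h * real N..}|lborel. saw v / v\<^sup>2)"
  proof -
    have i1: "set_integrable lborel {real N..} (\<lambda>x. cell_err h x / x\<^sup>2)"
      using \<open>N > 0\<close> abs_cell_err_le by (intro set_integrable_bounded_over_square) auto
    have i2: "set_integrable lborel {real N..} (\<lambda>x. saw (h * x) / x\<^sup>2)"
      using \<open>N > 0\<close> saw_nonneg saw_le by (intro set_integrable_bounded_over_square) auto
    have "?f x = cell_err h x / x\<^sup>2 + saw (h * x) / x\<^sup>2" for x
      by (simp add: cell_err_def diff_divide_distrib)
    then have "(LINT x:{real N..}|lborel. ?f x) = (LINT x:{real N..}|lborel. cell_err h x / x\<^sup>2 + saw (h * x) / x\<^sup>2)" by simp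
    then show ?thesis
      using set_integral_add(2)[OF i1 i2] saw_tail_scale[OF h(1), of "real N"] \<open>N > 0\<close> by simp
  qed
  have "(LINT x:{0<..}|lborel. ?f x) = (LINT x:{0<..real N}|lborel. ?f x) + (LINT x:{real N..}|lborel. ?f x)"
  proof -
    have "{0<..} = {0<..real N} \<union> {real N..}" using \<open>N > 0\<close> by auto
    then have "(LINT x:{0<..}|lborel. ?f x) = (LINT x:{0<..real N} \<union> {real N..}|lborel. ?f x)" by simp
    also have "\<dots> = (LINT x:{0<..real N}|lborel. ?f x) + (LINT x:{real N..}|lborel. ?f x)"
    proof (rule set_integral_Un_AE)
      show "AE x in lborel. \<not> (x \<in> {0<..real N} \<and> x \<in> {real N..})"
        using AE_lborel_singleton[of "real N"] by eventually_elim auto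
    qed (use \<open>N > 0\<close> in \<open>auto intro: set_integrable_subset[OF int]\<close>)
    finally show ?thesis .
  qed
  then have B: "(LINT u|lborel. dilation_sq h (exp u) / exp u) =
      real N * (h\<^sup>2 - 2 * h * ln (1 + h)) + h * harm N +
      (LINT x:{real N..}|lborel. cell_err h x / x\<^sup>2) + h * (LINT v:{h * real N..}|lborel. saw v / v\<^sup>2)"
    using dilation_exp_eq(2)[OF h] Ns tail by simp
  have e1: "\<bar>LINT x:{real N..}|lborel. cell_err h x / x\<^sup>2\<bar> \<le> 36 * h\<^sup>2"
  proof -
    have "16 * h / real N \<le> 32 * h\<^sup>2" using mult_left_mono[OF N2, of "16 * h"] h by (simp add: power2_eq_square)
    moreover have "1 / (real N)\<^sup>2 \<le> 4 * h\<^sup>2"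
      using power_mono[OF N2, of 2] by (simp add: power_divide power_mult_distrib)
    ultimately show ?thesis
      using cell_err_tail_integral_le[of h N] h \<open>N > 0\<close> by linarith
  qed
  have e2: "\<bar>h * (LINT v:{h * real N..}|lborel. saw v / v\<^sup>2) - h * saw_const\<bar> \<le> 4 * h\<^sup>2"
  proof -
    have "1 / 2 \<le> h * real N"
      using \<open>1 / h \<le> 2 * real N\<close> h by (simp add: field_simps)
    then have "\<bar>(LINT v:{h * real N..}|lborel. saw v / v\<^sup>2) - saw_const\<bar> \<le> 4 * (1 - h * real N)"
      using Nh by (intro saw_tail_le) (auto simp: mult.commute)
    also have "\<dots> \<le> 4 * h" using Nh by (simp add: mult.commute)
    finally have "h * \<bar>(LINT v:{h * real N..}|lborel. saw v / v\<^sup>2) - saw_const\<bar> \<le> h * (4 * h)"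
      using h by (intro mult_left_mono) auto
    then show ?thesis
      using h by (simp add: power2_eq_square abs_mult[of h, symmetric, unfolded abs_of_pos[OF h(1)]] right_diff_distrib)
  qed
  have e3: "\<bar>h * harm N - h * (ln (1 / h) + euler_mascheroni)\<bar> \<le> 4 * h\<^sup>2"
  proof -
    have "ln (1 / h) - ln (real N) \<le> (1 / h - real N) / real N"
      using ln_diff_le[of "1 / h" "real N"] h \<open>N > 0\<close> by simp
    also have "\<dots> \<le> 1 / real N" using N1 \<open>N > 0\<close> by (intro divide_right_mono) auto
    finally have 1: "ln (1 / h) - ln (real N) \<le> 1 / real N" .
    have 2: "ln (real N) \<le> ln (1 / h)" using N1 h \<open>N > 0\<close> by (subst ln_le_cancel_iff) auto
    have "\<bar>harm N - (ln (1 / h) + euler_mascheroni)\<bar> \<le> 4 * h"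
      using abs_harm_minus_ln_le[OF \<open>N > 0\<close>] 1 2 N2 by linarith
    then have "h * \<bar>harm N - (ln (1 / h) + euler_mascheroni)\<bar> \<le> h * (4 * h)"
      using h by (intro mult_left_mono) auto
    then show ?thesis
      using h by (simp add: power2_eq_square abs_mult[of h, symmetric, unfolded abs_of_pos[OF h(1)]] right_diff_distrib)
  qed
  \<comment> \<open>The source of the \<open>- 1\<close> in the constant: \<open>real N * h\<close>
    is 1 up to \<open>h\<close>, and \<open>ln (1 + h)\<close> is \<open>h\<close> up to
    \<open>h\<^sup>2\<close>, so the bracket is close to \<open>- (h\<^sup>2)\<close>.\<close>
  have e4: "\<bar>real N * (h\<^sup>2 - 2 * h * ln (1 + h)) - (- h)\<bar> \<le> 3 * h\<^sup>2"
  proof -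
    have "real N * (h\<^sup>2 - 2 * h * ln (1 + h)) + h = h * (1 - real N * h) - 2 * (real N * h) * (ln (1 + h) - h)"
      by (simp add: algebra_simps power2_eq_square)
    moreover have "\<bar>h * (1 - real N * h)\<bar> \<le> h * h"
      using Nh h by (auto simp: abs_mult intro!: mult_left_mono)
    moreover have "\<bar>2 * (real N * h) * (ln (1 + h) - h)\<bar> \<le> 2 * h\<^sup>2"
    proof -
      have "\<bar>real N * h\<bar> * \<bar>ln (1 + h) - h\<bar> \<le> 1 * h\<^sup>2"
        using Nh h by (intro mult_mono abs_ln_one_plus_x_minus_x_bound_nonneg) auto
      then show ?thesis by (simp add: abs_mult)
    qed
    ultimately show ?thesis by (simp add: power2_eq_square)
  qed
  have "h * ln (1 / h) + (euler_mascheroni + saw_const - 1) * h =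
      (- h) + h * (ln (1 / h) + euler_mascheroni) + h * saw_const"
    by (simp add: algebra_simps)
  \<comment> \<open>The constant is 47 = 36 + 4 + 4 + 3, from \<open>e1\<close> to
    \<open>e4\<close>.\<close>
  then show "\<bar>(LINT u|lborel. dilation_sq h (exp u) / exp u) - (h * ln (1 / h) + (euler_mascheroni + saw_const - 1) * h)\<bar> \<le> 47 * h\<^sup>2"
    unfolding B using e1 e2 e3 e4 by linarith
qed

section \<open>Squared norms of differences of translates of \<open>frac_exp\<close>\<close>

lemma integrable_frac_exp_sq: "integrable lborel (\<lambda>u. (frac_exp u)\<^sup>2)"
proof (rule Bochner_Integration.integrable_bound[OF integrable_frac_exp])
  have "(frac_exp u)\<^sup>2 \<le> frac_exp u" for u
  proof -
    have "frac_exp u \<le> 1" using frac_exp_le[of u] by (rule order_trans) simp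
    then show ?thesis using frac_exp_nonneg[of u] by (simp add: power2_eq_square mult_left_le)
  qed
  then show "AE u in lborel. norm ((frac_exp u)\<^sup>2) \<le> norm (frac_exp u)" by (auto simp: frac_exp_nonneg)
qed measurable

definition shift_sq :: "real \<Rightarrow> real" where
  "shift_sq y = (LINT u|lborel. (frac_exp (u + y) - frac_exp u)\<^sup>2)"

text \<open>Completing the square: \<open>exp (- y / 2)\<close> times the squared difference of the
  fractional parts absorbs the mixed product. The two leftover squares have the same integral by
  translation invariance.\<close>

lemma shift_sq_eq:
  assumes y: "0 < y" "exp y \<le> 2"
  shows "shift_sq y = exp (- y / 2) * (LINT u|lborel. dilation_sq (exp y - 1) (exp u) / exp u) +
           (2 - exp (y / 2) - exp (- y / 2)) * (LINT u|lborel. (frac_exp u)\<^sup>2)"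
proof -
  define h where "h = exp y - 1"
  have h: "0 < h" "h \<le> 1" using y by (auto simp: h_def)
  have pt: "(frac_exp (u + y) - frac_exp u)\<^sup>2 = exp (- y / 2) * (dilation_sq h (exp u) / exp u) +
     ((1 - exp (y / 2)) * (frac_exp (u + y))\<^sup>2 + (1 - exp (- y / 2)) * (frac_exp u)\<^sup>2)" for u
  proof -
    define a b r q where "a = frac (exp y * exp u)" and "b = frac (exp u)" and "r = exp (- y / 2)" and "q = exp (- u / 2)"
    have r: "exp (y / 2) = 1 / r" "r > 0" by (auto simp: r_def exp_minus inverse_eq_divide)
    have q: "1 / exp u = q\<^sup>2" by (simp add: q_def exp_minus inverse_eq_divide power2_eq_square flip: exp_add)
    have f: "frac_exp (u + y) = a * (q * r)" "frac_exp u = b * q"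
    proof -
      have "exp (- (u + y) / 2) = q * r" by (simp add: q_def r_def add_divide_distrib flip: exp_add)
      moreover have "exp (u + y) = exp y * exp u" by (simp add: exp_add)
      ultimately show "frac_exp (u + y) = a * (q * r)" by (simp add: frac_exp_def a_def)
    qed (simp add: frac_exp_def b_def q_def)
    have d: "dilation_sq h (exp u) / exp u = (a - b)\<^sup>2 * q\<^sup>2"
      using q by (simp add: dilation_sq_def h_def a_def b_def divide_inverse)
    show ?thesis
      unfolding f r(1) r_def[symmetric] d using r(2)
      by (simp add: power2_eq_square field_simps)
  qed
  have int: "integrable lborel (\<lambda>u. (frac_exp (u + y))\<^sup>2)"
    and eq: "(LINT u|lborel. (frac_exp (u + y))\<^sup>2) = (LINT u|lborel. (frac_exp u)\<^sup>2)"
    using lborel_integrable_real_affine[OF integrable_frac_exp_sq, of 1 y]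
      lborel_integral_real_affine[of 1 "\<lambda>u. (frac_exp u)\<^sup>2" y] by (simp_all add: add.commute)
  have linear: "(LINT u|lborel. c1 * p u + (c2 * q u + c3 * w u)) =
      c1 * (LINT u|lborel. p u) + (c2 * (LINT u|lborel. q u) + c3 * (LINT u|lborel. w u))"
    if "integrable lborel p" "integrable lborel q" "integrable lborel w"
    for c1 c2 c3 and p q w :: "real \<Rightarrow> real"
    using that by simp
  show ?thesis
    unfolding shift_sq_def pt linear[OF integrable_dilation_exp[OF h] int integrable_frac_exp_sq] eq h_def[symmetric]
    by (simp add: algebra_simps)
qed

text \<open>The expansion in \<open>h = exp y - 1\<close> is translated to \<open>y\<close>. The
  exponent 3/2 leaves a margin to the quadratic error terms; it is shared with the model density,
  where error terms carry logarithms.\<close>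

lemma shift_sq_asymp:
  obtains C where "(\<lambda>y. shift_sq y - (y * ln (1 / y) + C * y)) \<in> O[at_right 0](\<lambda>y. y powr (3/2))"
proof -
  define B where "B h = (LINT u|lborel. dilation_sq h (exp u) / exp u)" for h
  obtain C K where CK: "\<And>h. 0 < h \<Longrightarrow> h \<le> 1 \<Longrightarrow> \<bar>B h - (h * ln (1 / h) + C * h)\<bar> \<le> K * h\<^sup>2"
    using dilation_integral_asymp unfolding B_def by blast
  define A where "A = (LINT u|lborel. (frac_exp u)\<^sup>2)"
  have ev: "\<forall>\<^sub>F y in at_right 0. 0 < y \<and> exp y \<le> (2::real)"
  proof -
    have "\<forall>\<^sub>F y in at_right 0. y \<in> {0<..<ln 2 :: real}"
      by (rule eventually_at_right_real) simp
    then show ?thesis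
      by eventually_elim (auto simp: ln_ge_iff[symmetric] intro: less_imp_le)
  qed
  have R: "(\<lambda>y. B (exp y - 1) - ((exp y - 1) * ln (1 / (exp y - 1)) + C * (exp y - 1))) \<in> O[at_right 0](\<lambda>y. (exp y - 1)\<^sup>2)"
    using ev by (intro bigoI[of _ K], eventually_elim) (use CK in auto)
  have R': "(\<lambda>y::real. (exp y - 1)\<^sup>2) \<in> O[at_right 0](\<lambda>y. y powr (3/2))" by real_asymp
  have "(\<lambda>y. exp (- y / 2) * (B (exp y - 1) - ((exp y - 1) * ln (1 / (exp y - 1)) + C * (exp y - 1)))) \<in> O[at_right 0](\<lambda>y. 1 * y powr (3/2))"
  proof (rule landau_o.big.mult)
    show "(\<lambda>y::real. exp (- y / 2)) \<in> O[at_right 0](\<lambda>_. 1)" by real_asymp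
  qed (rule landau_o.big_trans[OF R R'])
  then have t1: "(\<lambda>y. exp (- y / 2) * (B (exp y - 1) - ((exp y - 1) * ln (1 / (exp y - 1)) + C * (exp y - 1)))) \<in> O[at_right 0](\<lambda>y. y powr (3/2))"
    by simp
  have t2: "(\<lambda>y::real. exp (- y / 2) * ((exp y - 1) * ln (1 / (exp y - 1))) - y * ln (1 / y)) \<in> O[at_right 0](\<lambda>y. y powr (3/2))"
    by real_asymp
  have "(\<lambda>y::real. exp (- y / 2) * (exp y - 1) - y) \<in> O[at_right 0](\<lambda>y. y powr (3/2))"
    by real_asymp
  then have t3: "(\<lambda>y::real. C * (exp (- y / 2) * (exp y - 1) - y)) \<in> O[at_right 0](\<lambda>y. y powr (3/2))"
    by (cases "C = 0") simp_all
  have "(\<lambda>y::real. 2 - exp (y / 2) - exp (- y / 2)) \<in> O[at_right 0](\<lambda>y. y powr (3/2))"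
    by real_asymp
  then have t4: "(\<lambda>y::real. (2 - exp (y / 2) - exp (- y / 2)) * A) \<in> O[at_right 0](\<lambda>y. y powr (3/2))"
    by (cases "A = 0") simp_all
  have "(\<lambda>y. exp (- y / 2) * (B (exp y - 1) - ((exp y - 1) * ln (1 / (exp y - 1)) + C * (exp y - 1))) +
     (exp (- y / 2) * ((exp y - 1) * ln (1 / (exp y - 1))) - y * ln (1 / y)) +
     C * (exp (- y / 2) * (exp y - 1) - y) + (2 - exp (y / 2) - exp (- y / 2)) * A) \<in> O[at_right 0](\<lambda>y. y powr (3/2))"
    by (intro sum_in_bigo t1 t2 t3 t4)
  also have "?this \<longleftrightarrow> (\<lambda>y. shift_sq y - (y * ln (1 / y) + C * y)) \<in> O[at_right 0](\<lambda>y. y powr (3/2))"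
  proof (rule landau_o.big.in_cong)
    show "\<forall>\<^sub>F y in at_right 0. exp (- y / 2) * (B (exp y - 1) - ((exp y - 1) * ln (1 / (exp y - 1)) + C * (exp y - 1))) +
     (exp (- y / 2) * ((exp y - 1) * ln (1 / (exp y - 1))) - y * ln (1 / y)) +
     C * (exp (- y / 2) * (exp y - 1) - y) + (2 - exp (y / 2) - exp (- y / 2)) * A = shift_sq y - (y * ln (1 / y) + C * y)"
      using ev by eventually_elim (simp add: shift_sq_eq B_def A_def algebra_simps)
  qed
  finally show ?thesis by (rule that)
qed

lemma shift_sq_minus: "shift_sq (- y) = shift_sq y"
proof -
  have "shift_sq (- y) = (LINT u|lborel. (frac_exp ((y + 1 * u) + - y) - frac_exp (y + 1 * u))\<^sup>2)"
    unfolding shift_sq_def by (subst lborel_integral_real_affine[of 1 _ y]) simp_all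
  also have "\<dots> = shift_sq y"
    unfolding shift_sq_def by (intro Bochner_Integration.integral_cong refl) (simp add: power2_commute add.commute)
  finally show ?thesis .
qed

text \<open>Supplies the hypothesis \<open>cont\<close> of \<open>plancherel\<close> for
  \<open>frac_exp\<close>, and through it the integrability of \<open>zeta_dens\<close>.\<close>

lemma shift_sq_tendsto_0: "(shift_sq \<longlongrightarrow> 0) (at 0)"
proof -
  obtain C where C: "(\<lambda>y. shift_sq y - (y * ln (1 / y) + C * y)) \<in> O[at_right 0](\<lambda>y. y powr (3/2))"
    using shift_sq_asymp by blast
  have "((\<lambda>y. y powr (3/2)) \<longlongrightarrow> (0::real)) (at_right 0)" by real_asymp
  then have lim: "((\<lambda>y::real. c * norm (y powr (3/2))) \<longlongrightarrow> (0::real)) (at_right 0)" for c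
    by (intro tendsto_mult_right_zero tendsto_norm_zero)
  obtain c where "\<forall>\<^sub>F y in at_right 0. norm (shift_sq y - (y * ln (1 / y) + C * y)) \<le> c * norm (y powr (3/2))"
    using C by (elim landau_o.bigE)
  then have "((\<lambda>y. shift_sq y - (y * ln (1 / y) + C * y)) \<longlongrightarrow> 0) (at_right 0)"
    using lim by (rule Lim_null_comparison)
  moreover have "((\<lambda>y::real. y * ln (1 / y) + C * y) \<longlongrightarrow> 0) (at_right 0)"
    by real_asymp
  ultimately have "((\<lambda>y. (shift_sq y - (y * ln (1 / y) + C * y)) + (y * ln (1 / y) + C * y)) \<longlongrightarrow> 0 + 0) (at_right 0)"
    by (rule tendsto_add)
  then have R: "(shift_sq \<longlongrightarrow> 0) (at_right 0)" by simp
  then have "((\<lambda>y. shift_sq (- y)) \<longlongrightarrow> 0) (at_left 0)"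
    by (simp add: filterlim_at_left_to_right)
  then have "(shift_sq \<longlongrightarrow> 0) (at_left 0)" by (simp add: shift_sq_minus)
  with R show ?thesis by (rule filterlim_split_at_real[rotated])
qed

subsection \<open>Cosine integrals of the zeta density and of a model density\<close>

definition zeta_dens :: "real \<Rightarrow> real" where
  "zeta_dens t = zeta_sq t / (1/4 + t\<^sup>2)"

lemma zeta_dens_nonneg: "zeta_dens t \<ge> 0"
  by (simp add: zeta_dens_def zeta_sq_def add_nonneg_nonneg)

lemma integrable_zeta_dens: "integrable lborel zeta_dens"
proof -
  have "((\<lambda>h. LINT u|lborel. (frac_exp (u + h) - frac_exp u)\<^sup>2) \<longlongrightarrow> 0) (at 0)"
    using shift_sq_tendsto_0 by (simp add: shift_sq_def[abs_def])
  from plancherel[OF integrable_frac_exp integrable_frac_exp_sq this] show ?thesis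
    by (simp add: norm_fourier_frac_exp zeta_dens_def[abs_def] has_bochner_integral_iff)
qed

text \<open>Plancherel for the difference \<open>g\<close>: translation by \<open>y\<close>
  multiplies the transform by \<open>cis (t * y)\<close>, and the squared modulus of
  \<open>cis (t * y) - 1\<close> is \<open>2 * (1 - cos (t * y))\<close>.\<close>

lemma zeta_dens_cos_integral:
  "(LINT t|lborel. zeta_dens t * (1 - cos (y * t))) = pi * shift_sq y"
proof -
  define g where "g u = frac_exp (u + y) - frac_exp u" for u
  have [measurable]: "g \<in> borel_measurable borel" unfolding g_def[abs_def] by measurable
  have int_y: "integrable lborel (\<lambda>u. frac_exp (u + y))"
    using lborel_integrable_real_affine[OF integrable_frac_exp, of 1 y] by (simp add: add.commute)
  have g: "integrable lborel g"
    unfolding g_def[abs_def] by (intro Bochner_Integration.integrable_diff int_y integrable_frac_exp)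
  note sq = shift_diff_square_integrable[OF integrable_frac_exp integrable_frac_exp_sq]
  have g2: "integrable lborel (\<lambda>u. (g u)\<^sup>2)" unfolding g_def by (rule sq)
  \<comment> \<open>Continuity of translation passes from \<open>frac_exp\<close> to
    \<open>g\<close>, a difference of two of its translates.\<close>
  have le: "(LINT u|lborel. (g (u + h) - g u)\<^sup>2) \<le> 4 * shift_sq h" for h
  proof -
    have sh: "integrable lborel (\<lambda>u. (frac_exp ((u + y) + h) - frac_exp (u + y))\<^sup>2)"
      "(LINT u|lborel. (frac_exp ((u + y) + h) - frac_exp (u + y))\<^sup>2) = shift_sq h"
      using lborel_integrable_real_affine[OF sq[of h], of 1 y]
        lborel_integral_real_affine[of 1 "\<lambda>u. (frac_exp (u + h) - frac_exp u)\<^sup>2" y]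
      by (simp_all add: add.commute shift_sq_def)
    have "(LINT u|lborel. (g (u + h) - g u)\<^sup>2) \<le>
        (LINT u|lborel. 2 * (frac_exp ((u + y) + h) - frac_exp (u + y))\<^sup>2 + 2 * (frac_exp (u + h) - frac_exp u)\<^sup>2)"
    proof (rule integral_mono)
      show "integrable lborel (\<lambda>u. (g (u + h) - g u)\<^sup>2)"
        by (rule shift_diff_square_integrable[OF g g2])
      show "integrable lborel (\<lambda>u. 2 * (frac_exp ((u + y) + h) - frac_exp (u + y))\<^sup>2 + 2 * (frac_exp (u + h) - frac_exp u)\<^sup>2)"
        using sh sq by auto
      fix u
      have "(p - q)\<^sup>2 \<le> 2 * p\<^sup>2 + 2 * q\<^sup>2" for p q :: real
        using zero_le_power2[of "p + q"] by (simp add: power2_sum power2_diff)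
      from this[of "frac_exp ((u + y) + h) - frac_exp (u + y)" "frac_exp (u + h) - frac_exp u"]
      show "(g (u + h) - g u)\<^sup>2 \<le> 2 * (frac_exp ((u + y) + h) - frac_exp (u + y))\<^sup>2 + 2 * (frac_exp (u + h) - frac_exp u)\<^sup>2"
        by (simp add: g_def algebra_simps)
    qed
    also have "\<dots> = 4 * shift_sq h"
      using sh sq[of h] by (simp add: shift_sq_def)
    finally show ?thesis .
  qed
  have cont: "((\<lambda>h. LINT u|lborel. (g (u + h) - g u)\<^sup>2) \<longlongrightarrow> 0) (at 0)"
  proof (rule tendsto_sandwich[OF _ _ tendsto_const])
    show "((\<lambda>h. 4 * shift_sq h) \<longlongrightarrow> 0) (at 0)"
      using tendsto_mult_right_zero[OF shift_sq_tendsto_0] .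
  qed (use le in \<open>auto intro!: always_eventually\<close>)
  have four: "(norm (fourier g t))\<^sup>2 = 2 * (zeta_dens t * (1 - cos (y * t)))" for t
  proof -
    have "fourier g t = (LINT u|lborel. of_real (frac_exp (u + y)) * cis (- t * u)) - fourier frac_exp t"
      unfolding fourier_def g_def
      using integrable_mult_cis[OF int_y, of "- t"] integrable_mult_cis[OF integrable_frac_exp, of "- t"]
      by (simp add: left_diff_distrib)
    also have "(LINT u|lborel. of_real (frac_exp (u + y)) * cis (- t * u)) =
        (LINT u|lborel. cis (t * y) * (of_real (frac_exp (y + 1 * u)) * cis (- t * (y + 1 * u))))"
    proof (rule Bochner_Integration.integral_cong[OF refl])
      fix u
      have "- t * u = t * y + - t * (y + 1 * u)" by (simp add: algebra_simps)
      then have "cis (- t * u) = cis (t * y) * cis (- t * (y + 1 * u))" by (simp only: cis_mult)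
      then show "of_real (frac_exp (u + y)) * cis (- t * u) =
          cis (t * y) * (of_real (frac_exp (y + 1 * u)) * cis (- t * (y + 1 * u)))"
        by (simp add: add.commute)
    qed
    also have "\<dots> = cis (t * y) * (LINT u|lborel. of_real (frac_exp (y + 1 * u)) * cis (- t * (y + 1 * u)))"
      by (rule integral_mult_right_zero)
    also have "(LINT u|lborel. of_real (frac_exp (y + 1 * u)) * cis (- t * (y + 1 * u))) = fourier frac_exp t"
      using lborel_integral_real_affine[of 1 "\<lambda>u. of_real (frac_exp u) * cis (- t * u)" y]
      by (simp add: fourier_def)
    finally have "fourier g t = (cis (t * y) - 1) * fourier frac_exp t" by (simp add: algebra_simps)
    then have "(norm (fourier g t))\<^sup>2 = (norm (cis (t * y) - 1))\<^sup>2 * zeta_dens t"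
      by (simp add: norm_mult power_mult_distrib norm_fourier_frac_exp zeta_dens_def)
    also have "(norm (cis (t * y) - 1))\<^sup>2 = (cos (t * y) - 1)\<^sup>2 + (sin (t * y))\<^sup>2"
      unfolding cmod_power2 by simp
    also have "\<dots> = 2 * (1 - cos (t * y))"
      using sin_cos_squared_add[of "t * y"] by (simp add: power2_diff)
    finally show ?thesis by (simp add: mult_ac)
  qed
  have "(LINT t|lborel. (norm (fourier g t))\<^sup>2) = 2 * pi * (LINT u|lborel. (g u)\<^sup>2)"
    using plancherel[OF g g2 cont] by (simp add: has_bochner_integral_iff)
  moreover have "(LINT u|lborel. (g u)\<^sup>2) = shift_sq y" by (simp add: g_def shift_sq_def)
  ultimately show ?thesis by (simp add: four)
qed

lemma even_integral:
  fixes f :: "real \<Rightarrow> real"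
  assumes [measurable]: "f \<in> borel_measurable borel"
    and even: "\<And>x. f (- x) = f x" and int: "set_integrable lborel {0<..} f"
  shows "integrable lborel f" and "(LINT x|lborel. f x) = 2 * (LINT x:{0<..}|lborel. f x)"
proof -
  let ?p = "\<lambda>x. indicator {0<..} x *\<^sub>R f x"
  have 1: "integrable lborel ?p" using int by (simp add: set_integrable_def)
  have 2: "integrable lborel (\<lambda>x. ?p (- x))" "(LINT x|lborel. ?p (- x)) = (LINT x|lborel. ?p x)"
    using lborel_integrable_real_affine[OF 1, of "-1" 0] lborel_integral_real_affine[of "-1" ?p 0] by simp_all
  have ae: "AE x in lborel. ?p x + ?p (- x) = f x"
    using AE_lborel_singleton[of "0::real"]
    by eventually_elim (auto simp: indicator_def even)
  have 3: "integrable lborel (\<lambda>x. ?p x + ?p (- x))" by (intro Bochner_Integration.integrable_add 1 2)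
  show "integrable lborel f"
    by (rule integrable_cong_AE_imp[OF 3 _ ae]) measurable
  have "(LINT x|lborel. f x) = (LINT x|lborel. ?p x + ?p (- x))"
    using ae by (intro integral_cong_AE) auto
  also have "\<dots> = 2 * (LINT x|lborel. ?p x)"
    using Bochner_Integration.integral_add[OF 1 2(1)] 2(2) by simp
  finally show "(LINT x|lborel. f x) = 2 * (LINT x:{0<..}|lborel. f x)"
    by (simp add: set_lebesgue_integral_def)
qed

section \<open>The Fejer kernel\<close>

definition fejer :: "real \<Rightarrow> real" where
  "fejer s = (1 - cos s) / s\<^sup>2"

lemma fejer_measurable [measurable]: "fejer \<in> borel_measurable borel"
  unfolding fejer_def[abs_def] by measurable

lemma fejer_nonneg: "fejer s \<ge> 0"
  by (simp add: fejer_def)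

lemma fejer_le_half: "fejer s \<le> 1 / 2"
\<comment> \<open>Division by zero makes \<open>fejer 0\<close> equal to 0 rather than to the limit
  1/2; the bound holds either way.\<close>
proof (cases "s = 0")
  case False
  have "1 - cos s = 2 * (sin (s / 2))\<^sup>2"
    using cos_double_sin[of "s / 2"] by simp
  also have "(sin (s / 2))\<^sup>2 \<le> (s / 2)\<^sup>2"
    using abs_sin_x_le_abs_x[of "s / 2"] by (simp only: abs_le_square_iff)
  finally have "1 - cos s \<le> s\<^sup>2 / 2" by (simp add: power_divide)
  then show ?thesis using False by (simp add: fejer_def divide_le_eq)
qed (simp add: fejer_def)

lemma exp_fejer_le: "exp u * fejer (exp u) \<le> 2 * exp (- \<bar>u\<bar>)"
proof (cases "u \<ge> 0")
  case True
  have "fejer (exp u) \<le> 2 / (exp u)\<^sup>2"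
    unfolding fejer_def using cos_ge_minus_one[of "exp u"] by (intro divide_right_mono) auto
  then have "exp u * fejer (exp u) \<le> exp u * (2 / (exp u)\<^sup>2)" by (rule mult_left_mono) simp
  then show ?thesis using True by (simp add: power2_eq_square exp_minus field_simps)
next
  case False
  have "exp u * fejer (exp u) \<le> exp u * (1 / 2)"
    by (intro mult_left_mono fejer_le_half) simp
  then show ?thesis using False by simp
qed

text \<open>In the variable \<open>u = ln x\<close>, power bounds at 0 and at infinity become a
  single exponential bound.\<close>

lemma set_integrable_via_exp:
  fixes f :: "real \<Rightarrow> real"
  assumes [measurable]: "f \<in> borel_measurable borel" and a: "a > 0"
    and bound: "\<And>u. \<bar>exp u * f (exp u)\<bar> \<le> C * exp (- \<bar>u\<bar> * a)"
  shows "set_integrable lborel {0<..} f"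
proof (rule exp_substitution(1))
  show "integrable lborel (\<lambda>u. exp u * f (exp u))"
  proof (rule Bochner_Integration.integrable_bound[of _ "\<lambda>u. C * exp (- \<bar>u\<bar> * a)"])
    show "integrable lborel (\<lambda>u::real. C * exp (- \<bar>u\<bar> * a))"
      by (intro integrable_mult_right integrable_exp_abs a)
    show "AE u in lborel. norm (exp u * f (exp u)) \<le> norm (C * exp (- \<bar>u\<bar> * a))"
      using bound by (auto intro: order_trans[OF _ abs_ge_self])
  qed measurable
qed measurable

lemma abs_le_exp: "\<bar>u\<bar> \<le> 4 * exp (\<bar>u\<bar> / 4)" for u :: real
  using exp_ge_add_one_self[of "\<bar>u\<bar> / 4"] by linarith

lemma fejer_set_integrable: "set_integrable lborel {0<..} fejer"
  using exp_fejer_le fejer_nonneg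
  by (intro set_integrable_via_exp[of _ 1 2]) (auto simp: abs_mult)

text \<open>In the second integral the weight \<open>s powr (- (1/2))\<close> keeps convergence at
  0. It is there because \<open>1 \<le> s powr (- (1/2)) * y powr (1/2)\<close> on
  \<open>s < y\<close> extracts the factor \<open>y powr (1/2)\<close> in
  \<open>ln_fejer_head_le\<close>.\<close>

lemma ln_fejer_set_integrable: "set_integrable lborel {0<..} (\<lambda>s. ln s * fejer s)"
  and ln_fejer_root_set_integrable: "set_integrable lborel {0<..} (\<lambda>s. \<bar>ln s\<bar> * fejer s * s powr (- (1/2)))"
proof -
  have le: "\<bar>u\<bar> * (exp u * fejer (exp u)) \<le> 8 * exp (- \<bar>u\<bar> * (3/4))" for u
  proof -
    have "\<bar>u\<bar> * (exp u * fejer (exp u)) \<le> (4 * exp (\<bar>u\<bar> / 4)) * (2 * exp (- \<bar>u\<bar>))"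
      by (rule mult_mono[OF abs_le_exp exp_fejer_le]) (simp_all add: fejer_nonneg)
    also have "\<dots> = 8 * exp (- \<bar>u\<bar> * (3/4))" by (simp flip: exp_add)
    finally show ?thesis .
  qed
  show "set_integrable lborel {0<..} (\<lambda>s. ln s * fejer s)"
  proof (rule set_integrable_via_exp[of _ "3/4" 8])
    fix u :: real
    show "\<bar>exp u * (ln (exp u) * fejer (exp u))\<bar> \<le> 8 * exp (- \<bar>u\<bar> * (3/4))"
      using le[of u] fejer_nonneg[of "exp u"] by (simp add: abs_mult mult_ac)
  qed auto
  show "set_integrable lborel {0<..} (\<lambda>s. \<bar>ln s\<bar> * fejer s * s powr (- (1/2)))"
  proof (rule set_integrable_via_exp[of _ "1/4" 8])
    fix u :: real
    have "\<bar>exp u * (\<bar>ln (exp u)\<bar> * fejer (exp u) * exp u powr (- (1/2)))\<bar> = (\<bar>u\<bar> * (exp u * fejer (exp u))) * exp (- u / 2)"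
      using fejer_nonneg[of "exp u"] by (simp add: abs_mult mult_ac powr_def)
    also have "\<dots> \<le> (8 * exp (- \<bar>u\<bar> * (3/4))) * exp (\<bar>u\<bar> / 2)"
      by (rule mult_mono[OF le]) (simp_all add: fejer_nonneg)
    also have "\<dots> = 8 * exp (- \<bar>u\<bar> * (1/4))" by (simp flip: exp_add)
    finally show "\<bar>exp u * (\<bar>ln (exp u)\<bar> * fejer (exp u) * exp u powr (- (1/2)))\<bar> \<le> 8 * exp (- \<bar>u\<bar> * (1/4))" .
  qed auto
qed

lemma fourier_unit_interval:
  assumes t: "t \<noteq> 0"
  shows "(norm (fourier (indicator {0..1}) t))\<^sup>2 = 2 * fejer t"
proof -
  have "((\<lambda>u. cis (- t * u)) has_integral (\<i> / t * cis (- t * 1) - \<i> / t * cis (- t * 0))) {0..1}"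
  proof (rule fundamental_theorem_of_calculus)
    fix u :: real
    have "((\<lambda>z. \<i> / t * exp (\<i> * (- t * z))) has_field_derivative exp (\<i> * (- t * u))) (at (of_real u))"
      using t by (auto intro!: derivative_eq_intros)
    then have "((\<lambda>u. \<i> / t * exp (\<i> * (- t * complex_of_real u))) has_vector_derivative exp (\<i> * (- t * u))) (at u within {0..1})"
      by (rule has_vector_derivative_real_field)
    then show "((\<lambda>u. \<i> / t * cis (- t * u)) has_vector_derivative cis (- t * u)) (at u within {0..1})"
      by (simp add: cis_conv_exp)
  qed simp
  moreover have "set_integrable lborel {0..1} (\<lambda>u. cis (- t * u))"
    by (intro borel_integrable_atLeastAtMost' continuous_intros)
  moreover have "fourier (indicator {0..1}) t = (LINT u:{0..1}|lborel. cis (- t * u))"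
    unfolding fourier_def set_lebesgue_integral_def by (simp add: scaleR_conv_of_real indicator_def of_bool_def)
  ultimately have "fourier (indicator {0..1}) t = \<i> / t * (cis (- t) - 1)"
    by (simp add: set_borel_integral_eq_integral(2) integral_unique right_diff_distrib)
  then have "(norm (fourier (indicator {0..1}) t))\<^sup>2 = (norm (cis (- t) - 1))\<^sup>2 / t\<^sup>2"
    by (simp add: norm_mult norm_divide power_mult_distrib power_divide)
  also have "(norm (cis (- t) - 1))\<^sup>2 = (cos t - 1)\<^sup>2 + (sin t)\<^sup>2"
    unfolding cmod_power2 by simp
  also have "\<dots> = 2 * (1 - cos t)"
    using sin_cos_squared_add[of t] by (simp add: power2_diff)
  finally show ?thesis by (simp add: fejer_def)
qed

text \<open>Plancherel for the indicator of the unit interval: its squared norm is 1, its squared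
  transform is \<open>2 * fejer t\<close>, and evenness halves the line.\<close>

lemma fejer_integral: "(LINT s:{0<..}|lborel. fejer s) = pi / 2"
proof -
  let ?g = "indicator {0..1} :: real \<Rightarrow> real"
  have g: "integrable lborel ?g" by (intro integrable_real_indicator) (auto simp: emeasure_lborel_Icc_eq)
  have g_sq: "(\<lambda>u. (?g u)\<^sup>2) = ?g" by (auto simp: indicator_def)
  have cont: "((\<lambda>h. LINT u|lborel. (?g (u + h) - ?g u)\<^sup>2) \<longlongrightarrow> 0) (at 0)"
  proof (rule tendsto_sandwich[OF _ _ tendsto_const])
    have "(LINT u|lborel. (?g (u + h) - ?g u)\<^sup>2) \<le> 4 * \<bar>h\<bar>" for h
    proof -
      \<comment> \<open>The indicator and its translate differ only within distance
        \<open>\<bar>h\<bar>\<close> of an endpoint 0 or 1.\<close>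
      have "(LINT u|lborel. (?g (u + h) - ?g u)\<^sup>2) \<le> (LINT u|lborel. indicator {- \<bar>h\<bar>..\<bar>h\<bar>} u + indicator {1 - \<bar>h\<bar>..1 + \<bar>h\<bar>} u)"
      proof (rule integral_mono)
        show "integrable lborel (\<lambda>u. (?g (u + h) - ?g u)\<^sup>2)"
          by (rule shift_diff_square_integrable) (simp_all add: g g_sq del: integrable_indicator_iff)
        show "integrable lborel (\<lambda>u. indicator {- \<bar>h\<bar>..\<bar>h\<bar>} u + indicator {1 - \<bar>h\<bar>..1 + \<bar>h\<bar>} u :: real)"
          by (intro Bochner_Integration.integrable_add integrable_real_indicator) (auto simp: emeasure_lborel_Icc_eq)
      qed (auto simp: indicator_def)
      also have "\<dots> = 4 * \<bar>h\<bar>"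
        by (subst Bochner_Integration.integral_add) (auto simp: emeasure_lborel_Icc_eq intro!: integrable_real_indicator)
      finally show ?thesis .
    qed
    then show "\<forall>\<^sub>F h in at 0. (LINT u|lborel. (?g (u + h) - ?g u)\<^sup>2) \<le> 4 * \<bar>h\<bar>" by simp
    show "((\<lambda>h. 4 * \<bar>h\<bar>) \<longlongrightarrow> (0::real)) (at 0)" by (auto intro!: tendsto_eq_intros)
  qed auto
  have "(LINT t|lborel. (norm (fourier ?g t))\<^sup>2) = 2 * pi * (LINT u|lborel. (?g u)\<^sup>2)"
    using plancherel[OF g _ cont] g by (simp add: has_bochner_integral_iff g_sq)
  also have "(LINT u|lborel. (?g u)\<^sup>2) = 1" unfolding g_sq by simp
  also have "(LINT t|lborel. (norm (fourier ?g t))\<^sup>2) = (LINT t|lborel. 2 * fejer t)"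
  proof (rule integral_cong_AE)
    show "AE t in lborel. (norm (fourier ?g t))\<^sup>2 = 2 * fejer t"
      using AE_lborel_singleton[of "0::real"] by eventually_elim (simp add: fourier_unit_interval)
    show "(\<lambda>t. (norm (fourier ?g t))\<^sup>2) \<in> borel_measurable lborel"
      unfolding fourier_def cis_conv_exp by measurable
  qed measurable
  also have "\<dots> = 2 * (2 * (LINT s:{0<..}|lborel. fejer s))"
    by (simp only: integral_mult_right_zero, subst even_integral(2)) (auto simp: fejer_set_integrable fejer_def)
  finally show ?thesis by simp
qed

section \<open>A model density and its match with the zeta density\<close>

text \<open>Shaped after the expected growth \<open>T * ln T + b * T\<close> of the mean square,
  whose derivative has the form \<open>ln t + a\<close>, divided by \<open>t\<^sup>2\<close>. The
  cut at 1 removes the singularity at 0; \<open>a\<close> stays free until the linear coefficients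
  are matched.\<close>

definition model_dens :: "real \<Rightarrow> real \<Rightarrow> real" where
  "model_dens a t = indicator {1..} \<bar>t\<bar> * (ln \<bar>t\<bar> + a) / t\<^sup>2"

lemma model_dens_measurable [measurable]: "model_dens a \<in> borel_measurable borel"
  unfolding model_dens_def[abs_def] by measurable

lemma model_dens_set_integrable: "set_integrable lborel {0<..} (model_dens a)"
proof (rule set_integrable_via_exp[of _ "3/4" "4 + \<bar>a\<bar>"])
  fix u :: real
  show "\<bar>exp u * model_dens a (exp u)\<bar> \<le> (4 + \<bar>a\<bar>) * exp (- \<bar>u\<bar> * (3/4))"
  proof (cases "u \<ge> 0")
    case True
    have "exp u * model_dens a (exp u) = (u + a) * exp (- u)"
      using True by (simp add: model_dens_def power2_eq_square exp_minus field_simps)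
    then have "\<bar>exp u * model_dens a (exp u)\<bar> \<le> (\<bar>u\<bar> + \<bar>a\<bar>) * exp (- u)"
      by (simp add: abs_mult mult_right_mono)
    also have "\<dots> \<le> ((4 + \<bar>a\<bar>) * exp (\<bar>u\<bar> / 4)) * exp (- u)"
    proof (intro mult_right_mono)
      have "\<bar>a\<bar> * 1 \<le> \<bar>a\<bar> * exp (\<bar>u\<bar> / 4)" by (intro mult_left_mono) auto
      then show "\<bar>u\<bar> + \<bar>a\<bar> \<le> (4 + \<bar>a\<bar>) * exp (\<bar>u\<bar> / 4)"
        using abs_le_exp[of u] by (simp add: distrib_right)
    qed simp
    also have "\<dots> = (4 + \<bar>a\<bar>) * exp (- \<bar>u\<bar> * (3/4))" using True by (simp add: mult.assoc flip: exp_add)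
    finally show ?thesis .
  qed (simp add: model_dens_def)
qed auto

lemma model_dens_even: "model_dens a (- t) = model_dens a t"
  by (simp add: model_dens_def)

lemma integrable_model_dens: "integrable lborel (model_dens a)"
  by (rule even_integral(1)) (auto simp: model_dens_even model_dens_set_integrable)

lemma integrable_mult_one_minus_cos:
  assumes "integrable lborel p"
  shows "integrable lborel (\<lambda>t. p t * (1 - cos (y * t)) :: real)"
proof (rule Bochner_Integration.integrable_bound[of _ "\<lambda>t. 2 * p t"])
  show "(\<lambda>t. p t * (1 - cos (y * t))) \<in> borel_measurable lborel"
    using assms by auto
  show "AE t in lborel. norm (p t * (1 - cos (y * t))) \<le> norm (2 * p t)"
  proof (rule AE_I2)
    fix t
    have "\<bar>1 - cos (y * t)\<bar> \<le> 2"
      using cos_ge_minus_one[of "y * t"] cos_le_one[of "y * t"] by linarith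
    then have "\<bar>p t\<bar> * \<bar>1 - cos (y * t)\<bar> \<le> \<bar>p t\<bar> * 2" by (rule mult_left_mono) simp
    then show "norm (p t * (1 - cos (y * t))) \<le> norm (2 * p t)"
      by (simp only: real_norm_def abs_mult abs_numeral mult.commute[of 2])
  qed
qed (use assms in auto)

text \<open>The scaling \<open>s = y * t\<close> turns \<open>ln t\<close> into
  \<open>ln s - ln y\<close>. Without the cut at \<open>t = 1\<close>, \<open>ln y\<close> would be
  multiplied by the full Fejer integral \<open>pi / 2\<close>; the integrals over
  \<open>{0<..<y}\<close> are the part lost to the cut.\<close>

lemma model_dens_cos_integral:
  assumes y: "y > 0"
  shows "(LINT t|lborel. model_dens a t * (1 - cos (y * t))) =
     2 * y * ((a - ln y) * (pi / 2 - (LINT s:{0<..<y}|lborel. fejer s)) +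
              ((LINT s:{0<..}|lborel. ln s * fejer s) - (LINT s:{0<..<y}|lborel. ln s * fejer s)))"
proof -
  let ?F = "\<lambda>t. model_dens a t * (1 - cos (y * t))"
  have int: "integrable lborel ?F"
    by (intro integrable_mult_one_minus_cos integrable_model_dens)
  have "(LINT t|lborel. ?F t) = 2 * (LINT t:{0<..}|lborel. ?F t)"
    by (rule even_integral(2))
       (use integrable_mult_indicator[OF _ int, of "{0<..}"] in \<open>auto simp: model_dens_even set_integrable_def\<close>)
  also have "(LINT t:{0<..}|lborel. ?F t) = \<bar>1 / y\<bar> *\<^sub>R (LINT s|lborel. indicator {0<..} (0 + 1 / y * s) *\<^sub>R ?F (0 + 1 / y * s))"
    unfolding set_lebesgue_integral_def using y by (intro lborel_integral_real_affine) simp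
  also have "(\<lambda>s. indicator {0<..} (0 + 1 / y * s) *\<^sub>R ?F (0 + 1 / y * s)) =
      (\<lambda>s. y\<^sup>2 * (indicator {y..} s *\<^sub>R ((a - ln y) * fejer s + ln s * fejer s)))"
  proof
    fix s
    have "indicator {0<..} (1 / y * s) * ?F (1 / y * s) = y\<^sup>2 * ((a - ln y) * fejer s + ln s * fejer s)" if "s \<ge> y"
    proof -
      have "indicator {1..} \<bar>1 / y * s\<bar> = (1::real)" "indicator {0<..} (1 / y * s) = (1::real)"
        using that y by (auto simp: indicator_def divide_simps)
      moreover have "ln \<bar>1 / y * s\<bar> = ln s - ln y" using that y by (simp add: ln_div)
      moreover have "(1 / y * s)\<^sup>2 = s\<^sup>2 / y\<^sup>2" "y * (1 / y * s) = s"
        using y by (simp_all add: power_divide power_mult_distrib)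
      moreover have "1 * (1 * (l - m + a) / (p / r) * (1 - k)) = r * ((a - m) * ((1 - k) / p) + l * ((1 - k) / p))"
        if "p \<noteq> 0" "r \<noteq> 0" for k l m p r :: real
        using that by (simp add: field_simps)
      moreover have "s\<^sup>2 \<noteq> 0" "y\<^sup>2 \<noteq> 0" using that y by auto
      ultimately show ?thesis by (simp only: model_dens_def fejer_def power2_abs)
    qed
    moreover have "indicator {0<..} (1 / y * s) * ?F (1 / y * s) = 0" if "s < y"
      using that y by (auto simp: indicator_def model_dens_def divide_simps)
    ultimately show "indicator {0<..} (0 + 1 / y * s) *\<^sub>R ?F (0 + 1 / y * s) =
      y\<^sup>2 * (indicator {y..} s *\<^sub>R ((a - ln y) * fejer s + ln s * fejer s))"
      by (cases "s \<ge> y") auto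
  qed
  also have "\<bar>1 / y\<bar> *\<^sub>R (LINT s|lborel. y\<^sup>2 * (indicator {y..} s *\<^sub>R ((a - ln y) * fejer s + ln s * fejer s))) =
      y * (LINT s:{y..}|lborel. (a - ln y) * fejer s + ln s * fejer s)"
    unfolding set_lebesgue_integral_def integral_mult_right_zero using y by (simp add: power2_eq_square)
  also have "(LINT s:{y..}|lborel. (a - ln y) * fejer s + ln s * fejer s) =
     (a - ln y) * (LINT s:{y..}|lborel. fejer s) + (LINT s:{y..}|lborel. ln s * fejer s)"
  proof -
    have "set_integrable lborel {y..} fejer" "set_integrable lborel {y..} (\<lambda>s. ln s * fejer s)"
      using y by (auto intro: set_integrable_subset[OF fejer_set_integrable] set_integrable_subset[OF ln_fejer_set_integrable])
    then show ?thesis by (subst set_integral_add(2)) auto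
  qed
  finally have main: "(LINT t|lborel. ?F t) = 2 * (y * ((a - ln y) * (LINT s:{y..}|lborel. fejer s) +
      (LINT s:{y..}|lborel. ln s * fejer s)))" .
  have split: "(LINT s:{y..}|lborel. f s) = (LINT s:{0<..}|lborel. f s) - (LINT s:{0<..<y}|lborel. f s)"
    if "set_integrable lborel {0<..} f" for f :: "real \<Rightarrow> real"
  proof -
    have "{0<..} = {0<..<y} \<union> {y..}" using y by auto
    then have "(LINT s:{0<..}|lborel. f s) = (LINT s:{0<..<y} \<union> {y..}|lborel. f s)" by simp
    also have "\<dots> = (LINT s:{0<..<y}|lborel. f s) + (LINT s:{y..}|lborel. f s)"
      using y by (intro set_integral_Un) (auto intro: set_integrable_subset[OF that])
    finally show ?thesis by simp
  qed
  show ?thesis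
    unfolding main split[OF fejer_set_integrable, unfolded fejer_integral] split[OF ln_fejer_set_integrable] by simp
qed

lemma fejer_head_le:
  assumes y: "y > 0"
  shows "\<bar>LINT s:{0<..<y}|lborel. fejer s\<bar> \<le> y / 2"
proof -
  have "\<bar>LINT s:{0<..<y}|lborel. fejer s\<bar> \<le> (LINT s|lborel. indicator {0<..<y} s *\<^sub>R (1/2))"
    unfolding set_lebesgue_integral_def real_norm_def[symmetric]
  proof (rule Bochner_Integration.integral_norm_bound_integral)
    show "integrable lborel (\<lambda>s. indicator {0<..<y} s *\<^sub>R fejer s)"
    proof -
      have "{0<..<y} \<subseteq> {0<..}" by auto
      from set_integrable_subset[OF fejer_set_integrable _ this] show ?thesis by (simp add: set_integrable_def)
    qed
    show "integrable lborel (\<lambda>s. indicator {0<..<y} s *\<^sub>R (1/2 :: real))"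
      using y by (intro integrable_scaleR_left integrable_real_indicator) auto
    show "norm (indicator {0<..<y} s *\<^sub>R fejer s) \<le> indicator {0<..<y} s *\<^sub>R (1/2)" for s
      using fejer_nonneg[of s] fejer_le_half[of s] by (auto simp: indicator_def)
  qed
  also have "\<dots> = y / 2" using y by simp
  finally show ?thesis .
qed

lemma ln_fejer_head_le:
  assumes y: "y > 0"
  shows "\<bar>LINT s:{0<..<y}|lborel. ln s * fejer s\<bar>
     \<le> (LINT s:{0<..}|lborel. \<bar>ln s\<bar> * fejer s * s powr (- (1/2))) * y powr (1/2)"
proof -
  have "\<bar>LINT s:{0<..<y}|lborel. ln s * fejer s\<bar> \<le>
      (LINT s|lborel. (indicator {0<..} s *\<^sub>R (\<bar>ln s\<bar> * fejer s * s powr (- (1/2)))) * y powr (1/2))"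
    unfolding set_lebesgue_integral_def real_norm_def[symmetric]
  proof (rule Bochner_Integration.integral_norm_bound_integral)
    show "integrable lborel (\<lambda>s. indicator {0<..<y} s *\<^sub>R (ln s * fejer s))"
    proof -
      have "{0<..<y} \<subseteq> {0<..}" by auto
      from set_integrable_subset[OF ln_fejer_set_integrable _ this] show ?thesis by (simp add: set_integrable_def)
    qed
    show "integrable lborel (\<lambda>s. (indicator {0<..} s *\<^sub>R (norm (ln s) * fejer s * s powr (- (1/2)))) * y powr (1/2))"
      using ln_fejer_root_set_integrable by (auto simp: set_integrable_def)
    fix s :: real
    have "\<bar>ln s\<bar> * fejer s * 1 \<le> \<bar>ln s\<bar> * fejer s * (s powr (- (1/2)) * y powr (1/2))" if "0 < s" "s < y"
    proof (intro mult_left_mono)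
      have "s powr (1/2) \<le> y powr (1/2)" using that by (intro powr_mono2) auto
      then show "1 \<le> s powr (- (1/2)) * y powr (1/2)"
        using that by (simp add: powr_minus field_simps)
    qed (simp add: fejer_nonneg)
    then show "norm (indicator {0<..<y} s *\<^sub>R (ln s * fejer s)) \<le>
       (indicator {0<..} s *\<^sub>R (norm (ln s) * fejer s * s powr (- (1/2)))) * y powr (1/2)"
      by (auto simp: indicator_def abs_mult fejer_nonneg mult.assoc)
  qed
  also have "\<dots> = (LINT s:{0<..}|lborel. \<bar>ln s\<bar> * fejer s * s powr (- (1/2))) * y powr (1/2)"
    unfolding set_lebesgue_integral_def by (rule integral_mult_left_zero)
  finally show ?thesis .
qed

text \<open>The point is that \<open>c\<close> does not depend on \<open>a\<close>: the parameter
  enters only the linear coefficient, as \<open>pi * a\<close>, and can adjust it to any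
  value.\<close>

lemma model_dens_cos_asymp:
  obtains c where "\<And>a. (\<lambda>y. (LINT t|lborel. model_dens a t * (1 - cos (y * t))) - (pi * (y * ln (1 / y)) + (pi * a + c) * y))
      \<in> O[at_right 0](\<lambda>y. y powr (3/2))"
proof
  fix a :: real
  define c1 where "c1 = (LINT s:{0<..}|lborel. ln s * fejer s)"
  define K0 where "K0 y = (LINT s:{0<..<y}|lborel. fejer s)" for y
  define K1 where "K1 y = (LINT s:{0<..<y}|lborel. ln s * fejer s)" for y
  have pos: "\<forall>\<^sub>F y in at_right 0. (0::real) < y" by (simp add: eventually_at_right_less)
  have K0: "K0 \<in> O[at_right 0](\<lambda>y. y)"
    using pos by (intro bigoI[of _ "1/2"], eventually_elim) (use fejer_head_le in \<open>auto simp: K0_def\<close>)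
  have K1: "K1 \<in> O[at_right 0](\<lambda>y. y powr (1/2))"
    using pos by (intro bigoI[of _ "LINT s:{0<..}|lborel. \<bar>ln s\<bar> * fejer s * s powr (- (1/2))"], eventually_elim)
      (use ln_fejer_head_le in \<open>auto simp: K1_def\<close>)
  have "(\<lambda>y. (-2 * y * (a - ln y)) * K0 y) \<in> O[at_right 0](\<lambda>y. y powr (1/2) * y)"
  proof (rule landau_o.big.mult[OF _ K0])
    show "(\<lambda>y. -2 * y * (a - ln y)) \<in> O[at_right 0](\<lambda>y. y powr (1/2))" by real_asymp
  qed
  moreover have "(\<lambda>y::real. y powr (1/2) * y) \<in> O[at_right 0](\<lambda>y. y powr (3/2))" by real_asymp
  ultimately have t1: "(\<lambda>y. (-2 * y * (a - ln y)) * K0 y) \<in> O[at_right 0](\<lambda>y. y powr (3/2))"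
    by (rule landau_o.big_trans)
  have "(\<lambda>y. (-2 * y) * K1 y) \<in> O[at_right 0](\<lambda>y. y * y powr (1/2))"
    by (rule landau_o.big.mult[OF _ K1]) real_asymp
  moreover have "(\<lambda>y::real. y * y powr (1/2)) \<in> O[at_right 0](\<lambda>y. y powr (3/2))" by real_asymp
  ultimately have t2: "(\<lambda>y. (-2 * y) * K1 y) \<in> O[at_right 0](\<lambda>y. y powr (3/2))"
    by (rule landau_o.big_trans)
  have "(\<lambda>y. (-2 * y * (a - ln y)) * K0 y + (-2 * y) * K1 y) \<in> O[at_right 0](\<lambda>y. y powr (3/2))"
    by (rule sum_in_bigo(1)[OF t1 t2])
  also have "?this \<longleftrightarrow> (\<lambda>y. (LINT t|lborel. model_dens a t * (1 - cos (y * t))) - (pi * (y * ln (1 / y)) + (pi * a + 2 * c1) * y))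
      \<in> O[at_right 0](\<lambda>y. y powr (3/2))"
  proof (rule landau_o.big.in_cong)
    show "\<forall>\<^sub>F y in at_right 0. (-2 * y * (a - ln y)) * K0 y + (-2 * y) * K1 y =
       (LINT t|lborel. model_dens a t * (1 - cos (y * t))) - (pi * (y * ln (1 / y)) + (pi * a + 2 * c1) * y)"
      using pos
    proof eventually_elim
      case (elim y)
      show ?case
        unfolding model_dens_cos_integral[OF elim] K0_def[symmetric] K1_def[symmetric] c1_def[symmetric]
        using elim by (simp add: ln_div field_simps)
    qed
  qed
  finally show "(\<lambda>y. (LINT t|lborel. model_dens a t * (1 - cos (y * t))) - (pi * (y * ln (1 / y)) + (pi * a + 2 * c1) * y))
      \<in> O[at_right 0](\<lambda>y. y powr (3/2))" .
qed

lemma excess_cos_integral_le: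
  "\<exists>a K. K \<ge> 0 \<and> (\<forall>y. \<bar>LINT t|lborel. (zeta_dens t - model_dens a t) * (1 - cos (y * t))\<bar> \<le> K * \<bar>y\<bar> powr (3/2))"
proof -
  obtain C where C: "(\<lambda>y. shift_sq y - (y * ln (1 / y) + C * y)) \<in> O[at_right 0](\<lambda>y. y powr (3/2))"
    using shift_sq_asymp by blast
  obtain c where c: "\<And>a. (\<lambda>y. (LINT t|lborel. model_dens a t * (1 - cos (y * t))) - (pi * (y * ln (1 / y)) + (pi * a + c) * y))
      \<in> O[at_right 0](\<lambda>y. y powr (3/2))"
    using model_dens_cos_asymp by blast
  \<comment> \<open>The leading terms \<open>pi * (y * ln (1 / y))\<close> agree already; this value
    makes the linear terms agree.\<close>
  define a where "a = C - c / pi"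
  have a: "pi * a + c = pi * C" by (simp add: a_def field_simps)
  define \<Delta> where "\<Delta> y = (LINT t|lborel. (zeta_dens t - model_dens a t) * (1 - cos (y * t)))" for y
  have \<Delta>: "\<Delta> y = pi * shift_sq y - (LINT t|lborel. model_dens a t * (1 - cos (y * t)))" for y
    unfolding \<Delta>_def left_diff_distrib
    by (subst Bochner_Integration.integral_diff)
       (simp_all add: zeta_dens_cos_integral integrable_mult_one_minus_cos integrable_zeta_dens integrable_model_dens)
  have "(\<lambda>y. pi * (shift_sq y - (y * ln (1 / y) + C * y))) \<in> O[at_right 0](\<lambda>y. y powr (3/2))"
    using C by simp
  from sum_in_bigo(2)[OF this c[of a]] have "\<Delta> \<in> O[at_right 0](\<lambda>y. y powr (3/2))"
    unfolding a by (simp add: \<Delta>[abs_def] algebra_simps)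
  then obtain k where k: "k > 0" "\<forall>\<^sub>F y in at_right 0. norm (\<Delta> y) \<le> k * norm (y powr (3/2))"
    by (elim landau_o.bigE)
  then obtain d where d: "d > 0" "\<And>y. 0 < y \<Longrightarrow> y < d \<Longrightarrow> \<bar>\<Delta> y\<bar> \<le> k * y powr (3/2)"
    unfolding eventually_at_right_field by auto
  define M where "M = (LINT t|lborel. 2 * \<bar>zeta_dens t - model_dens a t\<bar>)"
  have M: "\<bar>\<Delta> y\<bar> \<le> M" for y
    unfolding \<Delta>_def M_def real_norm_def[symmetric]
  proof (rule Bochner_Integration.integral_norm_bound_integral)
    show "integrable lborel (\<lambda>t. (zeta_dens t - model_dens a t) * (1 - cos (y * t)))"
      by (intro integrable_mult_one_minus_cos Bochner_Integration.integrable_diff integrable_zeta_dens integrable_model_dens)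
    show "integrable lborel (\<lambda>t. 2 * norm (zeta_dens t - model_dens a t))"
      by (intro integrable_mult_right integrable_norm Bochner_Integration.integrable_diff integrable_zeta_dens integrable_model_dens)
    fix t
    have "\<bar>1 - cos (y * t)\<bar> \<le> 2"
      using cos_ge_minus_one[of "y * t"] cos_le_one[of "y * t"] by linarith
    then show "norm ((zeta_dens t - model_dens a t) * (1 - cos (y * t))) \<le> 2 * norm (zeta_dens t - model_dens a t)"
      by (simp add: abs_mult mult.commute mult_right_mono)
  qed
  have "M \<ge> 0" using M[of 0] by linarith
  \<comment> \<open>The bound \<open>M\<close> holds for all \<open>y\<close>; divided by
    \<open>d powr (3/2)\<close> it turns into a multiple of the power for
    \<open>y \<ge> d\<close>.\<close>
  define K where "K = k + M / d powr (3/2)"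
  have "k \<le> K" "M \<le> K * d powr (3/2)" "K \<ge> 0"
    using \<open>M \<ge> 0\<close> k d by (auto simp: K_def distrib_right)
  have pos: "\<bar>\<Delta> y\<bar> \<le> K * y powr (3/2)" if "y > 0" for y
  proof (cases "y < d")
    case True
    with d(2)[OF that] mult_right_mono[OF \<open>k \<le> K\<close>, of "y powr (3/2)"] show ?thesis by simp
  next
    case False
    then have "K * d powr (3/2) \<le> K * y powr (3/2)"
      using \<open>K \<ge> 0\<close> d by (intro mult_left_mono powr_mono2) auto
    with M[of y] \<open>M \<le> K * d powr (3/2)\<close> show ?thesis by linarith
  qed
  have "\<Delta> (- y) = \<Delta> y" "\<Delta> 0 = 0" for y by (simp_all add: \<Delta>_def)
  then have "\<bar>\<Delta> y\<bar> \<le> K * \<bar>y\<bar> powr (3/2)" for y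
    using pos[of y] pos[of "- y"] by (cases y "0 :: real" rule: linorder_cases) auto
  with \<open>K \<ge> 0\<close> show ?thesis unfolding \<Delta>_def by blast
qed

section \<open>Gaussian smoothing: the indicator of \<open>[-T, T]\<close> convolved with a normal
  density\<close>

definition smooth_window :: "real \<Rightarrow> real \<Rightarrow> real \<Rightarrow> real" where
  "smooth_window H T t = (LINT u:{-T..T}|lborel. normal_density 0 H (t - u))"

lemma normal_density_shift:
  assumes "H > 0"
  shows "integrable lborel (\<lambda>u. normal_density 0 H (t - u))" "(LINT u|lborel. normal_density 0 H (t - u)) = 1"
proof -
  have eq: "t + -1 * u = t - u" for u by simp
  show "integrable lborel (\<lambda>u. normal_density 0 H (t - u))"
    using lborel_integrable_real_affine[of "normal_density 0 H" "-1" t] integrable_normal_density[OF assms, of 0]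
    by (simp only: eq)
  have "(LINT u|lborel. normal_density 0 H u) = \<bar>-1\<bar> *\<^sub>R (LINT u|lborel. normal_density 0 H (t + -1 * u))"
    by (rule lborel_integral_real_affine) simp
  then show "(LINT u|lborel. normal_density 0 H (t - u)) = 1"
    unfolding eq integral_normal_density[OF assms] by simp
qed

lemma smooth_window_measurable [measurable]: "smooth_window H T \<in> borel_measurable borel"
proof -
  have "(\<lambda>(t, u). indicator {-T..T} u *\<^sub>R normal_density 0 H (t - u)) \<in> borel_measurable (borel \<Otimes>\<^sub>M lborel)"
    by measurable
  from lborel.borel_measurable_lebesgue_integral[OF this] show ?thesis
    by (simp only: smooth_window_def[abs_def] set_lebesgue_integral_def split_conv)
qed

lemma smooth_window_bounds:
  assumes "H > 0"
  shows "0 \<le> smooth_window H T t" "smooth_window H T t \<le> 1"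
proof -
  show "0 \<le> smooth_window H T t"
    unfolding smooth_window_def set_lebesgue_integral_def by (intro Bochner_Integration.integral_nonneg) auto
  have "smooth_window H T t \<le> (LINT u|lborel. normal_density 0 H (t - u))"
    unfolding smooth_window_def set_lebesgue_integral_def
  proof (rule integral_mono)
    show "integrable lborel (\<lambda>u. indicator {- T..T} u *\<^sub>R normal_density 0 H (t - u))"
      by (intro integrable_mult_indicator normal_density_shift assms) auto
  qed (auto simp: indicator_def normal_density_shift assms)
  then show "smooth_window H T t \<le> 1" by (simp add: normal_density_shift assms)
qed

text \<open>Bounds the mass of a normal law of deviation \<open>H\<close> beyond distance
  \<open>d\<close>. Half of the exponent supplies this factor; the other half is kept as a normal
  density of deviation \<open>sqrt 2 * H\<close>, with total mass 1.\<close>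

definition gauss_tail :: "real \<Rightarrow> real \<Rightarrow> real" where
  "gauss_tail H d = sqrt 2 * exp (- (d\<^sup>2) / (4 * H\<^sup>2))"

lemma normal_density_outside_le:
  assumes H: "H > 0" and d: "0 \<le> d" "d \<le> \<bar>v\<bar>"
  shows "normal_density 0 H v \<le> gauss_tail H d * normal_density 0 (sqrt 2 * H) v"
proof -
  have "normal_density 0 H v = sqrt 2 * (exp (- (v\<^sup>2) / (4 * H\<^sup>2)) * normal_density 0 (sqrt 2 * H) v)"
    using H by (simp add: normal_density_def real_sqrt_mult power_mult_distrib field_simps flip: exp_add)
  also have "\<dots> \<le> sqrt 2 * (exp (- (d\<^sup>2) / (4 * H\<^sup>2)) * normal_density 0 (sqrt 2 * H) v)"
    using H d power_mono[of d "\<bar>v\<bar>" 2] by (intro mult_left_mono mult_right_mono) (auto intro!: divide_right_mono)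
  finally show ?thesis by (simp add: gauss_tail_def mult_ac)
qed

lemma normal_density_outside_integral_le:
  assumes H: "H > 0" and d: "0 \<le> d" and S: "S \<in> sets borel" and far: "\<And>u. u \<in> S \<Longrightarrow> d \<le> \<bar>t - u\<bar>"
  shows "(LINT u:S|lborel. normal_density 0 H (t - u)) \<le> gauss_tail H d"
proof -
  have H': "sqrt 2 * H > 0" using H by simp
  have "(LINT u:S|lborel. normal_density 0 H (t - u)) \<le> (LINT u|lborel. gauss_tail H d * normal_density 0 (sqrt 2 * H) (t - u))"
    unfolding set_lebesgue_integral_def
  proof (rule integral_mono)
    show "integrable lborel (\<lambda>u. indicator S u *\<^sub>R normal_density 0 H (t - u))"
      using S by (intro integrable_mult_indicator normal_density_shift H) auto
    show "integrable lborel (\<lambda>u. gauss_tail H d * normal_density 0 (sqrt 2 * H) (t - u))"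
      by (intro integrable_mult_right normal_density_shift H')
    have "gauss_tail H d \<ge> 0" by (simp add: gauss_tail_def)
    then show "indicator S u *\<^sub>R normal_density 0 H (t - u) \<le> gauss_tail H d * normal_density 0 (sqrt 2 * H) (t - u)" for u
      using normal_density_outside_le[OF H d far[of u]] by (auto simp: indicator_def)
  qed
  then show ?thesis by (simp add: normal_density_shift(2)[OF H'])
qed

lemma smooth_window_inside_ge:
  assumes H: "H > 0" and d: "0 \<le> d" "\<bar>t\<bar> \<le> T - d"
  shows "smooth_window H T t \<ge> 1 - gauss_tail H d"
proof -
  have int: "set_integrable lborel A (\<lambda>u. normal_density 0 H (t - u))" if "A \<in> sets borel" for A
    unfolding set_integrable_def using that by (intro integrable_mult_indicator normal_density_shift H) auto
  have "1 = (LINT u:{-T..T} \<union> - {-T..T}|lborel. normal_density 0 H (t - u))"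
    using normal_density_shift(2)[OF H, of t] by (simp add: set_lebesgue_integral_def)
  also have "\<dots> = smooth_window H T t + (LINT u:- {-T..T}|lborel. normal_density 0 H (t - u))"
    unfolding smooth_window_def by (rule set_integral_Un) (auto intro!: int)
  also have "(LINT u:- {-T..T}|lborel. normal_density 0 H (t - u)) \<le> gauss_tail H d"
    using d by (intro normal_density_outside_integral_le H) auto
  finally show ?thesis by simp
qed

lemma smooth_window_outside_le:
  assumes H: "H > 0" and d: "0 \<le> d" "T + d \<le> \<bar>t\<bar>"
  shows "smooth_window H T t \<le> gauss_tail H d"
  unfolding smooth_window_def
proof (rule normal_density_outside_integral_le[OF H d(1)])
  show "d \<le> \<bar>t - u\<bar>" if "u \<in> {-T..T}" for u
  proof -
    have "\<bar>u\<bar> \<le> T" using that by auto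
    with d show ?thesis by linarith
  qed
qed simp

text \<open>The Gaussian comes from \<open>gauss_fourier\<close>, and integrating
  \<open>cos (y * (t - u))\<close> over the window gives
  \<open>2 * (sin (T * y) / y) * cos (y * t)\<close> for \<open>y \<noteq> 0\<close>.\<close>

lemma smooth_window_fourier:
  assumes H: "H > 0" and T: "T \<ge> 0"
  shows "smooth_window H T t =
    (1 / pi) * (LINT y|lborel. exp (- H\<^sup>2 * y\<^sup>2 / 2) * (sin (T * y) / y) * cos (y * t))"
proof -
  have dens: "normal_density 0 H x = (1 / (2 * pi)) * (LINT y|lborel. exp (- H\<^sup>2 * y\<^sup>2 / 2) * cos (y * x))" for x
  proof -
    have int: "integrable lborel (\<lambda>y. complex_of_real (exp (- H\<^sup>2 * y\<^sup>2 / 2)) * cis (y * x))"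
    proof (rule Bochner_Integration.integrable_bound[OF integrable_gauss[OF H]])
      show "(\<lambda>y. complex_of_real (exp (- H\<^sup>2 * y\<^sup>2 / 2)) * cis (y * x)) \<in> borel_measurable lborel"
        unfolding cis_conv_exp by measurable
    qed (simp add: norm_mult)
    have "Re (LINT y|lborel. complex_of_real (exp (- H\<^sup>2 * y\<^sup>2 / 2)) * cis (y * x)) =
        (LINT y|lborel. exp (- H\<^sup>2 * y\<^sup>2 / 2) * cos (y * x))"
      using integral_Re[OF int] by simp
    then show ?thesis unfolding gauss_fourier[OF H] by (simp add: field_simps)
  qed
  have "smooth_window H T t = (LINT u|lborel. LINT y|lborel. indicator {-T..T} u * (1 / (2 * pi)) * (exp (- H\<^sup>2 * y\<^sup>2 / 2) * cos (y * (t - u))))"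
    unfolding smooth_window_def set_lebesgue_integral_def dens by (simp add: mult.assoc)
  also have "\<dots> = (LINT y|lborel. LINT u|lborel. indicator {-T..T} u * (1 / (2 * pi)) * (exp (- H\<^sup>2 * y\<^sup>2 / 2) * cos (y * (t - u))))"
  proof (rule Fubini_lborel_dominated(1)[OF _ _ integrable_gauss[OF H]])
    show "case_prod (\<lambda>u y. indicator {-T..T} u * (1 / (2 * pi)) * (exp (- H\<^sup>2 * y\<^sup>2 / 2) * cos (y * (t - u)))) \<in> borel_measurable (lborel \<Otimes>\<^sub>M lborel)"
      by measurable
    show "integrable lborel (\<lambda>u. indicator {-T..T} u * (1 / (2 * pi)) :: real)"
      by (intro integrable_mult_left integrable_real_indicator) (auto simp: emeasure_lborel_Icc_eq)
    fix u y :: real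
    have "exp (- H\<^sup>2 * y\<^sup>2 / 2) * \<bar>cos (y * (t - u))\<bar> \<le> exp (- H\<^sup>2 * y\<^sup>2 / 2) * 1"
      by (intro mult_left_mono abs_cos_le_one) simp
    then show "norm (indicator {-T..T} u * (1 / (2 * pi)) * (exp (- H\<^sup>2 * y\<^sup>2 / 2) * cos (y * (t - u)))) \<le>
        indicator {-T..T} u * (1 / (2 * pi)) * exp (- H\<^sup>2 * y\<^sup>2 / 2)"
      by (auto simp: abs_mult indicator_def divide_right_mono)
  qed
  also have "\<dots> = (LINT y|lborel. (1 / pi) * (exp (- H\<^sup>2 * y\<^sup>2 / 2) * (sin (T * y) / y) * cos (y * t)))"
  proof (rule integral_cong_AE)
    show "AE y in lborel. (LINT u|lborel. indicator {-T..T} u * (1 / (2 * pi)) * (exp (- H\<^sup>2 * y\<^sup>2 / 2) * cos (y * (t - u)))) =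
        (1 / pi) * (exp (- H\<^sup>2 * y\<^sup>2 / 2) * (sin (T * y) / y) * cos (y * t))"
      using AE_lborel_singleton[of "0::real"]
    proof eventually_elim
      case (elim y)
      have "((\<lambda>u. cos (y * (t - u))) has_integral (- sin (y * (t - T)) / y - (- sin (y * (t - (- T))) / y))) {-T..T}"
        using T elim
        by (intro fundamental_theorem_of_calculus)
           (auto intro!: derivative_eq_intros simp flip: has_real_derivative_iff_has_vector_derivative)
      also have "- sin (y * (t - T)) / y - (- sin (y * (t - (- T))) / y) = 2 * (sin (T * y) / y) * cos (y * t)"
        by (simp add: right_diff_distrib distrib_left sin_diff sin_add mult.commute diff_divide_distrib add_divide_distrib)
      finally have "(LINT u:{-T..T}|lborel. cos (y * (t - u))) = 2 * (sin (T * y) / y) * cos (y * t)"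
        by (subst set_borel_integral_eq_integral(2))
           (auto intro!: borel_integrable_atLeastAtMost' continuous_intros simp: integral_unique)
      moreover have "(LINT u|lborel. indicator {-T..T} u * (1 / (2 * pi)) * (exp (- H\<^sup>2 * y\<^sup>2 / 2) * cos (y * (t - u)))) =
          (LINT u|lborel. (1 / (2 * pi) * exp (- H\<^sup>2 * y\<^sup>2 / 2)) * (indicator {-T..T} u *\<^sub>R cos (y * (t - u))))"
        by (simp add: mult_ac)
      ultimately show ?case
        unfolding integral_mult_right_zero set_lebesgue_integral_def by simp
    qed
  qed measurable
  finally show ?thesis by (simp only: integral_mult_right_zero)
qed

text \<open>Subtracting from the value at 0 produces the kernel \<open>1 - cos\<close>, so after
  exchanging the integrals only the cosine integrals of \<open>p\<close> enter. Their bound absorbs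
  \<open>1 / \<bar>y\<bar>\<close>, and the result is uniform in \<open>T\<close>.\<close>

lemma smooth_excess_le:
  fixes p :: "real \<Rightarrow> real" and H T K :: real
  assumes int: "integrable lborel p"
    and K: "\<And>y. \<bar>LINT t|lborel. p t * (1 - cos (y * t))\<bar> \<le> K * \<bar>y\<bar> powr (3/2)"
    and H: "H > 0" and T: "T \<ge> 0"
  shows "\<bar>LINT t|lborel. p t * (smooth_window H T 0 - smooth_window H T t)\<bar>
     \<le> (1 / pi) * (LINT y|lborel. exp (- H\<^sup>2 * y\<^sup>2 / 2) * (K * \<bar>y\<bar> powr (1/2)))"
proof -
  have [measurable]: "p \<in> borel_measurable borel" using int by auto
  let ?\<gamma> = "\<lambda>y::real. exp (- H\<^sup>2 * y\<^sup>2 / 2)"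
  \<comment> \<open>The bound by \<open>T\<close> secures integrability; the final estimate uses
    \<open>1 / \<bar>y\<bar>\<close> instead.\<close>
  have sinc: "\<bar>sin (T * y) / y\<bar> \<le> T" for y
    using abs_sin_x_le_abs_x[of "T * y"] T by (cases "y = 0") (auto simp: abs_mult divide_le_eq)
  have bd: "norm (?\<gamma> y * (sin (T * y) / y) * z) \<le> T * B * ?\<gamma> y" if "\<bar>z\<bar> \<le> B" for y z B
  proof -
    have "?\<gamma> y * (\<bar>sin (T * y) / y\<bar> * \<bar>z\<bar>) \<le> ?\<gamma> y * (T * B)"
      using sinc that T by (intro mult_left_mono mult_mono) auto
    then show ?thesis by (simp add: abs_mult mult_ac)
  qed
  have int_k: "integrable lborel (\<lambda>y. ?\<gamma> y * (sin (T * y) / y) * z y)" if [measurable]: "z \<in> borel_measurable borel" and "\<And>y. \<bar>z y\<bar> \<le> B" for z B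
  proof (rule Bochner_Integration.integrable_bound[of _ "\<lambda>y. T * B * ?\<gamma> y"])
    show "integrable lborel (\<lambda>y. T * B * ?\<gamma> y)" by (intro integrable_mult_right integrable_gauss H)
    show "AE y in lborel. norm (?\<gamma> y * (sin (T * y) / y) * z y) \<le> norm (T * B * ?\<gamma> y)"
      using bd[OF that(2)] by (auto intro: order_trans[OF _ abs_ge_self])
  qed measurable
  have w: "smooth_window H T 0 - smooth_window H T t =
      (1 / pi) * (LINT y|lborel. ?\<gamma> y * (sin (T * y) / y) * (1 - cos (y * t)))" for t
  proof -
    have "integrable lborel (\<lambda>y. ?\<gamma> y * (sin (T * y) / y) * cos (y * t))" for t
      by (rule int_k[of _ 1]) auto
    from Bochner_Integration.integral_diff[OF this[of 0] this[of t]] show ?thesis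
      by (simp add: smooth_window_fourier[OF H T] right_diff_distrib)
  qed
  have "(LINT t|lborel. p t * (smooth_window H T 0 - smooth_window H T t)) =
      (LINT t|lborel. LINT y|lborel. (1 / pi) * (p t * (?\<gamma> y * (sin (T * y) / y) * (1 - cos (y * t)))))"
    unfolding w by (simp only: integral_mult_right_zero mult.left_commute)
  also have "\<dots> = (LINT y|lborel. LINT t|lborel. (1 / pi) * (p t * (?\<gamma> y * (sin (T * y) / y) * (1 - cos (y * t)))))"
  proof (rule Fubini_lborel_dominated(1)[of _ "\<lambda>t. (1 / pi) * \<bar>p t\<bar>" "\<lambda>y. T * 2 * ?\<gamma> y"])
    show "integrable lborel (\<lambda>y. T * 2 * ?\<gamma> y)" by (intro integrable_mult_right integrable_gauss H)
    show "integrable lborel (\<lambda>t. (1 / pi) * \<bar>p t\<bar>)" using int by auto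
    fix t y :: real
    have "\<bar>1 - cos (y * t)\<bar> \<le> 2"
      using cos_ge_minus_one[of "y * t"] cos_le_one[of "y * t"] by linarith
    from mult_left_mono[OF bd[OF this, of y], of "(1 / pi) * \<bar>p t\<bar>"]
    show "norm ((1 / pi) * (p t * (?\<gamma> y * (sin (T * y) / y) * (1 - cos (y * t))))) \<le> (1 / pi) * \<bar>p t\<bar> * (T * 2 * ?\<gamma> y)"
      by (simp add: abs_mult mult_ac)
  qed measurable
  also have "\<dots> = (LINT y|lborel. (1 / pi) * (?\<gamma> y * (sin (T * y) / y) * (LINT t|lborel. p t * (1 - cos (y * t)))))"
  proof (rule Bochner_Integration.integral_cong[OF refl])
    fix y
    have "(LINT t|lborel. (1 / pi) * (p t * (?\<gamma> y * (sin (T * y) / y) * (1 - cos (y * t))))) =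
        (LINT t|lborel. ((1 / pi) * (?\<gamma> y * (sin (T * y) / y))) * (p t * (1 - cos (y * t))))"
      by (intro Bochner_Integration.integral_cong refl) (simp only: mult_ac)
    then show "(LINT t|lborel. (1 / pi) * (p t * (?\<gamma> y * (sin (T * y) / y) * (1 - cos (y * t))))) =
        (1 / pi) * (?\<gamma> y * (sin (T * y) / y) * (LINT t|lborel. p t * (1 - cos (y * t))))"
      by (simp only: integral_mult_right_zero mult.assoc)
  qed
  also have "\<dots> = (1 / pi) * (LINT y|lborel. ?\<gamma> y * (sin (T * y) / y) * (LINT t|lborel. p t * (1 - cos (y * t))))"
    by (rule integral_mult_right_zero)
  finally have eq: "(LINT t|lborel. p t * (smooth_window H T 0 - smooth_window H T t)) =
      (1 / pi) * (LINT y|lborel. ?\<gamma> y * (sin (T * y) / y) * (LINT t|lborel. p t * (1 - cos (y * t))))" .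
  have G: "\<bar>LINT t|lborel. p t * (1 - cos (y * t))\<bar> \<le> (LINT t|lborel. 2 * \<bar>p t\<bar>)" for y
    unfolding real_norm_def[symmetric]
  proof (rule Bochner_Integration.integral_norm_bound_integral)
    show "integrable lborel (\<lambda>t. p t * (1 - cos (y * t)))" by (rule integrable_mult_one_minus_cos[OF int])
    fix t
    have "\<bar>1 - cos (y * t)\<bar> \<le> 2"
      using cos_ge_minus_one[of "y * t"] cos_le_one[of "y * t"] by linarith
    then have "\<bar>p t\<bar> * \<bar>1 - cos (y * t)\<bar> \<le> \<bar>p t\<bar> * 2" by (rule mult_left_mono) simp
    then show "norm (p t * (1 - cos (y * t))) \<le> 2 * norm (p t)"
      by (simp only: real_norm_def abs_mult mult.commute[of 2])
  qed (use int in auto)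
  have K0: "K \<ge> 0" using K[of 1] by simp
  have "\<bar>LINT y|lborel. ?\<gamma> y * (sin (T * y) / y) * (LINT t|lborel. p t * (1 - cos (y * t)))\<bar>
     \<le> (LINT y|lborel. ?\<gamma> y * (K * \<bar>y\<bar> powr (1/2)))"
    unfolding real_norm_def[symmetric]
  proof (rule Bochner_Integration.integral_norm_bound_integral)
    show "integrable lborel (\<lambda>y. ?\<gamma> y * (sin (T * y) / y) * (LINT t|lborel. p t * (1 - cos (y * t))))"
      using G by (intro int_k) measurable
    show "integrable lborel (\<lambda>y. ?\<gamma> y * (K * norm y powr (1/2)))"
    \<comment> \<open>As \<open>\<bar>y\<bar> powr (1/2) \<le> 1 + \<bar>y\<bar>\<close>, the
      absolute moments of order 0 and 1 of a normal law of deviation \<open>1 / H\<close>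
      suffice.\<close>
    proof (rule Bochner_Integration.integrable_bound[of _ "\<lambda>y. K * sqrt (2 * pi * (1 / H)\<^sup>2) * (normal_density 0 (1 / H) y * \<bar>y - 0\<bar> ^ 0 + normal_density 0 (1 / H) y * \<bar>y - 0\<bar> ^ 1)"])
      show "integrable lborel (\<lambda>y. K * sqrt (2 * pi * (1 / H)\<^sup>2) * (normal_density 0 (1 / H) y * \<bar>y - 0\<bar> ^ 0 + normal_density 0 (1 / H) y * \<bar>y - 0\<bar> ^ 1))"
        using H by (intro integrable_mult_right Bochner_Integration.integrable_add integrable_normal_moment_abs) auto
      show "AE y in lborel. norm (?\<gamma> y * (K * norm y powr (1/2))) \<le>
        norm (K * sqrt (2 * pi * (1 / H)\<^sup>2) * (normal_density 0 (1 / H) y * \<bar>y - 0\<bar> ^ 0 + normal_density 0 (1 / H) y * \<bar>y - 0\<bar> ^ 1))"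
      proof (rule AE_I2)
        fix y :: real
        have "\<bar>y\<bar> powr (1/2) \<le> 1 + \<bar>y\<bar>"
        proof (cases "\<bar>y\<bar> \<le> 1")
          case True
          then have "\<bar>y\<bar> powr (1/2) \<le> 1" by (intro powr_le1) auto
          then show ?thesis by simp
        next
          case False
          then have "\<bar>y\<bar> powr (1/2) \<le> \<bar>y\<bar> powr 1" by (intro powr_mono) auto
          then show ?thesis by simp
        qed
        then have le: "?\<gamma> y * (K * \<bar>y\<bar> powr (1/2)) \<le> ?\<gamma> y * (K * (1 + \<bar>y\<bar>))"
          using K0 by (intro mult_left_mono) auto
        have "norm (?\<gamma> y * (K * norm y powr (1/2))) = ?\<gamma> y * (K * \<bar>y\<bar> powr (1/2))"
          using K0 by (simp add: abs_mult)
        also note le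
        also have "?\<gamma> y * (K * (1 + \<bar>y\<bar>)) =
          K * sqrt (2 * pi * (1 / H)\<^sup>2) * (normal_density 0 (1 / H) y * \<bar>y - 0\<bar> ^ 0 + normal_density 0 (1 / H) y * \<bar>y - 0\<bar> ^ 1)"
          using H by (simp add: normal_density_def field_simps)
        also note abs_ge_self
        finally show "norm (?\<gamma> y * (K * norm y powr (1/2))) \<le>
        norm (K * sqrt (2 * pi * (1 / H)\<^sup>2) * (normal_density 0 (1 / H) y * \<bar>y - 0\<bar> ^ 0 + normal_density 0 (1 / H) y * \<bar>y - 0\<bar> ^ 1))"
          by (simp only: real_norm_def)
      qed
    qed measurable
    fix y :: real
    have "\<bar>sin (T * y) / y\<bar> * \<bar>LINT t|lborel. p t * (1 - cos (y * t))\<bar> \<le> K * \<bar>y\<bar> powr (1/2)"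
    proof (cases "y = 0")
      case False
      have "\<bar>sin (T * y) / y\<bar> \<le> 1 / \<bar>y\<bar>"
        using abs_sin_le_one[of "T * y"] by (simp add: divide_right_mono)
      then have "\<bar>sin (T * y) / y\<bar> * \<bar>LINT t|lborel. p t * (1 - cos (y * t))\<bar> \<le> 1 / \<bar>y\<bar> * (K * \<bar>y\<bar> powr (3/2))"
        by (intro mult_mono K) auto
      also have "\<bar>y\<bar> powr (3/2) = \<bar>y\<bar> powr (1/2) * \<bar>y\<bar>"
        using False powr_add[of "\<bar>y\<bar>" "1/2" 1] by simp
      finally show ?thesis using False by simp
    qed simp
    then have "?\<gamma> y * (\<bar>sin (T * y) / y\<bar> * \<bar>LINT t|lborel. p t * (1 - cos (y * t))\<bar>) \<le> ?\<gamma> y * (K * \<bar>y\<bar> powr (1/2))"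
      by (intro mult_left_mono) auto
    then show "norm (?\<gamma> y * (sin (T * y) / y) * (LINT t|lborel. p t * (1 - cos (y * t)))) \<le> ?\<gamma> y * (K * norm y powr (1/2))"
      by (simp add: abs_mult mult_ac)
  qed
  then show ?thesis
    unfolding eq abs_mult by (simp add: divide_right_mono)
qed

text \<open>Replacing \<open>y\<close> by \<open>y / H\<close> yields one power of
  \<open>1 / H\<close> from the measure and half a power from the root.\<close>

lemma gauss_root_integral:
  fixes H K :: real
  assumes H: "H > 0"
  shows "(LINT y|lborel. exp (- H\<^sup>2 * y\<^sup>2 / 2) * (K * \<bar>y\<bar> powr (1/2))) =
     H powr (- (3/2)) * (LINT y|lborel. exp (- (y\<^sup>2) / 2) * (K * \<bar>y\<bar> powr (1/2)))"
proof -
  have "(LINT y|lborel. exp (- H\<^sup>2 * y\<^sup>2 / 2) * (K * \<bar>y\<bar> powr (1/2))) =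
      \<bar>1 / H\<bar> *\<^sub>R (LINT y|lborel. exp (- H\<^sup>2 * (0 + 1 / H * y)\<^sup>2 / 2) * (K * \<bar>0 + 1 / H * y\<bar> powr (1/2)))"
    using H by (intro lborel_integral_real_affine) simp
  also have "(\<lambda>y. exp (- H\<^sup>2 * (0 + 1 / H * y)\<^sup>2 / 2) * (K * \<bar>0 + 1 / H * y\<bar> powr (1/2))) =
      (\<lambda>y. H powr (- (1/2)) * (exp (- (y\<^sup>2) / 2) * (K * \<bar>y\<bar> powr (1/2))))"
  proof
    fix y :: real
    have "- H\<^sup>2 * (0 + 1 / H * y)\<^sup>2 = - (y\<^sup>2)" using H by (simp add: power_divide)
    moreover have "\<bar>0 + 1 / H * y\<bar> powr (1/2) = \<bar>y\<bar> powr (1/2) / H powr (1/2)"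
      using H by (simp add: powr_divide)
    ultimately show "exp (- H\<^sup>2 * (0 + 1 / H * y)\<^sup>2 / 2) * (K * \<bar>0 + 1 / H * y\<bar> powr (1/2)) =
        H powr (- (1/2)) * (exp (- (y\<^sup>2) / 2) * (K * \<bar>y\<bar> powr (1/2)))"
      by (simp add: powr_minus_divide)
  qed
  also have "\<bar>1 / H\<bar> *\<^sub>R (LINT y|lborel. H powr (- (1/2)) * (exp (- (y\<^sup>2) / 2) * (K * \<bar>y\<bar> powr (1/2)))) =
      (1 / H * H powr (- (1/2))) * (LINT y|lborel. exp (- (y\<^sup>2) / 2) * (K * \<bar>y\<bar> powr (1/2)))"
    unfolding integral_mult_right_zero using H by simp
  also have "1 / H * H powr (- (1/2)) = H powr (- (3/2))"
    using H powr_add[of H "-1" "- (1/2)"] by (simp add: powr_minus inverse_eq_divide)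
  finally show ?thesis .
qed

subsection \<open>The mean square of the zeta-function on the critical line\<close>

definition tail_mass :: "(real \<Rightarrow> real) \<Rightarrow> real \<Rightarrow> real" where
  "tail_mass q T = (LINT t|lborel. indicator {t. T < \<bar>t\<bar>} t * q t)"

definition shell_mass :: "(real \<Rightarrow> real) \<Rightarrow> real \<Rightarrow> real \<Rightarrow> real" where
  "shell_mass q A B = (LINT t|lborel. indicator {t. A \<le> \<bar>t\<bar> \<and> \<bar>t\<bar> \<le> B} t * \<bar>q t\<bar>)"

lemma abs_integral_le:
  fixes f g :: "real \<Rightarrow> real"
  assumes "integrable lborel f" "integrable lborel g" "\<And>x. \<bar>f x\<bar> \<le> g x"
  shows "\<bar>LINT x|lborel. f x\<bar> \<le> (LINT x|lborel. g x)"
  using Bochner_Integration.integral_norm_bound_integral[of lborel f g] assms by simp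

lemma gauss_tail_nonneg: "gauss_tail H d \<ge> 0"
  by (simp add: gauss_tail_def)

text \<open>The reference is the window at 0, not 1, because that is the form in
  \<open>smooth_excess_le\<close>. It misses 1 by at most \<open>gauss_tail H d\<close>, which
  explains the factor 2 in the second bound and the slightly negative lower bound in the
  third.\<close>

lemma window_complement:
  assumes H: "H > 0" and d: "0 \<le> d" "d \<le> T"
  defines "v \<equiv> \<lambda>t. smooth_window H T 0 - smooth_window H T t"
  shows window_complement_small: "\<bar>t\<bar> \<le> T - d \<Longrightarrow> \<bar>v t\<bar> \<le> gauss_tail H d"
    and window_complement_large: "T + d \<le> \<bar>t\<bar> \<Longrightarrow> \<bar>v t - 1\<bar> \<le> 2 * gauss_tail H d"
    and window_complement_bounds: "- gauss_tail H d \<le> v t" "v t \<le> 1"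
proof -
  have 0: "1 - gauss_tail H d \<le> smooth_window H T 0"
    using d by (intro smooth_window_inside_ge H) auto
  note b = smooth_window_bounds[OF H, of T 0] smooth_window_bounds[OF H, of T t]
  show "\<bar>t\<bar> \<le> T - d \<Longrightarrow> \<bar>v t\<bar> \<le> gauss_tail H d"
    using smooth_window_inside_ge[OF H d(1), of t T] 0 b unfolding v_def by linarith
  show "T + d \<le> \<bar>t\<bar> \<Longrightarrow> \<bar>v t - 1\<bar> \<le> 2 * gauss_tail H d"
    using smooth_window_outside_le[OF H d(1), of T t] 0 b unfolding v_def by linarith
  show "- gauss_tail H d \<le> v t" "v t \<le> 1" using 0 b unfolding v_def by linarith+
qed

lemma integrable_mult_bounded:
  fixes q v :: "real \<Rightarrow> real"
  assumes q: "integrable lborel q" and [measurable]: "v \<in> borel_measurable borel" and v: "\<And>t. \<bar>v t\<bar> \<le> C"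
  shows "integrable lborel (\<lambda>t. v t * q t)"
proof (rule Bochner_Integration.integrable_bound[of _ "\<lambda>t. C * q t"])
  show "(\<lambda>t. v t * q t) \<in> borel_measurable lborel" using q by auto
  show "AE t in lborel. norm (v t * q t) \<le> norm (C * q t)"
    using v by (auto simp: abs_mult intro!: mult_right_mono order_trans[OF v abs_ge_self])
qed (use q in auto)

lemma window_complement_integrable:
  assumes "integrable lborel q" "H > 0"
  shows "integrable lborel (\<lambda>t. q t * (smooth_window H T 0 - smooth_window H T t))"
proof -
  have "\<bar>smooth_window H T 0 - smooth_window H T t\<bar> \<le> 1" for t
    using smooth_window_bounds[OF assms(2), of T 0] smooth_window_bounds[OF assms(2), of T t] by linarith
  from integrable_mult_bounded[OF assms(1) _ this] show ?thesis by (simp add: mult.commute)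
qed

lemma integrable_indicator_mult:
  fixes q :: "real \<Rightarrow> real"
  assumes "integrable lborel q" "A \<in> sets borel"
  shows "integrable lborel (\<lambda>t. indicator A t * q t)"
  using integrable_mult_indicator[of A lborel q] assms by simp

lemma sets_tail [measurable]: "{t::real. T < \<bar>t\<bar>} \<in> sets borel"
  and sets_shell [measurable]: "{t::real. A \<le> \<bar>t\<bar> \<and> \<bar>t\<bar> \<le> B} \<in> sets borel"
  by measurable

text \<open>For \<open>q\<close> of either sign, everything beyond the Gaussian tails is paid for by
  the mass of \<open>\<bar>q\<bar>\<close> in the shell where the window is in transition.\<close>

lemma window_model_le:
  assumes q: "integrable lborel q" and H: "H > 0" and d: "0 \<le> d" "d \<le> T"
  shows "\<bar>(LINT t|lborel. q t * (smooth_window H T 0 - smooth_window H T t)) - tail_mass q T\<bar>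
     \<le> 2 * gauss_tail H d * (LINT t|lborel. \<bar>q t\<bar>) + shell_mass q (T - d) (T + d)"
proof -
  define v where "v t = smooth_window H T 0 - smooth_window H T t" for t
  note w = window_complement[OF H d, folded v_def]
  note i1 = window_complement_integrable[OF q H, of T, folded v_def]
  have i2: "integrable lborel (\<lambda>t. indicator {t. T < \<bar>t\<bar>} t * q t)"
    using q by (rule integrable_indicator_mult) measurable
  have i3: "integrable lborel (\<lambda>t. 2 * gauss_tail H d * \<bar>q t\<bar>)" using q by auto
  have i4: "integrable lborel (\<lambda>t. indicator {t. T - d \<le> \<bar>t\<bar> \<and> \<bar>t\<bar> \<le> T + d} t * \<bar>q t\<bar>)"
    using q by (intro integrable_indicator_mult) auto
  have "\<bar>LINT t|lborel. q t * v t - indicator {t. T < \<bar>t\<bar>} t * q t\<bar> \<le>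
     (LINT t|lborel. 2 * gauss_tail H d * \<bar>q t\<bar> + indicator {t. T - d \<le> \<bar>t\<bar> \<and> \<bar>t\<bar> \<le> T + d} t * \<bar>q t\<bar>)"
  proof (rule abs_integral_le)
    show "integrable lborel (\<lambda>t. q t * v t - indicator {t. T < \<bar>t\<bar>} t * q t)"
      by (intro Bochner_Integration.integrable_diff i1 i2)
    show "integrable lborel (\<lambda>t. 2 * gauss_tail H d * \<bar>q t\<bar> + indicator {t. T - d \<le> \<bar>t\<bar> \<and> \<bar>t\<bar> \<le> T + d} t * \<bar>q t\<bar>)"
      using Bochner_Integration.integrable_add[OF i3 i4] by simp
    fix t :: real
    have "\<bar>v t - indicator {t. T < \<bar>t\<bar>} t\<bar> \<le> 2 * gauss_tail H d + indicator {t. T - d \<le> \<bar>t\<bar> \<and> \<bar>t\<bar> \<le> T + d} t"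
    proof -
      consider "\<bar>t\<bar> < T - d" | "T - d \<le> \<bar>t\<bar> \<and> \<bar>t\<bar> \<le> T + d" | "T + d < \<bar>t\<bar>" by linarith
      then show ?thesis
      proof cases
        case 1
        then have "\<not> T < \<bar>t\<bar>" using d by linarith
        then show ?thesis using w(1)[of t] 1 gauss_tail_nonneg[of H d] by (simp add: indicator_def)
      next
        case 2
        then show ?thesis using w(3)[of t] w(4)[of t] gauss_tail_nonneg[of H d] by (auto simp: indicator_def)
      next
        case 3
        then have "T < \<bar>t\<bar>" using d by linarith
        then show ?thesis using w(2)[of t] 3 by (simp add: indicator_def)
      qed
    qed
    then have "\<bar>v t - indicator {t. T < \<bar>t\<bar>} t\<bar> * \<bar>q t\<bar> \<le>
        (2 * gauss_tail H d + indicator {t. T - d \<le> \<bar>t\<bar> \<and> \<bar>t\<bar> \<le> T + d} t) * \<bar>q t\<bar>"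
      by (rule mult_right_mono) simp
    moreover have "q t * v t - indicator {t. T < \<bar>t\<bar>} t * q t = (v t - indicator {t. T < \<bar>t\<bar>} t) * q t"
      by (simp add: algebra_simps)
    ultimately show "\<bar>q t * v t - indicator {t. T < \<bar>t\<bar>} t * q t\<bar> \<le>
       2 * gauss_tail H d * \<bar>q t\<bar> + indicator {t. T - d \<le> \<bar>t\<bar> \<and> \<bar>t\<bar> \<le> T + d} t * \<bar>q t\<bar>"
      by (simp only: abs_mult distrib_right)
  qed
  then show ?thesis
    unfolding Bochner_Integration.integral_diff[OF i1 i2] Bochner_Integration.integral_add[OF i3 i4]
    by (simp add: tail_mass_def shell_mass_def v_def)
qed

text \<open>Positivity of \<open>p\<close> allows one-sided comparisons with cut-offs moved by
  \<open>d\<close>: in the transition zone \<open>p\<close> is simply kept or dropped, so its mass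
  near \<open>T\<close> never has to be estimated.\<close>

lemma window_tail_le:
  assumes p: "integrable lborel p" "\<And>t. p t \<ge> 0" and H: "H > 0" and d: "0 \<le> d" "d \<le> T"
  shows "tail_mass p (T + d) \<le> (LINT t|lborel. p t * (smooth_window H T 0 - smooth_window H T t)) + 2 * gauss_tail H d * (LINT t|lborel. p t)"
    and "(LINT t|lborel. p t * (smooth_window H T 0 - smooth_window H T t)) \<le> tail_mass p (T - d) + 2 * gauss_tail H d * (LINT t|lborel. p t)"
proof -
  define v where "v t = smooth_window H T 0 - smooth_window H T t" for t
  note w = window_complement[OF H d, folded v_def]
  note i1 = window_complement_integrable[OF p(1) H, of T, folded v_def]
  have i2: "integrable lborel (\<lambda>t. indicator {t. S < \<bar>t\<bar>} t * p t)" for S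
    using p(1) by (rule integrable_indicator_mult) measurable
  have i3: "integrable lborel (\<lambda>t. 2 * gauss_tail H d * p t)" using p(1) by auto
  have "tail_mass p (T + d) \<le> (LINT t|lborel. p t * v t + 2 * gauss_tail H d * p t)"
    unfolding tail_mass_def
  proof (rule integral_mono[OF i2 Bochner_Integration.integrable_add[OF i1 i3]])
    fix t
    have "indicator {t. T + d < \<bar>t\<bar>} t \<le> v t + 2 * gauss_tail H d"
      using w(2)[of t] w(3)[of t] gauss_tail_nonneg[of H d] by (cases "T + d < \<bar>t\<bar>") auto
    from mult_right_mono[OF this p(2)[of t]]
    show "indicator {t. T + d < \<bar>t\<bar>} t * p t \<le> p t * v t + 2 * gauss_tail H d * p t"
      by (simp add: algebra_simps)
  qed
  then show "tail_mass p (T + d) \<le> (LINT t|lborel. p t * (smooth_window H T 0 - smooth_window H T t)) + 2 * gauss_tail H d * (LINT t|lborel. p t)"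
    unfolding Bochner_Integration.integral_add[OF i1 i3] by (simp add: v_def)
  have "(LINT t|lborel. p t * v t) \<le> (LINT t|lborel. indicator {t. T - d < \<bar>t\<bar>} t * p t + 2 * gauss_tail H d * p t)"
  proof (rule integral_mono[OF i1 Bochner_Integration.integrable_add[OF i2 i3]])
    fix t
    have "v t \<le> indicator {t. T - d < \<bar>t\<bar>} t + 2 * gauss_tail H d"
      using w(1)[of t] w(4)[of t] gauss_tail_nonneg[of H d] by (cases "T - d < \<bar>t\<bar>") auto
    from mult_right_mono[OF this p(2)[of t]]
    show "p t * v t \<le> indicator {t. T - d < \<bar>t\<bar>} t * p t + 2 * gauss_tail H d * p t"
      by (simp add: algebra_simps)
  qed
  then show "(LINT t|lborel. p t * (smooth_window H T 0 - smooth_window H T t)) \<le> tail_mass p (T - d) + 2 * gauss_tail H d * (LINT t|lborel. p t)"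
    unfolding Bochner_Integration.integral_add[OF i2 i3] by (simp add: v_def tail_mass_def)
qed

lemma tail_mass_diff_le:
  assumes q: "integrable lborel q" and "A \<le> S" "S \<le> B" "A \<le> S'" "S' \<le> B"
  shows "\<bar>tail_mass q S - tail_mass q S'\<bar> \<le> shell_mass q A B"
proof -
  have i: "integrable lborel (\<lambda>t. indicator {t. S < \<bar>t\<bar>} t * q t)" for S
    using q by (rule integrable_indicator_mult) measurable
  have "\<bar>LINT t|lborel. indicator {t. S < \<bar>t\<bar>} t * q t - indicator {t. S' < \<bar>t\<bar>} t * q t\<bar> \<le> shell_mass q A B"
    unfolding shell_mass_def
  proof (rule abs_integral_le)
    show "integrable lborel (\<lambda>t. indicator {t. A \<le> \<bar>t\<bar> \<and> \<bar>t\<bar> \<le> B} t * \<bar>q t\<bar>)"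
      using q by (intro integrable_indicator_mult) auto
    show "\<bar>indicator {t. S < \<bar>t\<bar>} t * q t - indicator {t. S' < \<bar>t\<bar>} t * q t\<bar> \<le> indicator {t. A \<le> \<bar>t\<bar> \<and> \<bar>t\<bar> \<le> B} t * \<bar>q t\<bar>" for t
      using assms by (auto simp: indicator_def)
  qed (intro Bochner_Integration.integrable_diff i)
  then show ?thesis
    unfolding Bochner_Integration.integral_diff[OF i i] tail_mass_def .
qed

lemma shell_mass_mono:
  assumes q: "integrable lborel q" and "A' \<le> A" "B \<le> B'"
  shows "shell_mass q A B \<le> shell_mass q A' B'"
  unfolding shell_mass_def
proof -
  have i: "integrable lborel (\<lambda>t. indicator {t. A \<le> \<bar>t\<bar> \<and> \<bar>t\<bar> \<le> B} t * \<bar>q t\<bar>)" for A B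
    using q by (intro integrable_indicator_mult) auto
  show "(LINT t|lborel. indicator {t. A \<le> \<bar>t\<bar> \<and> \<bar>t\<bar> \<le> B} t * \<bar>q t\<bar>) \<le>
      (LINT t|lborel. indicator {t. A' \<le> \<bar>t\<bar> \<and> \<bar>t\<bar> \<le> B'} t * \<bar>q t\<bar>)"
    by (rule integral_mono[OF i i]) (use assms in \<open>auto simp: indicator_def\<close>)
qed

text \<open>The upper bound for the sharp tail comes from the window at \<open>S - d\<close>, the
  lower one from \<open>S + d\<close>. One \<open>shell_mass\<close> pays for smoothing
  \<open>q\<close>, the other for moving its cut-off back to \<open>S\<close>; both shells lie
  within \<open>2 * d\<close> of \<open>S\<close>.\<close>

lemma tail_mass_compare:
  assumes p: "integrable lborel p" "\<And>t. p t \<ge> 0" and q: "integrable lborel q"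
    and H: "H > 0" and d: "0 \<le> d" "2 * d \<le> S"
    and R: "\<And>T. T \<ge> 0 \<Longrightarrow> \<bar>LINT t|lborel. (p t - q t) * (smooth_window H T 0 - smooth_window H T t)\<bar> \<le> R"
  shows "\<bar>tail_mass p S - tail_mass q S\<bar> \<le> R + 2 * gauss_tail H d * ((LINT t|lborel. p t) + (LINT t|lborel. \<bar>q t\<bar>))
      + 2 * shell_mass q (S - 2 * d) (S + 2 * d)"
proof -
  let ?w = "\<lambda>q T. LINT t|lborel. q t * (smooth_window H T 0 - smooth_window H T t)"
  have diff: "?w p T - ?w q T = (LINT t|lborel. (p t - q t) * (smooth_window H T 0 - smooth_window H T t))" for T
    using Bochner_Integration.integral_diff[OF window_complement_integrable[OF p(1) H] window_complement_integrable[OF q H]]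
    by (simp add: left_diff_distrib)
  define e where "e = 2 * gauss_tail H d * (LINT t|lborel. p t)"
  define f where "f = 2 * gauss_tail H d * (LINT t|lborel. \<bar>q t\<bar>)"
  define M where "M = shell_mass q (S - 2 * d) (S + 2 * d)"
  have "tail_mass p S \<le> ?w p (S - d) + e"
    using window_tail_le(1)[OF p H, of d "S - d"] d by (simp add: e_def)
  moreover have "?w p (S - d) \<le> ?w q (S - d) + R"
    using R[of "S - d"] d diff[of "S - d"] by linarith
  moreover have "?w q (S - d) \<le> tail_mass q (S - d) + (f + M)"
  proof -
    have "shell_mass q (S - d - d) (S - d + d) \<le> M"
      unfolding M_def using d by (intro shell_mass_mono q) auto
    then show ?thesis
      using window_model_le[OF q H, of d "S - d"] d unfolding f_def by linarith
  qed
  moreover have "tail_mass q (S - d) \<le> tail_mass q S + M"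
    using tail_mass_diff_le[OF q, of "S - 2 * d" "S - d" "S + 2 * d" S] d unfolding M_def by linarith
  moreover have "?w p (S + d) \<le> tail_mass p S + e"
    using window_tail_le(2)[OF p H, of d "S + d"] d by (simp add: e_def)
  moreover have "?w q (S + d) \<le> ?w p (S + d) + R"
    using R[of "S + d"] d diff[of "S + d"] by linarith
  moreover have "tail_mass q (S + d) \<le> ?w q (S + d) + (f + M)"
  proof -
    have "shell_mass q (S + d - d) (S + d + d) \<le> M"
      unfolding M_def using d by (intro shell_mass_mono q) auto
    then show ?thesis
      using window_model_le[OF q H, of d "S + d"] d unfolding f_def by linarith
  qed
  moreover have "tail_mass q S \<le> tail_mass q (S + d) + M"
    using tail_mass_diff_le[OF q, of "S - 2 * d" "S + d" "S + 2 * d" S] d unfolding M_def by linarith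
  ultimately have "\<bar>tail_mass p S - tail_mass q S\<bar> \<le> R + (e + f) + 2 * M" by linarith
  then show ?thesis by (simp add: e_def f_def M_def distrib_left)
qed

text \<open>The shell consists of two intervals of length \<open>4 * d\<close>. There
  \<open>\<bar>t\<bar>\<close> lies between \<open>S / 2\<close> and \<open>2 * S\<close>, and
  squaring \<open>S / 2\<close> contributes a further factor 4, whence 32.\<close>

lemma model_shell_le:
  assumes S: "S \<ge> 2" and d: "0 \<le> d" "4 * d \<le> S"
  shows "shell_mass (model_dens a) (S - 2 * d) (S + 2 * d) \<le> 32 * d * (ln (2 * S) + \<bar>a\<bar>) / S\<^sup>2"
proof -
  define c where "c = (ln (2 * S) + \<bar>a\<bar>) / (S / 2)\<^sup>2"
  define I J where "I = {S - 2 * d..S + 2 * d}" and "J = {- S - 2 * d..- S + 2 * d}"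
  have "shell_mass (model_dens a) (S - 2 * d) (S + 2 * d) \<le> (LINT t|lborel. indicator I t *\<^sub>R c + indicator J t *\<^sub>R c)"
    unfolding shell_mass_def
  proof (rule integral_mono)
    show "integrable lborel (\<lambda>t. indicator {t. S - 2 * d \<le> \<bar>t\<bar> \<and> \<bar>t\<bar> \<le> S + 2 * d} t * \<bar>model_dens a t\<bar>)"
      using integrable_model_dens by (intro integrable_indicator_mult) auto
    show "integrable lborel (\<lambda>t. indicator I t *\<^sub>R c + indicator J t *\<^sub>R c)"
      unfolding I_def J_def
      by (intro Bochner_Integration.integrable_add integrable_scaleR_left integrable_real_indicator) (auto simp: emeasure_lborel_Icc_eq)
    fix t :: real
    have "c \<ge> 0" using S by (simp add: c_def)
    have "\<bar>model_dens a t\<bar> \<le> c" if t: "S - 2 * d \<le> \<bar>t\<bar>" "\<bar>t\<bar> \<le> S + 2 * d"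
    proof -
      have t': "S / 2 \<le> \<bar>t\<bar>" "\<bar>t\<bar> \<le> 2 * S" using t d by linarith+
      have "1 \<le> \<bar>t\<bar>" using t' S by linarith
      have "\<bar>model_dens a t\<bar> = \<bar>ln \<bar>t\<bar> + a\<bar> / \<bar>t\<bar>\<^sup>2"
        using \<open>1 \<le> \<bar>t\<bar>\<close> by (simp add: model_dens_def abs_mult)
      also have "\<dots> \<le> (ln (2 * S) + \<bar>a\<bar>) / (S / 2)\<^sup>2"
      proof (rule frac_le)
        have "0 \<le> ln \<bar>t\<bar>" "ln \<bar>t\<bar> \<le> ln (2 * S)" using \<open>1 \<le> \<bar>t\<bar>\<close> t' by auto
        then show "\<bar>ln \<bar>t\<bar> + a\<bar> \<le> ln (2 * S) + \<bar>a\<bar>" "0 \<le> ln (2 * S) + \<bar>a\<bar>" by linarith+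
        show "0 < (S / 2)\<^sup>2" using S by simp
        show "(S / 2)\<^sup>2 \<le> \<bar>t\<bar>\<^sup>2" using t' S by (intro power_mono) auto
      qed
      finally show ?thesis by (simp add: c_def)
    qed
    moreover have "t \<in> I \<or> t \<in> J" if "S - 2 * d \<le> \<bar>t\<bar>" "\<bar>t\<bar> \<le> S + 2 * d"
      using that by (auto simp: I_def J_def abs_if split: if_splits)
    ultimately show "indicator {t. S - 2 * d \<le> \<bar>t\<bar> \<and> \<bar>t\<bar> \<le> S + 2 * d} t * \<bar>model_dens a t\<bar> \<le> indicator I t *\<^sub>R c + indicator J t *\<^sub>R c"
      using \<open>c \<ge> 0\<close> by (auto simp: indicator_def intro: add_increasing)
  qed
  also have "\<dots> = 8 * d * c"
    unfolding I_def J_def using d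
    by (subst Bochner_Integration.integral_add)
       (auto simp: emeasure_lborel_Icc_eq measure_lborel_Icc intro!: integrable_scaleR_left integrable_real_indicator)
  also have "\<dots> = 32 * d * (ln (2 * S) + \<bar>a\<bar>) / S\<^sup>2"
    by (simp add: c_def power_divide)
  finally show ?thesis .
qed

text \<open>The rate \<open>o(1 / T)\<close> is what partial summation can use: multiplied by the
  weight \<open>1/4 + T\<^sup>2\<close> that restores \<open>zeta_sq\<close>, the difference of the
  tails is still \<open>o(T)\<close>.\<close>

lemma tail_excess_tendsto_0:
  obtains a where "((\<lambda>T. T * (tail_mass zeta_dens T - tail_mass (model_dens a) T)) \<longlongrightarrow> 0) at_top"
proof -
  obtain a K where K: "K \<ge> 0 \<and> (\<forall>y. \<bar>LINT t|lborel. (zeta_dens t - model_dens a t) * (1 - cos (y * t))\<bar> \<le> K * \<bar>y\<bar> powr (3/2))"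
    using excess_cos_integral_le by (elim exE)
  have int: "integrable lborel (\<lambda>t. zeta_dens t - model_dens a t)"
    by (intro Bochner_Integration.integrable_diff integrable_zeta_dens integrable_model_dens)
  define B where "B = (1 / pi) * (LINT y|lborel. exp (- (y\<^sup>2) / 2) * (K * \<bar>y\<bar> powr (1/2)))"
  define P where "P = (LINT t|lborel. zeta_dens t) + (LINT t|lborel. \<bar>model_dens a t\<bar>)"
  \<comment> \<open>The smoothing scale \<open>H = S powr (3/4)\<close> and the margin \<open>d = S powr (7/8)\<close> satisfy
    \<open>H powr (- (3/2)) = o(1 / S)\<close>, \<open>H = o(d)\<close> and \<open>d ln S = o(S)\<close>.\<close>
  define E where "E S = B * (S * (S powr (3/4)) powr (- (3/2))) + P * (2 * S * gauss_tail (S powr (3/4)) (S powr (7/8)))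
      + (64 * S powr (7/8) * ln (2 * S) / S + \<bar>a\<bar> * (64 * S powr (7/8) / S))" for S :: real
  have bound: "\<bar>S * (tail_mass zeta_dens S - tail_mass (model_dens a) S)\<bar> \<le> E S"
    if S: "S \<ge> 2" "4 * S powr (7/8) \<le> S" for S
  proof -
    define H d where "H = S powr (3/4)" and "d = S powr (7/8)"
    have H: "H > 0" and d: "0 \<le> d" "4 * d \<le> S" using S by (auto simp: H_def d_def)
    have "\<bar>tail_mass zeta_dens S - tail_mass (model_dens a) S\<bar> \<le> B * H powr (- (3/2)) +
        2 * gauss_tail H d * P + 2 * shell_mass (model_dens a) (S - 2 * d) (S + 2 * d)"
      unfolding P_def
    proof (rule tail_mass_compare[OF integrable_zeta_dens zeta_dens_nonneg integrable_model_dens H])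
      fix T :: real assume "T \<ge> 0"
      from smooth_excess_le[OF int K[THEN conjunct2, rule_format] H this]
      show "\<bar>LINT t|lborel. (zeta_dens t - model_dens a t) * (smooth_window H T 0 - smooth_window H T t)\<bar> \<le> B * H powr (- (3/2))"
        unfolding gauss_root_integral[OF H] B_def by (simp add: mult_ac)
    qed (use d in auto)
    also have "\<dots> \<le> B * H powr (- (3/2)) + 2 * gauss_tail H d * P + 2 * (32 * d * (ln (2 * S) + \<bar>a\<bar>) / S\<^sup>2)"
      by (intro add_left_mono mult_left_mono model_shell_le[OF S(1) d]) simp
    finally have "S * \<bar>tail_mass zeta_dens S - tail_mass (model_dens a) S\<bar> \<le>
        S * (B * H powr (- (3/2)) + 2 * gauss_tail H d * P + 2 * (32 * d * (ln (2 * S) + \<bar>a\<bar>) / S\<^sup>2))"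
      using S by (intro mult_left_mono) auto
    also have "\<dots> = E S"
      using S unfolding E_def H_def[symmetric] d_def[symmetric] by (simp add: field_simps power2_eq_square)
    finally show ?thesis using S by (simp add: abs_mult)
  qed
  have ev: "\<forall>\<^sub>F S in at_top. \<bar>S * (tail_mass zeta_dens S - tail_mass (model_dens a) S)\<bar> \<le> E S"
  proof -
    have "\<forall>\<^sub>F S in at_top. 4 * S powr (7/8) \<le> (S::real)" by real_asymp
    with eventually_ge_at_top[of 2] show ?thesis by eventually_elim (rule bound)
  qed
  have "((\<lambda>S::real. S * (S powr (3/4)) powr (- (3/2))) \<longlongrightarrow> 0) at_top" by real_asymp
  moreover have "((\<lambda>S::real. 2 * S * gauss_tail (S powr (3/4)) (S powr (7/8))) \<longlongrightarrow> 0) at_top"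
    unfolding gauss_tail_def by real_asymp
  moreover have "((\<lambda>S::real. 64 * S powr (7/8) * ln (2 * S) / S) \<longlongrightarrow> 0) at_top" by real_asymp
  moreover have "((\<lambda>S::real. 64 * S powr (7/8) / S) \<longlongrightarrow> 0) at_top" by real_asymp
  ultimately have "(E \<longlongrightarrow> B * 0 + P * 0 + (0 + \<bar>a\<bar> * 0)) at_top"
    unfolding E_def by (intro tendsto_intros)
  then have E: "(E \<longlongrightarrow> 0) at_top" by simp
  have "((\<lambda>S. S * (tail_mass zeta_dens S - tail_mass (model_dens a) S)) \<longlongrightarrow> 0) at_top"
    using ev by (intro Lim_null_comparison[OF _ E]) simp
  then show ?thesis by (rule that)
qed

section \<open>From tails back to the mean square\<close>

text \<open>Because \<open>frac_exp\<close> is real, its transform at \<open>- t\<close> is the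
  conjugate of the one at \<open>t\<close>.\<close>

lemma zeta_dens_even: "zeta_dens (- t) = zeta_dens t"
proof -
  have "fourier frac_exp (- t) = cnj (fourier frac_exp t)"
    unfolding fourier_def Bochner_Integration.integral_cnj[symmetric] by (simp add: cis_cnj)
  then have "(norm (fourier frac_exp (- t)))\<^sup>2 = (norm (fourier frac_exp t))\<^sup>2" by simp
  then show ?thesis unfolding norm_fourier_frac_exp zeta_dens_def .
qed

lemma mean_tendsto_0:
  fixes f :: "real \<Rightarrow> real"
  assumes f: "continuous_on {1..} f" and lim: "(f \<longlongrightarrow> 0) at_top"
  shows "((\<lambda>T. integral {1..T} f / T) \<longlongrightarrow> 0) at_top"
proof (rule lhospital_at_top_at_top)
  show "filterlim (\<lambda>T::real. T) at_top at_top" by (rule filterlim_ident)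
  show "\<forall>\<^sub>F T in at_top. ((\<lambda>T. integral {1..T} f) has_real_derivative f T) (at T)"
    using eventually_gt_at_top[of 1]
  proof eventually_elim
    case (elim T)
    have "((\<lambda>T. integral {1..T} f) has_real_derivative f T) (at T within {1..T + 1})"
      using elim by (intro integral_has_real_derivative continuous_on_subset[OF f]) auto
    moreover have "at T within {1..T + 1} = at T" using elim by (intro at_within_interior) auto
    ultimately show ?case by simp
  qed
  show "\<forall>\<^sub>F T in at_top. ((\<lambda>T::real. T) has_real_derivative 1) (at T)" by auto
qed (use lim in auto)

text \<open>Partial summation against the difference \<open>D\<close> of the tails. The model
  contributes the main terms explicitly, and the limit found is \<open>b = a - 1\<close>.\<close>

lemma zeta_sq_mean:
  obtains b where "((\<lambda>T. integral {0..T} zeta_sq / T - ln T) \<longlongrightarrow> b) at_top"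
proof -
  obtain a where a: "((\<lambda>T. T * (tail_mass zeta_dens T - tail_mass (model_dens a) T)) \<longlongrightarrow> 0) at_top"
    by (rule tail_excess_tendsto_0)
  define r where "r t = zeta_dens t - model_dens a t" for t
  define D where "D T = tail_mass zeta_dens T - tail_mass (model_dens a) T" for T
  have r_int: "integrable lborel r"
    unfolding r_def[abs_def] by (intro Bochner_Integration.integrable_diff integrable_zeta_dens integrable_model_dens)
  have r_even: "r (- t) = r t" for t by (simp add: r_def zeta_dens_even model_dens_even)
  have r_cont: "continuous_on {1..} r"
  proof -
    have "continuous_on {1..} zeta_dens"
      unfolding zeta_dens_def[abs_def]
      by (intro continuous_intros continuous_on_zeta_sq) (auto simp: add_nonneg_eq_0_iff)
    moreover have "continuous_on {1..} (\<lambda>t. (ln t + a) / t\<^sup>2)" by (intro continuous_intros) auto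
    ultimately have "continuous_on {1..} (\<lambda>t. zeta_dens t - (ln t + a) / t\<^sup>2)" by (rule continuous_on_diff)
    then show ?thesis by (rule continuous_on_eq) (auto simp: r_def model_dens_def)
  qed
  \<comment> \<open>The tails are two-sided and \<open>r\<close> is even, hence the factor
    2.\<close>
  have D: "D T = D 1 - 2 * integral {1..T} r" if T: "T \<ge> 1" for T
  proof -
    have i: "integrable lborel (\<lambda>t. indicator {t. S < \<bar>t\<bar>} t * r t)" for S
      using r_int by (rule integrable_indicator_mult) measurable
    have D_eq: "D S = (LINT t|lborel. indicator {t. S < \<bar>t\<bar>} t * r t)" for S
    proof -
      have "integrable lborel (\<lambda>t. indicator {t. S < \<bar>t\<bar>} t * zeta_dens t)"
        "integrable lborel (\<lambda>t. indicator {t. S < \<bar>t\<bar>} t * model_dens a t)"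
        by (rule integrable_indicator_mult[OF integrable_zeta_dens], measurable)
           (rule integrable_indicator_mult[OF integrable_model_dens], measurable)
      from Bochner_Integration.integral_diff[OF this] show ?thesis
        by (simp add: D_def tail_mass_def r_def right_diff_distrib)
    qed
    have "D 1 - D T = (LINT t|lborel. indicator {t. 1 < \<bar>t\<bar>} t * r t - indicator {t. T < \<bar>t\<bar>} t * r t)"
      unfolding D_eq by (rule Bochner_Integration.integral_diff[OF i i, symmetric])
    also have "\<dots> = 2 * (LINT t:{0<..}|lborel. indicator {t. 1 < \<bar>t\<bar>} t * r t - indicator {t. T < \<bar>t\<bar>} t * r t)"
    proof (rule even_integral(2))
      show "set_integrable lborel {0<..} (\<lambda>t. indicator {t. 1 < \<bar>t\<bar>} t * r t - indicator {t. T < \<bar>t\<bar>} t * r t)"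
        unfolding set_integrable_def by (intro integrable_mult_indicator Bochner_Integration.integrable_diff i) auto
      show "(\<lambda>t. indicator {t. 1 < \<bar>t\<bar>} t * r t - indicator {t. T < \<bar>t\<bar>} t * r t) \<in> borel_measurable borel"
        using i[of 1] i[of T] by auto
    qed (simp add: r_even indicator_def)
    also have "(LINT t:{0<..}|lborel. indicator {t. 1 < \<bar>t\<bar>} t * r t - indicator {t. T < \<bar>t\<bar>} t * r t) = (LINT t:{1<..T}|lborel. r t)"
      unfolding set_lebesgue_integral_def using T
      by (intro Bochner_Integration.integral_cong refl) (auto simp: indicator_def)
    also have "\<dots> = integral {1<..T} r"
      by (rule set_borel_integral_eq_integral(2)) (use integrable_mult_indicator[OF _ r_int, of "{1<..T}"] in \<open>simp add: set_integrable_def\<close>)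
    also have "\<dots> = integral {1..T} r"
      by (rule integral_spike_set) (auto intro: negligible_subset[of "{1}"])
    finally show ?thesis by simp
  qed
  have D_deriv: "(D has_real_derivative (- 2 * r T)) (at T within {1..U})" if "T \<in> {1..U}" for T U
  proof -
    have "((\<lambda>T. D 1 - 2 * integral {1..T} r) has_real_derivative (- 2 * r T)) (at T within {1..U})"
      using that by (auto intro!: derivative_eq_intros integral_has_real_derivative continuous_on_subset[OF r_cont])
    then show ?thesis
    proof (rule has_field_derivative_transform_within[where d = 1])
      show "D 1 - 2 * integral {1..T'} r = D T'" if "T' \<in> {1..U}" for T'
        using D[of T'] that by simp
    qed (use that in auto)
  qed
  have D_cont: "continuous_on {1..} D"
    unfolding continuous_on_eq_continuous_within
  proof
    fix T :: real assume T: "T \<in> {1..}"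
    have "continuous (at T within {1..T + 1}) D"
      using T by (intro DERIV_continuous[OF D_deriv]) simp
    moreover have "at T within {1..T + 1} = at T within {1..}"
      by (rule at_within_nhd[of _ "{..<T + 1}"]) (use T in auto)
    ultimately show "continuous (at T within {1..}) D" by simp
  qed
  \<comment> \<open>Found by integrating \<open>(1/4 + x\<^sup>2) * r x\<close> by parts with
    \<open>D' = - 2 * r\<close>; both terms are \<open>o(T)\<close> because \<open>T * D T\<close>
    tends to 0.\<close>
  define F where "F T = integral {1..T} (\<lambda>s. s * D s) - (1/4 + T\<^sup>2) * D T / 2" for T
  have F: "integral {1..T} (\<lambda>t. (1/4 + t\<^sup>2) * r t) = F T - F 1" if T: "T \<ge> 1" for T
  proof (rule integral_unique, rule fundamental_theorem_of_calculus[OF T])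
    fix x assume x: "x \<in> {1..T}"
    have "((\<lambda>x. integral {1..x} (\<lambda>s. s * D s)) has_real_derivative x * D x) (at x within {1..T})"
      by (intro integral_has_real_derivative continuous_intros continuous_on_subset[OF D_cont] x) auto
    then have "(F has_real_derivative (1/4 + x\<^sup>2) * r x) (at x within {1..T})"
      unfolding F_def[abs_def] using x
      by (auto intro!: derivative_eq_intros D_deriv simp: field_simps power2_eq_square)
    then show "(F has_vector_derivative (1/4 + x\<^sup>2) * r x) (at x within {1..T})"
      by (simp add: has_real_derivative_iff_has_vector_derivative)
  qed
  \<comment> \<open>Antiderivative of \<open>(1/4 + t\<^sup>2) * ((ln t + a) / t\<^sup>2)\<close>;
    its part \<open>t * ln t + (a - 1) * t\<close> gives the main terms of the mean square.\<close>
  define A where "A t = t * ln t - t + a * t - (ln t + 1 + a) / (4 * t)" for t :: real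
  have A: "integral {1..T} (\<lambda>t. (1/4 + t\<^sup>2) * model_dens a t) = A T - A 1" if T: "T \<ge> 1" for T
  proof (rule integral_unique, rule fundamental_theorem_of_calculus[OF T])
    fix x assume x: "x \<in> {1..T}"
    then have "(A has_real_derivative (1/4 + x\<^sup>2) * ((ln x + a) / x\<^sup>2)) (at x within {1..T})"
      unfolding A_def[abs_def]
      by (auto intro!: derivative_eq_intros simp: field_simps power2_eq_square)
    moreover have "model_dens a x = (ln x + a) / x\<^sup>2" using x by (simp add: model_dens_def)
    ultimately show "(A has_vector_derivative (1/4 + x\<^sup>2) * model_dens a x) (at x within {1..T})"
      by (simp add: has_real_derivative_iff_has_vector_derivative)
  qed
  have I: "integral {0..T} zeta_sq = integral {0..1} zeta_sq + (F T - F 1) + (A T - A 1)" if T: "T \<ge> 1" for T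
  proof -
    have "integral {0..T} zeta_sq = integral {0..1} zeta_sq + integral {1..T} zeta_sq"
      using T by (intro Henstock_Kurzweil_Integration.integral_combine[symmetric] integrable_continuous_real continuous_on_zeta_sq) auto
    also have "integral {1..T} zeta_sq = integral {1..T} (\<lambda>t. (1/4 + t\<^sup>2) * r t + (1/4 + t\<^sup>2) * model_dens a t)"
    proof (rule Henstock_Kurzweil_Integration.integral_cong)
      fix t :: real
      have "1/4 + t\<^sup>2 > 0" by (simp add: add_pos_nonneg)
      then have "zeta_sq t = (1/4 + t\<^sup>2) * zeta_dens t" by (simp add: zeta_dens_def)
      then show "zeta_sq t = (1/4 + t\<^sup>2) * r t + (1/4 + t\<^sup>2) * model_dens a t"
        by (simp add: r_def flip: distrib_left)
    qed
    also have "\<dots> = (F T - F 1) + (A T - A 1)"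
    proof -
      have "continuous_on {1..T} (\<lambda>t. (1/4 + t\<^sup>2) * ((ln t + a) / t\<^sup>2))" by (intro continuous_intros) auto
      then have "continuous_on {1..T} (\<lambda>t. (1/4 + t\<^sup>2) * model_dens a t)"
        by (rule continuous_on_eq) (auto simp: model_dens_def)
      moreover have "continuous_on {1..T} (\<lambda>t. (1/4 + t\<^sup>2) * r t)"
        by (intro continuous_intros continuous_on_subset[OF r_cont]) auto
      ultimately show ?thesis
        using F[OF T] A[OF T] by (subst Henstock_Kurzweil_Integration.integral_add) (auto intro: integrable_continuous_real)
    qed
    finally show ?thesis by simp
  qed
  have TD: "((\<lambda>T. T * D T) \<longlongrightarrow> 0) at_top" using a by (simp add: D_def)
  have "((\<lambda>T. integral {1..T} (\<lambda>s. s * D s) / T) \<longlongrightarrow> 0) at_top"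
    by (intro mean_tendsto_0 TD continuous_intros D_cont)
  moreover have "((\<lambda>T. (1 / (8 * T\<^sup>2) + 1 / 2) * (T * D T)) \<longlongrightarrow> (0 + 1 / 2) * 0) at_top"
    by (intro tendsto_intros TD) real_asymp
  ultimately have "((\<lambda>T. integral {1..T} (\<lambda>s. s * D s) / T - (1 / (8 * T\<^sup>2) + 1 / 2) * (T * D T)) \<longlongrightarrow> 0 - (0 + 1 / 2) * 0) at_top"
    by (rule tendsto_diff)
  moreover have "\<forall>\<^sub>F T in at_top. integral {1..T} (\<lambda>s. s * D s) / T - (1 / (8 * T\<^sup>2) + 1 / 2) * (T * D T) = F T / T"
    using eventually_gt_at_top[of 0] by eventually_elim (simp add: F_def field_simps power2_eq_square)
  ultimately have "((\<lambda>T. F T / T) \<longlongrightarrow> 0 - (0 + 1 / 2) * 0) at_top"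
    by (rule Lim_transform_eventually)
  then have F_lim: "((\<lambda>T. F T / T) \<longlongrightarrow> 0) at_top" by simp
  have A_lim: "((\<lambda>T. A T / T - ln T) \<longlongrightarrow> a - 1) at_top"
    unfolding A_def by real_asymp
  define k where "k = integral {0..1} zeta_sq - F 1 - A 1"
  have "((\<lambda>T. k / T) \<longlongrightarrow> 0) at_top"
    by (intro tendsto_divide_0[OF tendsto_const] filterlim_at_top_imp_at_infinity filterlim_ident)
  with F_lim A_lim have "((\<lambda>T. F T / T + (A T / T - ln T) + k / T) \<longlongrightarrow> 0 + (a - 1) + 0) at_top"
    by (intro tendsto_add)
  moreover have "\<forall>\<^sub>F T in at_top. F T / T + (A T / T - ln T) + k / T = integral {0..T} zeta_sq / T - ln T"
    using eventually_ge_at_top[of 1] 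
  proof eventually_elim
    case (elim T)
    show ?case unfolding I[OF elim] k_def by (simp add: add_divide_distrib diff_divide_distrib)
  qed
  ultimately have "((\<lambda>T. integral {0..T} zeta_sq / T - ln T) \<longlongrightarrow> 0 + (a - 1) + 0) at_top"
    by (rule Lim_transform_eventually)
  then show ?thesis by (rule that)
qed

subsection \<open>Abelian means and Jacob's ladder\<close>

lemma one_plus_square_exp_le:
  fixes s :: real
  assumes "s \<ge> 0"
  shows "(1 + s\<^sup>2) * exp (- s) \<le> 9 * exp (- (s * (1/2)))"
proof -
  have "s\<^sup>2 \<le> 8 * exp (s / 2)"
    using exp_lower_Taylor_quadratic[of "s / 2"] assms by (simp add: power2_eq_square)
  moreover have "1 \<le> exp (s / 2)" using assms by simp
  ultimately have "1 + s\<^sup>2 \<le> 9 * exp (s / 2)" by linarith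
  then have "(1 + s\<^sup>2) * exp (- s) \<le> (9 * exp (s / 2)) * exp (- s)" by (intro mult_right_mono) auto
  also have "\<dots> = 9 * exp (- (s * (1/2)))" by (simp add: mult.assoc flip: exp_add)
  finally show ?thesis .
qed

lemma laplace_majorant_integrable: "integrable lborel (\<lambda>s::real. indicator {0<..} s * ((1 + s\<^sup>2) * exp (- s)))"
proof (rule Bochner_Integration.integrable_bound[of _ "\<lambda>s. 9 * (indicator {0<..} s * exp (- (s * (1/2))))"])
  show "integrable lborel (\<lambda>s::real. 9 * (indicator {0<..} s * exp (- (s * (1/2)))))"
    using integrable_I0i_exp_mscale[of "1/2"] by (intro integrable_mult_right) (simp add: set_integrable_def)
  show "AE s in lborel. norm (indicator {0<..} s * ((1 + s\<^sup>2) * exp (- s))) \<le> norm (9 * (indicator {0<..} s * exp (- (s * (1/2)))) :: real)"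
    using one_plus_square_exp_le by (auto simp: indicator_def abs_mult)
qed measurable

lemma Gamma_lborel_integral:
  fixes x :: real
  assumes x: "x > 1"
  shows "has_bochner_integral lborel (\<lambda>s. indicator {0<..} s * (s powr (x - 1) * exp (- s))) (Gamma x)"
proof -
  have eq: "indicator {0..} s * s powr (x - 1) / exp s = indicator {0<..} s * (s powr (x - 1) * exp (- s))" for s
    using x by (auto simp: indicator_def exp_minus field_simps)
  have "(\<integral>\<^sup>+s. ennreal (indicator {0<..} s * (s powr (x - 1) * exp (- s))) \<partial>lborel) = ennreal (Gamma x)"
    using Gamma_conv_nn_integral_real[of x] x by (simp add: eq)
  then show ?thesis
    using x Gamma_real_pos[of x] by (intro has_bochner_integral_nn_integral) auto
qed

text \<open>This is the derivative of Gamma at 2, that is \<open>Gamma 2 * Digamma 2\<close>.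
  Differentiation under the integral is carried out with difference quotients along
  \<open>h n = 1 / (n + 1)\<close> and dominated convergence.\<close>

lemma ln_exp_integral:
  "(LINT s|lborel. indicator {0<..} s * (s * ln s * exp (- s))) = 1 - (euler_mascheroni :: real)"
proof -
  define h where "h n = 1 / real (n + 1)" for n
  have h: "0 < h n" "h n \<le> 1" for n by (auto simp: h_def)
  have h0: "h \<longlonglongrightarrow> 0" unfolding h_def[abs_def] by real_asymp
  define g where "g n s = indicator {0<..} s * (s * ((s powr h n - 1) / h n) * exp (- s))" for n s
  have "(LINT s|lborel. g n s) = (Gamma (2 + h n) - Gamma 2) / h n" for n
  proof -
    have "has_bochner_integral lborel (\<lambda>s. (indicator {0<..} s * (s powr ((2 + h n) - 1) * exp (- s)) -
        indicator {0<..} s * (s powr (2 - 1) * exp (- s))) / h n) ((Gamma (2 + h n) - Gamma 2) / h n)"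
      using h[of n] by (intro has_bochner_integral_divide_zero has_bochner_integral_diff Gamma_lborel_integral) auto
    moreover have "(\<lambda>s. (indicator {0<..} s * (s powr ((2 + h n) - 1) * exp (- s)) -
        indicator {0<..} s * (s powr (2 - 1) * exp (- s))) / h n) = g n"
      by (auto simp: g_def indicator_def powr_add algebra_simps diff_divide_distrib)
    ultimately have "has_bochner_integral lborel (g n) ((Gamma (2 + h n) - Gamma 2) / h n)" by (simp only:)
    then show ?thesis by (rule has_bochner_integral_integral_eq)
  qed
  moreover have "(\<lambda>n. (Gamma (2 + h n) - Gamma 2) / h n) \<longlonglongrightarrow> 1 - euler_mascheroni"
  proof -
    have "(Gamma has_field_derivative Gamma 2 * Digamma (2::real)) (at 2)"
      by (rule has_field_derivative_Gamma) (auto elim!: nonpos_Ints_cases)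
    then have "((\<lambda>h. (Gamma (2 + h) - Gamma 2) / h) \<longlongrightarrow> Gamma 2 * Digamma (2::real)) (at 0)"
      by (simp add: DERIV_def)
    moreover have "filterlim h (at 0) sequentially"
      unfolding filterlim_at using h(1) h0 by (auto intro!: always_eventually simp: less_imp_neq[symmetric])
    ultimately have "(\<lambda>n. (Gamma (2 + h n) - Gamma 2) / h n) \<longlonglongrightarrow> Gamma 2 * Digamma (2::real)"
      by (rule filterlim_compose)
    also have "Gamma 2 * Digamma (2::real) = 1 - euler_mascheroni"
      using Digamma_plus1[of "1::real"] Gamma_numeral[of "num.Bit0 num.One", where 'a = real] by simp
    finally show ?thesis .
  qed
  ultimately have lim: "(\<lambda>n. LINT s|lborel. g n s) \<longlonglongrightarrow> 1 - euler_mascheroni" by simp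
  have "(\<lambda>n. LINT s|lborel. g n s) \<longlonglongrightarrow> (LINT s|lborel. indicator {0<..} s * (s * ln s * exp (- s)))"
  proof (rule integral_dominated_convergence[OF _ _ laplace_majorant_integrable])
    show "AE s in lborel. (\<lambda>n. g n s) \<longlonglongrightarrow> indicator {0<..} s * (s * ln s * exp (- s))"
    proof (rule AE_I2)
      fix s :: real
      show "(\<lambda>n. g n s) \<longlonglongrightarrow> indicator {0<..} s * (s * ln s * exp (- s))"
      proof (cases "s > 0")
        case True
        have "((\<lambda>h. s powr h) has_real_derivative ln s) (at 0)"
          using True by (auto intro!: derivative_eq_intros)
        then have "((\<lambda>h. (s powr h - 1) / h) \<longlongrightarrow> ln s) (at 0)"
          using True by (simp add: DERIV_def)
        moreover have "filterlim h (at 0) sequentially"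
          unfolding filterlim_at using h(1) h0 by (auto intro!: always_eventually simp: less_imp_neq[symmetric])
        ultimately have "(\<lambda>n. (s powr h n - 1) / h n) \<longlonglongrightarrow> ln s" by (rule filterlim_compose)
        then show ?thesis unfolding g_def by (intro tendsto_intros)
      qed (simp add: g_def)
    qed
    show "AE s in lborel. norm (g n s) \<le> indicator {0<..} s * ((1 + s\<^sup>2) * exp (- s))" for n
    proof (rule AE_I2)
      fix s :: real
      \<comment> \<open>For \<open>s \<ge> 1\<close> Young's inequality gives
        \<open>0 \<le> w \<le> s - 1\<close>; for \<open>s < 1\<close> the bound
        \<open>exp x \<ge> 1 + x\<close> gives \<open>ln s \<le> w \<le> 0\<close>, and
        \<open>- ln s \<le> 1 / s\<close>. The majorant is thus independent of
        \<open>n\<close>.\<close>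
      define w where "w = (s powr h n - 1) / h n"
      have hw: "s powr h n = 1 + h n * w" using h[of n] by (simp add: w_def)
      have "\<bar>s * w\<bar> \<le> 1 + s\<^sup>2" if s: "s > 0"
      proof (cases "s \<ge> 1")
        case True
        have "s powr h n \<le> 1 + h n * (s - 1)"
          using Youngs_inequality_0[of "h n" "1 - h n" s 1] h[of n] True by (simp add: algebra_simps)
        then have "w \<le> s - 1" using h[of n] by (simp add: hw)
        moreover have "1 \<le> s powr h n" using True h[of n] by (intro ge_one_powr_ge_zero) auto
        then have "w \<ge> 0" using h[of n] by (simp add: hw zero_le_mult_iff)
        ultimately have "s * w \<le> s * s" "s * w \<ge> 0" using s by (auto intro!: mult_left_mono)
        then show ?thesis by (simp add: power2_eq_square)
      next
        case False
        have "1 + h n * ln s \<le> s powr h n"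
          using s exp_ge_add_one_self[of "h n * ln s"] by (simp add: powr_def)
        then have "ln s \<le> w" using h[of n] by (simp add: hw)
        moreover have "- ln s \<le> 1 / s"
          using ln_le_minus_one[of "1 / s"] s by (simp add: ln_div)
        moreover have "s powr h n \<le> 1" using False s h[of n] by (intro powr_le1) auto
        then have "w \<le> 0" using h[of n] by (simp add: hw mult_le_0_iff)
        ultimately have "\<bar>w\<bar> \<le> 1 / s" by linarith
        then have "s * \<bar>w\<bar> \<le> s * (1 / s)" using s by (intro mult_left_mono) auto
        then have "\<bar>s * w\<bar> \<le> 1" using s by (simp add: abs_mult)
        then show ?thesis using zero_le_power2[of s] by linarith
      qed
      then show "norm (g n s) \<le> indicator {0<..} s * ((1 + s\<^sup>2) * exp (- s))"
        by (auto simp: g_def w_def[symmetric] indicator_def abs_mult[of _ "exp (- s)"] intro!: mult_right_mono)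
    qed
  qed (simp_all add: g_def)
  from LIMSEQ_unique[OF this lim] show ?thesis .
qed

section \<open>Laplace means of \<open>zeta_sq\<close>\<close>

definition zeta_int :: "real \<Rightarrow> real" where
  "zeta_int T = integral {0..T} zeta_sq"

lemma zeta_sq_nonneg: "zeta_sq t \<ge> 0"
  by (simp add: zeta_sq_def)

lemma zeta_sq_integrable_on: "zeta_sq integrable_on {a..b}"
  by (intro integrable_continuous_real continuous_on_zeta_sq)

lemma zeta_int_deriv:
  assumes "x \<in> {0..B}"
  shows "(zeta_int has_real_derivative zeta_sq x) (at x within {0..B})"
  unfolding zeta_int_def[abs_def]
  by (intro integral_has_real_derivative continuous_on_zeta_sq assms)

lemma zeta_int_mono:
  assumes "S \<le> T"
  shows "zeta_int S \<le> zeta_int T"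
  unfolding zeta_int_def using assms
  by (intro integral_subset_le zeta_sq_integrable_on) (auto simp: zeta_sq_nonneg)

lemma continuous_on_zeta_int: "continuous_on {0..B} zeta_int"
  by (rule DERIV_continuous_on[OF zeta_int_deriv])

lemma zeta_int_measurable [measurable]: "zeta_int \<in> borel_measurable borel"
  by (rule borel_measurable_mono) (simp add: mono_def zeta_int_mono)

lemma zeta_int_diff:
  assumes "0 \<le> S" "S \<le> T"
  shows "integral {S..T} zeta_sq = zeta_int T - zeta_int S"
  using Henstock_Kurzweil_Integration.integral_combine[OF assms zeta_sq_integrable_on] by (simp add: zeta_int_def)

text \<open>Integration by parts moves the integral onto \<open>zeta_int\<close>, whose asymptotics
  are known, and \<open>t = U * s\<close> removes \<open>U\<close> from the exponential.\<close>

lemma zeta_laplace_by_parts: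
  assumes U: "U > 0" and m: "m \<ge> 0"
  shows "integral {0..U * m} (\<lambda>t. zeta_sq t * exp (- t / U)) =
    zeta_int (U * m) * exp (- m) + (LINT s|lborel. indicator {0<..m} s * (zeta_int (U * s) * exp (- s)))"
proof -
  let ?M = "U * m"
  have M: "?M \<ge> 0" using U m by simp
  have c1: "continuous_on {0..?M} (\<lambda>t. zeta_sq t * exp (- t / U))"
    using U by (intro continuous_intros continuous_on_zeta_sq) auto
  have c2: "continuous_on {0..?M} (\<lambda>t. zeta_int t * exp (- t / U))"
    using U by (intro continuous_intros continuous_on_zeta_int) auto
  have "((\<lambda>t. zeta_sq t * exp (- t / U) - (zeta_int t * exp (- t / U)) / U) has_integral
      (zeta_int ?M * exp (- ?M / U) - zeta_int 0 * exp (- 0 / U))) {0..?M}"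
  proof (rule fundamental_theorem_of_calculus[OF M])
    fix x assume x: "x \<in> {0..?M}"
    have "((\<lambda>t. zeta_int t * exp (- t / U)) has_real_derivative
        (zeta_sq x * exp (- x / U) - (zeta_int x * exp (- x / U)) / U)) (at x within {0..?M})"
      using U by (auto intro!: derivative_eq_intros zeta_int_deriv[OF x])
    then show "((\<lambda>t. zeta_int t * exp (- t / U)) has_vector_derivative
        (zeta_sq x * exp (- x / U) - (zeta_int x * exp (- x / U)) / U)) (at x within {0..?M})"
      by (simp add: has_real_derivative_iff_has_vector_derivative)
  qed
  then have "integral {0..?M} (\<lambda>t. zeta_sq t * exp (- t / U) - (zeta_int t * exp (- t / U)) / U) = zeta_int ?M * exp (- m)"
    using U by (simp add: integral_unique zeta_int_def)
  moreover have "integral {0..?M} (\<lambda>t. zeta_sq t * exp (- t / U) - (zeta_int t * exp (- t / U)) / U) =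
     integral {0..?M} (\<lambda>t. zeta_sq t * exp (- t / U)) - integral {0..?M} (\<lambda>t. zeta_int t * exp (- t / U)) / U"
    using integrable_continuous_real[OF c1] integrable_on_divide[OF integrable_continuous_real[OF c2], of U]
    by (subst Henstock_Kurzweil_Integration.integral_diff) simp_all
  moreover have "integral {0..?M} (\<lambda>t. zeta_int t * exp (- t / U)) =
     U * (LINT s|lborel. indicator {0<..m} s * (zeta_int (U * s) * exp (- s)))"
  proof -
    have "integral {0..?M} (\<lambda>t. zeta_int t * exp (- t / U)) = (LINT t:{0..?M}|lborel. zeta_int t * exp (- t / U))"
      by (intro set_borel_integral_eq_integral(2)[symmetric] borel_integrable_atLeastAtMost' c2)
    also have "\<dots> = \<bar>U\<bar> *\<^sub>R (LINT s|lborel. indicator {0..?M} (0 + U * s) *\<^sub>R (zeta_int (0 + U * s) * exp (- (0 + U * s) / U)))"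
      unfolding set_lebesgue_integral_def using U by (intro lborel_integral_real_affine) simp
    also have "(LINT s|lborel. indicator {0..?M} (0 + U * s) *\<^sub>R (zeta_int (0 + U * s) * exp (- (0 + U * s) / U))) =
        (LINT s|lborel. indicator {0<..m} s * (zeta_int (U * s) * exp (- s)))"
    proof (rule integral_cong_AE)
      show "AE s in lborel. indicator {0..?M} (0 + U * s) *\<^sub>R (zeta_int (0 + U * s) * exp (- (0 + U * s) / U)) =
          indicator {0<..m} s * (zeta_int (U * s) * exp (- s))"
        using AE_lborel_singleton[of "0::real"]
        by eventually_elim (use U in \<open>auto simp: indicator_def zero_le_mult_iff mult_le_cancel_left\<close>)
    qed measurable
    finally show ?thesis using U by simp
  qed
  ultimately show ?thesis using U by simp
qed

text \<open>Both facts concern the same \<open>b\<close>: the limit gives pointwise convergence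
  after scaling, while the bound for all \<open>t > 0\<close> serves domination, since
  \<open>U * s\<close> is small near \<open>s = 0\<close> however large \<open>U\<close> is.\<close>

lemma zeta_int_approx:
  "\<exists>b C. C \<ge> 0 \<and> (\<forall>t>0. \<bar>zeta_int t - t * ln t - b * t\<bar> \<le> C * (1 + t)) \<and>
     ((\<lambda>t. zeta_int t / t - ln t) \<longlongrightarrow> b) at_top"
proof -
  obtain b where b: "((\<lambda>T. zeta_int T / T - ln T) \<longlongrightarrow> b) at_top"
    unfolding zeta_int_def by (rule zeta_sq_mean)
  have "\<forall>\<^sub>F T in at_top. \<bar>zeta_int T / T - ln T - b\<bar> < 1"
    using b by (auto simp: tendsto_iff dist_real_def)
  then obtain N where N: "\<And>T. T \<ge> N \<Longrightarrow> \<bar>zeta_int T / T - ln T - b\<bar> < 1"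
    by (auto simp: eventually_at_top_linorder)
  define N' where "N' = max N 1"
  \<comment> \<open>The summand 1 covers \<open>t \<ge> N'\<close>; the others bound the three terms
    of the error on \<open>0 < t < N'\<close>.\<close>
  define C where "C = 1 + zeta_int N' + N'\<^sup>2 + \<bar>b\<bar> * N'"
  have z0: "zeta_int N' \<ge> 0" unfolding zeta_int_def by (intro Henstock_Kurzweil_Integration.integral_nonneg zeta_sq_integrable_on) (auto simp: zeta_sq_nonneg)
  have N': "N' \<ge> 1" by (simp add: N'_def)
  have C: "C \<ge> 1" using z0 N' by (simp add: C_def)
  have "\<bar>zeta_int t - t * ln t - b * t\<bar> \<le> C * (1 + t)" if t: "t > 0" for t
  proof (cases "t \<ge> N'")
    case True
    then have "\<bar>zeta_int t / t - ln t - b\<bar> \<le> C" using N[of t] C by (simp add: N'_def)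
    then have "t * \<bar>zeta_int t / t - ln t - b\<bar> \<le> t * C" using t by (intro mult_left_mono) auto
    also have "t * \<bar>zeta_int t / t - ln t - b\<bar> = \<bar>zeta_int t - t * ln t - b * t\<bar>"
      using t by (simp add: abs_mult[of t, symmetric, unfolded abs_of_pos[OF t]] right_diff_distrib mult.commute)
    finally show ?thesis using C by (simp add: algebra_simps)
  next
    case False
    have "\<bar>t * ln t\<bar> \<le> N'\<^sup>2"
    proof (cases "t \<ge> 1")
      case True
      have "t * ln t \<le> N' * N'" using False True t ln_le_minus_one[OF t] by (intro mult_mono) auto
      then show ?thesis using True by (simp add: power2_eq_square)
    next
      case f: False
      have "- ln t \<le> 1 / t" using ln_le_minus_one[of "1 / t"] t by (simp add: ln_div)
      then have "t * (- ln t) \<le> t * (1 / t)" using t by (intro mult_left_mono) auto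
      moreover have "ln t < 0" using f t by simp
      ultimately have "\<bar>t * ln t\<bar> \<le> 1" using t by (simp add: abs_mult)
      also have "1 \<le> N'\<^sup>2" using N' by simp
      finally show ?thesis .
    qed
    moreover have "0 \<le> zeta_int t" "zeta_int t \<le> zeta_int N'"
      using False zeta_int_mono[of t N'] zeta_int_mono[of 0 t] t by (auto simp: zeta_int_def)
    moreover have "\<bar>b * t\<bar> \<le> \<bar>b\<bar> * N'" using False t by (auto simp: abs_mult intro!: mult_left_mono)
    ultimately have "\<bar>zeta_int t - t * ln t - b * t\<bar> \<le> C" unfolding C_def by linarith
    also have "C \<le> C * (1 + t)" using C t by simp
    finally show ?thesis .
  qed
  with C b show ?thesis by (intro exI[of _ b] exI[of _ C]) auto
qed

lemma linear_exp_integral: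
  assumes "m \<ge> 0"
  shows "integrable lborel (\<lambda>s. indicator {0<..m} s * (s * exp (- s)) :: real)"
    and "(LINT s|lborel. indicator {0<..m} s * (s * exp (- s))) = 1 - (1 + m) * exp (- m)"
proof -
  have set: "set_integrable lborel {0..m} (\<lambda>s. s * exp (- s) :: real)"
    by (intro borel_integrable_atLeastAtMost' continuous_intros)
  have eq: "indicator {0..m} s *\<^sub>R (s * exp (- s)) = indicator {0<..m} s * (s * exp (- s))" for s :: real
    by (auto simp: indicator_def)
  show "integrable lborel (\<lambda>s. indicator {0<..m} s * (s * exp (- s)) :: real)"
    using set unfolding set_integrable_def eq .
  have "((\<lambda>s. s * exp (- s)) has_integral (- (1 + m) * exp (- m) - (- (1 + 0) * exp (- 0)))) {0..m}"
    using assms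
    by (intro fundamental_theorem_of_calculus)
       (auto intro!: derivative_eq_intros simp: algebra_simps simp flip: has_real_derivative_iff_has_vector_derivative)
  then have "(LINT s:{0..m}|lborel. s * exp (- s)) = 1 - (1 + m) * exp (- m)"
    using set_borel_integral_eq_integral(2)[OF set] by (simp add: integral_unique algebra_simps)
  then show "(LINT s|lborel. indicator {0<..m} s * (s * exp (- s))) = 1 - (1 + m) * exp (- m)"
    unfolding set_lebesgue_integral_def eq .
qed

lemma one_plus_le_square: "1 + x \<le> 2 * (1 + x\<^sup>2)" for x :: real
proof -
  have "0 \<le> (x - 1)\<^sup>2" by simp
  then have "2 * x \<le> x\<^sup>2 + 1" by (simp add: power2_diff)
  moreover have "0 \<le> x\<^sup>2" by simp
  ultimately have "1 + x \<le> 2 + 2 * x\<^sup>2" by linarith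
  then show ?thesis by simp
qed

text \<open>After \<open>t = U * s\<close>, the factor \<open>zeta_int (U * s) / U\<close> is close
  to \<open>s * (ln U + b) + s * ln s\<close>. Against \<open>exp (- s)\<close> the first part
  integrates to \<open>ln U + b\<close>, which \<open>zeta_int U / U\<close> cancels; the second
  gives the constant. The growth of \<open>m\<close> makes truncation at \<open>m U\<close>
  harmless.\<close>

lemma zeta_laplace_asymp:
  fixes m :: "real \<Rightarrow> real"
  assumes m: "\<forall>\<^sub>F U in at_top. m U \<ge> 14 * ln (2 * U)"
  shows "((\<lambda>U. (integral {0..U * m U} (\<lambda>t. zeta_sq t * exp (- t / U)) - zeta_int U) / U) \<longlongrightarrow> 1 - euler_mascheroni) at_top"
proof -
  obtain b C where bC: "C \<ge> 0 \<and> (\<forall>t>0. \<bar>zeta_int t - t * ln t - b * t\<bar> \<le> C * (1 + t)) \<and>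
      ((\<lambda>t. zeta_int t / t - ln t) \<longlongrightarrow> b) at_top"
    using zeta_int_approx by (elim exE)
  then have C: "C \<ge> 0" "\<And>t. t > 0 \<Longrightarrow> \<bar>zeta_int t - t * ln t - b * t\<bar> \<le> C * (1 + t)"
    and b: "((\<lambda>t. zeta_int t / t - ln t) \<longlongrightarrow> b) at_top"
    by auto
  \<comment> \<open>The scaled integrand with \<open>s * (ln U + b)\<close> removed from its first
    factor; its limit is \<open>s * ln s * exp (- s)\<close> on the positive half-line.\<close>
  define k where "k U s = indicator {0<..m U} s * ((zeta_int (U * s) / U - s * ln U - s * b) * exp (- s))" for U s
  have m_top: "filterlim m at_top at_top"
  proof (rule filterlim_at_top_mono[OF _ m])
    show "filterlim (\<lambda>U::real. 14 * ln (2 * U)) at_top at_top" by real_asymp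
  qed
  have pos: "\<forall>\<^sub>F U in at_top. U \<ge> (1::real) \<and> m U \<ge> 0 \<and> m U \<ge> 14 * ln (2 * U)"
    using m eventually_ge_at_top[of 1] m_top[unfolded filterlim_at_top, rule_format, of 0] by eventually_elim auto
  have k_bound: "\<bar>k U s\<bar> \<le> (2 + 2 * C) * (indicator {0<..} s * ((1 + s\<^sup>2) * exp (- s)))" if U: "U \<ge> 1" for U s
  proof (cases "s > 0")
    case True
    have "\<bar>zeta_int (U * s) / U - s * ln U - s * b\<bar> \<le> (2 + 2 * C) * (1 + s\<^sup>2)"
    proof -
      have Us: "U * s > 0" using U True by simp
      have eq: "zeta_int (U * s) / U - s * ln U - s * b = (zeta_int (U * s) - U * s * ln (U * s) - b * (U * s)) / U + s * ln s"
        using U True by (simp add: ln_mult field_simps)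
      have e1: "\<bar>(zeta_int (U * s) - U * s * ln (U * s) - b * (U * s)) / U\<bar> \<le> C * (1 + s)"
      proof -
        have "\<bar>zeta_int (U * s) - U * s * ln (U * s) - b * (U * s)\<bar> / U \<le> C * (1 + U * s) / U"
          using C(2)[OF Us] U by (intro divide_right_mono) auto
        also have "\<dots> = C * (1 / U + s)" using U by (simp add: field_simps)
        also have "\<dots> \<le> C * (1 + s)" using U C(1) by (intro mult_left_mono) auto
        finally show ?thesis using U by simp
      qed
      have e2: "\<bar>s * ln s\<bar> \<le> 1 + s\<^sup>2"
      proof (cases "s \<ge> 1")
        case T: True
        have "s * ln s \<le> s * s" using T ln_le_minus_one[OF True] by (intro mult_left_mono) auto
        moreover have "\<bar>s * ln s\<bar> = s * ln s" using T by simp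
        ultimately show ?thesis unfolding power2_eq_square by linarith
      next
        case False
        have "- ln s \<le> 1 / s" using ln_le_minus_one[of "1 / s"] True by (simp add: ln_div)
        then have "s * (- ln s) \<le> s * (1 / s)" using True by (intro mult_left_mono) auto
        moreover have "ln s < 0" using False True by simp
        ultimately have "\<bar>s * ln s\<bar> \<le> 1" using True by (simp add: abs_mult)
        then show ?thesis using zero_le_power2[of s] by linarith
      qed
      have e3: "C * (1 + s) \<le> C * (2 * (1 + s\<^sup>2))"
      proof (rule mult_left_mono[OF _ C(1)])
        show "1 + s \<le> 2 * (1 + s\<^sup>2)" by (rule one_plus_le_square)
      qed
      have "\<bar>zeta_int (U * s) / U - s * ln U - s * b\<bar> \<le> C * (2 * (1 + s\<^sup>2)) + (1 + s\<^sup>2)"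
        unfolding eq by (intro order_trans[OF abs_triangle_ineq] add_mono order_trans[OF e1 e3] e2)
      also have "\<dots> \<le> (2 + 2 * C) * (1 + s\<^sup>2)" by (simp add: algebra_simps)
      finally show ?thesis .
    qed
    from mult_right_mono[OF this, of "exp (- s)"] show ?thesis
      using True C(1) by (auto simp: k_def indicator_def abs_mult mult.assoc)
  qed (simp add: k_def)
  have k_meas [measurable]: "k U \<in> borel_measurable borel" for U unfolding k_def[abs_def] by measurable
  have maj: "integrable lborel (\<lambda>s. (2 + 2 * C) * (indicator {0<..} s * ((1 + s\<^sup>2) * exp (- s))))"
    by (intro integrable_mult_right laplace_majorant_integrable)
  have k_int: "integrable lborel (k U)" if "U \<ge> 1" for U
    by (rule Bochner_Integration.integrable_bound[OF maj])
       (use k_bound[OF that] in \<open>auto intro: order_trans[OF _ abs_ge_self]\<close>)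
  have k_lim: "((\<lambda>U. LINT s|lborel. k U s) \<longlongrightarrow> 1 - euler_mascheroni) at_top"
    unfolding ln_exp_integral[symmetric]
  proof (rule integral_dominated_convergence_at_top[OF _ _ maj])
    show "\<forall>\<^sub>F U in at_top. AE s in lborel. norm (k U s) \<le> (2 + 2 * C) * (indicator {0<..} s * ((1 + s\<^sup>2) * exp (- s)))"
      using eventually_ge_at_top[of 1] by eventually_elim (use k_bound in auto)
    show "AE s in lborel. ((\<lambda>U. k U s) \<longlongrightarrow> indicator {0<..} s * (s * ln s * exp (- s))) at_top"
    proof (rule AE_I2)
      fix s :: real
      show "((\<lambda>U. k U s) \<longlongrightarrow> indicator {0<..} s * (s * ln s * exp (- s))) at_top"
      proof (cases "s > 0")
        case True
        have "filterlim (\<lambda>U. s * U) at_top at_top" by (rule filterlim_tendsto_pos_mult_at_top[OF tendsto_const True filterlim_ident])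
        from filterlim_compose[OF b this]
        have "((\<lambda>U. (s * (zeta_int (s * U) / (s * U) - ln (s * U) - b) + s * ln s) * exp (- s)) \<longlongrightarrow> (s * (b - b) + s * ln s) * exp (- s)) at_top"
          by (intro tendsto_intros)
        moreover have "\<forall>\<^sub>F U in at_top. (s * (zeta_int (s * U) / (s * U) - ln (s * U) - b) + s * ln s) * exp (- s) = k U s"
          using eventually_ge_at_top[of 1] m_top[unfolded filterlim_at_top, rule_format, of s]
          by eventually_elim (use True in \<open>simp add: k_def indicator_def ln_mult mult.commute algebra_simps\<close>)
        ultimately show ?thesis
          using True Lim_transform_eventually by fastforce
      qed (simp add: k_def)
    qed
  qed measurable
  \<comment> \<open>Three small parts: the boundary term of the integration by parts, the end cut
    off from the integral of \<open>s * exp (- s)\<close>, and the error of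
    \<open>zeta_int U / U\<close>.\<close>
  define err where "err U = zeta_int (U * m U) / U * exp (- m U) - (ln U + b) * ((1 + m U) * exp (- m U)) - (zeta_int U / U - ln U - b)" for U
  have split: "\<forall>\<^sub>F U in at_top. (LINT s|lborel. k U s) + err U =
      (integral {0..U * m U} (\<lambda>t. zeta_sq t * exp (- t / U)) - zeta_int U) / U"
    using pos
  proof eventually_elim
    case (elim U)
    then have U: "U > 0" "U \<ge> 1" "m U \<ge> 0" by auto
    have "(LINT s|lborel. indicator {0<..m U} s * (zeta_int (U * s) * exp (- s))) =
        (LINT s|lborel. U * (k U s + (ln U + b) * (indicator {0<..m U} s * (s * exp (- s)))))"
    proof (rule Bochner_Integration.integral_cong[OF refl])
      fix s
      show "indicator {0<..m U} s * (zeta_int (U * s) * exp (- s)) = U * (k U s + (ln U + b) * (indicator {0<..m U} s * (s * exp (- s))))"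
        using U by (auto simp: k_def indicator_def field_simps)
    qed
    also have "\<dots> = U * ((LINT s|lborel. k U s) + (ln U + b) * (1 - (1 + m U) * exp (- m U)))"
      using k_int[OF U(2)] linear_exp_integral[OF U(3)] by simp
    finally have int: "(LINT s|lborel. indicator {0<..m U} s * (zeta_int (U * s) * exp (- s))) =
        U * ((LINT s|lborel. k U s) + (ln U + b) * (1 - (1 + m U) * exp (- m U)))" .
    have "K + (z / U * e - (l + b) * (d * e) - (i / U - l - b)) = (z * e + U * (K + (l + b) * (1 - d * e)) - i) / U"
      for K z e l d i :: real
      using U by (simp add: field_simps)
    then show ?case
      unfolding zeta_laplace_by_parts[OF U(1,3)] int err_def .
  qed
  have err_lim: "(err \<longlongrightarrow> 0 - 0 - (b - b)) at_top"
    unfolding err_def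
  proof (intro tendsto_diff b tendsto_const)
    \<comment> \<open>Half of the exponent absorbs the polynomial in \<open>m U\<close>; the other
      half is at most \<open>(2 * U) powr (-7)\<close>, which beats the growth of size
      \<open>U\<^sup>2\<close> below.\<close>
    have bd: "(1 + (m U)\<^sup>2) * exp (- m U) \<le> 9 * exp (- (7 * ln (2 * U)))" if "m U \<ge> 0" "m U \<ge> 14 * ln (2 * U)" for U
    proof -
      have "9 * exp (- (m U * (1/2))) \<le> 9 * exp (- (7 * ln (2 * U)))" using that by simp
      with one_plus_square_exp_le[OF that(1)] show ?thesis by linarith
    qed
    have z1: "((\<lambda>U::real. (ln U + \<bar>b\<bar>) * (2 * (9 * exp (- (7 * ln (2 * U)))))) \<longlongrightarrow> 0) at_top" by real_asymp
    show "((\<lambda>U. (ln U + b) * ((1 + m U) * exp (- m U))) \<longlongrightarrow> 0) at_top"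
    proof (rule Lim_null_comparison[OF _ z1])
      show "\<forall>\<^sub>F U in at_top. norm ((ln U + b) * ((1 + m U) * exp (- m U))) \<le> (ln U + \<bar>b\<bar>) * (2 * (9 * exp (- (7 * ln (2 * U)))))"
        using pos
      proof eventually_elim
        case (elim U)
        have "1 + m U \<le> 2 * (1 + (m U)\<^sup>2)"
          by (rule one_plus_le_square)
        then have "(1 + m U) * exp (- m U) \<le> 2 * (1 + (m U)\<^sup>2) * exp (- m U)" by (rule mult_right_mono) simp
        also have "\<dots> \<le> 2 * (9 * exp (- (7 * ln (2 * U))))"
          unfolding mult.assoc using elim by (intro mult_left_mono bd) auto
        finally have "(1 + m U) * exp (- m U) \<le> 2 * (9 * exp (- (7 * ln (2 * U))))" .
        moreover have "\<bar>ln U + b\<bar> \<le> ln U + \<bar>b\<bar>" using elim ln_ge_zero[of U] by linarith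
        moreover have "(1 + m U) * exp (- m U) \<ge> 0" using elim by simp
        ultimately have "\<bar>ln U + b\<bar> * ((1 + m U) * exp (- m U)) \<le> (ln U + \<bar>b\<bar>) * (2 * (9 * exp (- (7 * ln (2 * U)))))"
          by - (rule mult_mono, linarith+)
        then show ?case using elim by (simp add: abs_mult)
      qed
    qed
    define K where "K = 2 + \<bar>b\<bar> + 2 * C"
    have z2: "((\<lambda>U::real. (1 + U\<^sup>2) * (9 * exp (- (7 * ln (2 * U))))) \<longlongrightarrow> 0) at_top" by real_asymp
    from tendsto_mult_right_zero[OF this, of K]
    have z2: "((\<lambda>U. K * ((1 + U\<^sup>2) * (9 * exp (- (7 * ln (2 * U)))))) \<longlongrightarrow> 0) at_top" .
    show "((\<lambda>U. zeta_int (U * m U) / U * exp (- m U)) \<longlongrightarrow> 0) at_top"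
    proof (rule Lim_null_comparison[OF _ z2])
      show "\<forall>\<^sub>F U in at_top. norm (zeta_int (U * m U) / U * exp (- m U)) \<le> K * ((1 + U\<^sup>2) * (9 * exp (- (7 * ln (2 * U)))))"
        using pos m_top[unfolded filterlim_at_top, rule_format, of 1]
      proof eventually_elim
        case (elim U)
        define t where "t = U * m U"
        have "1 * 1 \<le> U * m U" using elim by (intro mult_mono) auto
        then have t: "t \<ge> 1" by (simp add: t_def)
        have "t * ln t \<le> t * t" "t \<le> t * t" using t ln_le_minus_one[of t] by (auto intro!: mult_left_mono)
        moreover have "b * t \<le> \<bar>b\<bar> * (t * t)"
        proof -
          have "b * t \<le> \<bar>b\<bar> * t" using t by (intro mult_right_mono) auto
          also have "\<dots> \<le> \<bar>b\<bar> * (t * t)" using \<open>t \<le> t * t\<close> by (intro mult_left_mono) auto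
          finally show ?thesis .
        qed
        moreover have "C * (1 + t) \<le> C * (2 * (1 + t * t))"
          using mult_left_mono[OF one_plus_le_square C(1), of t] by (simp only: power2_eq_square)
        moreover have "\<bar>zeta_int t - t * ln t - b * t\<bar> \<le> C * (1 + t)" using C(2)[of t] t by simp
        ultimately have "zeta_int t \<le> t * t + \<bar>b\<bar> * (t * t) + C * (2 * (1 + t * t))" by linarith
        also have "\<dots> \<le> K * (1 + t * t)" using t by (simp add: K_def algebra_simps)
        \<comment> \<open>Separates \<open>U\<close> from \<open>m U\<close>, so that the power of
          \<open>m U\<close> is absorbed by its exponential through \<open>bd\<close>.\<close>
        also have "1 + t * t \<le> (1 + U\<^sup>2) * (1 + (m U)\<^sup>2)"
          by (simp add: t_def power2_eq_square algebra_simps)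
        finally have "zeta_int t \<le> K * ((1 + U\<^sup>2) * (1 + (m U)\<^sup>2))"
          using C(1) by (simp add: K_def mult_left_mono)
        moreover have z0: "zeta_int t \<ge> 0" using zeta_int_mono[of 0 t] t by (simp add: zeta_int_def)
        have "zeta_int t / U \<le> zeta_int t" using elim z0 by (simp add: divide_le_eq mult_le_cancel_left1)
        ultimately have "zeta_int t / U * exp (- m U) \<le> K * ((1 + U\<^sup>2) * (1 + (m U)\<^sup>2)) * exp (- m U)"
          by (intro mult_right_mono) auto
        also have "\<dots> = K * ((1 + U\<^sup>2) * ((1 + (m U)\<^sup>2) * exp (- m U)))" by simp
        also have "\<dots> \<le> K * ((1 + U\<^sup>2) * (9 * exp (- (7 * ln (2 * U)))))"
          using bd[of U] elim C(1) by (intro mult_left_mono) (auto simp: K_def)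
        finally show ?case using z0 elim by (simp add: t_def abs_mult)
      qed
    qed
  qed
  from tendsto_add[OF k_lim err_lim] have "((\<lambda>U. (LINT s|lborel. k U s) + err U) \<longlongrightarrow> 1 - euler_mascheroni) at_top" by simp
  from Lim_transform_eventually[OF this split] show ?thesis .
qed

section \<open>The equation that defines the ladder\<close>

definition jacob_lhs :: "(real \<Rightarrow> real) \<Rightarrow> real \<Rightarrow> real" where
  "jacob_lhs \<mu> x = integral {0..\<mu> x} (\<lambda>t. zeta_sq t * exp (- 2 * t / x))"

lemma jacob_integrand_integrable:
  assumes "x > 0"
  shows "(\<lambda>t. zeta_sq t * exp (- 2 * t / x)) integrable_on {a..b}"
  using assms by (intro integrable_continuous_real continuous_intros continuous_on_zeta_sq) auto

text \<open>A positive value at \<open>x\<close> forces \<open>zeta_sq\<close> to be positive somewhere on \<open>[0, \<mu> x]\<close>, and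
  there the larger exponential makes the inequality strict.\<close>

lemma jacob_lhs_strict_mono:
  assumes w: "jacob_weight y0 \<mu>" and x: "y0 \<le> x" "x < x'" and pos: "jacob_lhs \<mu> x > 0"
  shows "jacob_lhs \<mu> x < jacob_lhs \<mu> x'"
proof (rule ccontr)
  assume "\<not> jacob_lhs \<mu> x < jacob_lhs \<mu> x'"
  then have le: "jacob_lhs \<mu> x' \<le> jacob_lhs \<mu> x" by simp
  have y0: "y0 > 0" "x > 0" "x' > 0" using w x by (auto simp: jacob_weight_def)
  have mu: "\<mu> x \<le> \<mu> x'" using w x unfolding jacob_weight_def mono_on_def by auto
  have mu0: "\<mu> x > 0"
  proof (rule ccontr)
    assume "\<not> \<mu> x > 0"
    then have "\<mu> x < 0 \<or> \<mu> x = 0" by linarith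
    then have "jacob_lhs \<mu> x = 0" by (auto simp: jacob_lhs_def)
    with pos show False by simp
  qed
  let ?f = "\<lambda>x t. zeta_sq t * exp (- 2 * t / x)"
  have c: "continuous_on {0..\<mu> x} (?f y)" if "y > 0" for y
    using that by (intro continuous_intros continuous_on_zeta_sq) auto
  have ge: "?f x t \<le> ?f x' t" if "t \<ge> 0" for t
  proof -
    have "2 * t / x' \<le> 2 * t / x" using that x y0 by (intro divide_left_mono) auto
    then show ?thesis by (intro mult_left_mono zeta_sq_nonneg) simp
  qed
  have "integral {0..\<mu> x} (?f x') \<le> jacob_lhs \<mu> x'"
    unfolding jacob_lhs_def using mu y0
    by (intro integral_subset_le jacob_integrand_integrable) (auto simp: zeta_sq_nonneg)
  with le have "integral {0..\<mu> x} (?f x') \<le> integral {0..\<mu> x} (?f x)" by (simp add: jacob_lhs_def)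
  moreover have "integral {0..\<mu> x} (?f x) \<le> integral {0..\<mu> x} (?f x')"
    using y0 ge by (intro integral_le jacob_integrand_integrable) auto
  ultimately have "integral {0..\<mu> x} (\<lambda>t. ?f x' t - ?f x t) = 0"
    using Henstock_Kurzweil_Integration.integral_diff[OF jacob_integrand_integrable[OF y0(3)] jacob_integrand_integrable[OF y0(2)], of 0 "\<mu> x"]
    by simp
  moreover have "integral {0..\<mu> x} (\<lambda>t. ?f x' t - ?f x t) = 0 \<longleftrightarrow> (\<forall>t\<in>{0..\<mu> x}. ?f x' t - ?f x t = 0)"
  proof (rule integral_eq_0_iff[OF _ mu0])
    show "continuous_on {0..\<mu> x} (\<lambda>t. ?f x' t - ?f x t)"
      by (intro continuous_on_diff c y0)
    show "0 \<le> ?f x' t - ?f x t" if "t \<in> {0..\<mu> x}" for t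
      using ge[of t] that by simp
  qed
  ultimately have zero: "\<forall>t\<in>{0..\<mu> x}. ?f x' t - ?f x t = 0" by blast
  have "zeta_sq t = 0" if "0 < t" "t \<le> \<mu> x" for t
  proof -
    have "?f x' t = ?f x t" using that zero by auto
    moreover have "exp (- 2 * t / x') \<noteq> exp (- 2 * t / x)" using that x y0 by (auto simp: field_simps)
    ultimately show ?thesis by auto
  qed
  then have "jacob_lhs \<mu> x = integral {0..\<mu> x} (\<lambda>t. 0)"
    unfolding jacob_lhs_def by (intro integral_spike[of "{0}"]) auto
  with pos show False by simp
qed

text \<open>Strict monotonicity is available only at positive values, hence \<open>pos\<close>: it
  excludes a second solution, and the definite description returns the given one.\<close>

lemma jacob_phi_eq:
  assumes w: "jacob_weight y0 \<mu>" and x: "y0 \<le> x" "jacob_lhs \<mu> x = zeta_int T" and pos: "zeta_int T > 0"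
  shows "jacob_phi y0 \<mu> T = x"
  unfolding jacob_phi_def jacob_lhs_def[symmetric] zeta_int_def[symmetric]
proof (rule the_equality)
  fix z assume z: "y0 \<le> z \<and> jacob_lhs \<mu> z = zeta_int T"
  show "z = x"
    using jacob_lhs_strict_mono[OF w, of z x] jacob_lhs_strict_mono[OF w, of x z] z x pos
    by (cases z x rule: linorder_cases) auto
qed (use x in auto)

lemma zeta_int_at_top: "filterlim zeta_int at_top at_top"
proof -
  obtain b where b: "((\<lambda>t. zeta_int t / t - ln t) \<longlongrightarrow> b) at_top"
    unfolding zeta_int_def by (rule zeta_sq_mean)
  have "filterlim (\<lambda>t. (zeta_int t / t - ln t) + ln t) at_top at_top"
    by (rule filterlim_tendsto_add_at_top[OF b ln_at_top])
  then have "filterlim (\<lambda>t. ((zeta_int t / t - ln t) + ln t) * t) at_top at_top"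
    by (rule filterlim_at_top_mult_at_top[OF _ filterlim_ident])
  moreover have "\<forall>\<^sub>F t in at_top. ((zeta_int t / t - ln t) + ln t) * t = zeta_int t"
    using eventually_gt_at_top[of 0] by eventually_elim simp
  ultimately show ?thesis using filterlim_cong by fastforce
qed

text \<open>The equation is read backwards: \<open>T\<close> is chosen by the intermediate value
  theorem so that \<open>zeta_int T\<close> equals the Laplace integral at \<open>2 * U\<close>, and
  the ladder then maps \<open>T\<close> to \<open>U\<close>. By \<open>gt\<close> this
  \<open>T\<close> can be taken at or beyond \<open>U\<close>, hence in \<open>{T0..}\<close>, where
  the ladder is injective.\<close>

lemma reverse_iter_integral:
  assumes w: "jacob_weight y0 \<mu>" and mono: "strict_mono_on {T0..} (jacob_ladder y0 \<mu>)"
    and U: "U > 0" "U \<ge> T0" "2 * U \<ge> y0" and gt: "jacob_lhs \<mu> (2 * U) > zeta_int U"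
  shows "integral {U..reverse_iter y0 \<mu> T0 U} zeta_sq = jacob_lhs \<mu> (2 * U) - zeta_int U"
proof -
  have "\<forall>\<^sub>F t in at_top. zeta_int t \<ge> jacob_lhs \<mu> (2 * U)"
    using zeta_int_at_top by (simp add: filterlim_at_top)
  then obtain N where N: "\<And>t. t \<ge> N \<Longrightarrow> zeta_int t \<ge> jacob_lhs \<mu> (2 * U)"
    by (auto simp: eventually_at_top_linorder)
  have "\<exists>T\<ge>U. T \<le> max N U \<and> zeta_int T = jacob_lhs \<mu> (2 * U)"
    using gt N[of "max N U"] U continuous_on_subset[OF continuous_on_zeta_int[of "max N U"], of "{U..max N U}"]
    by (intro IVT') auto
  then obtain T where T: "T \<ge> U" "zeta_int T = jacob_lhs \<mu> (2 * U)" by blast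
  have "zeta_int U \<ge> 0" using zeta_int_mono[of 0 U] U by (simp add: zeta_int_def)
  then have "jacob_phi y0 \<mu> T = 2 * U"
    using T gt U by (intro jacob_phi_eq[OF w]) auto
  then have "jacob_ladder y0 \<mu> T = U" by (simp add: jacob_ladder_def)
  then have "reverse_iter y0 \<mu> T0 U = T"
    unfolding reverse_iter_def using T U
    by (intro the_inv_into_f_eq strict_mono_on_imp_inj_on[OF mono]) auto
  then show ?thesis using zeta_int_diff[of U T] T U by simp
qed

text \<open>At \<open>x = 2 * U\<close> the weight \<open>exp (- 2 * t / x)\<close> is
  \<open>exp (- t / U)\<close>, so the integral divided by \<open>U\<close> tends to
  \<open>1 - euler_mascheroni\<close>. The scaling
  \<open>U = q * (\<tau> / (1 - euler_mascheroni))\<close> converts this limit to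
  \<open>q\<close>.\<close>

lemma zeta_mean_tendsto:
  assumes w: "jacob_weight y0 \<mu>" and mono: "strict_mono_on {T0..} (jacob_ladder y0 \<mu>)" and q: "q > 0"
  shows "(zeta_mean y0 \<mu> T0 q \<longlongrightarrow> q) at_top"
proof -
  define c :: real where "c = 1 - euler_mascheroni"
  have c: "c > 0" using euler_mascheroni_less_13_over_22 by (simp add: c_def)
  \<comment> \<open>The bound \<open>7 * y * ln y\<close> at \<open>y = 2 * U\<close> becomes
    \<open>14 * ln (2 * U)\<close> after division by \<open>U\<close>.\<close>
  define m where "m U = \<mu> (2 * U) / U" for U
  have y0: "y0 > 0" and mu: "\<And>y. y \<ge> y0 \<Longrightarrow> \<mu> y \<ge> 7 * y * ln y"
    using w by (auto simp: jacob_weight_def)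
  have "\<forall>\<^sub>F U in at_top. m U \<ge> 14 * ln (2 * U)"
    using eventually_ge_at_top[of y0]
  proof eventually_elim
    case (elim U)
    then show ?case using mu[of "2 * U"] y0 by (simp add: m_def le_divide_eq mult_ac)
  qed
  from zeta_laplace_asymp[OF this]
  have "((\<lambda>U. (integral {0..U * m U} (\<lambda>t. zeta_sq t * exp (- t / U)) - zeta_int U) / U) \<longlongrightarrow> c) at_top"
    by (simp add: c_def)
  moreover have "\<forall>\<^sub>F U in at_top. (integral {0..U * m U} (\<lambda>t. zeta_sq t * exp (- t / U)) - zeta_int U) / U
      = (jacob_lhs \<mu> (2 * U) - zeta_int U) / U"
    using eventually_gt_at_top[of 0] by eventually_elim (simp add: jacob_lhs_def m_def)
  ultimately have lim: "((\<lambda>U. (jacob_lhs \<mu> (2 * U) - zeta_int U) / U) \<longlongrightarrow> c) at_top"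
    by (rule Lim_transform_eventually)
  \<comment> \<open>Positivity of the limit, that is Euler's constant being below 1, yields the
    strict inequality that \<open>reverse_iter_integral\<close> asks for.\<close>
  have "\<forall>\<^sub>F U in at_top. (jacob_lhs \<mu> (2 * U) - zeta_int U) / U > 0"
    using order_tendstoD(1)[OF lim c] .
  then have ev: "\<forall>\<^sub>F U in at_top. integral {U..reverse_iter y0 \<mu> T0 U} zeta_sq / U = (jacob_lhs \<mu> (2 * U) - zeta_int U) / U"
    using eventually_gt_at_top[of 0] eventually_ge_at_top[of T0] eventually_ge_at_top[of y0]
  proof eventually_elim
    case (elim U)
    then show ?case
      using reverse_iter_integral[OF w mono, of U] by (simp add: zero_less_divide_iff)
  qed
  have lim': "((\<lambda>U. integral {U..reverse_iter y0 \<mu> T0 U} zeta_sq / U) \<longlongrightarrow> c) at_top"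
    by (rule Lim_transform_eventually[OF lim]) (use ev in \<open>auto elim: eventually_mono\<close>)
  have "filterlim (\<lambda>\<tau>. (q / c) * \<tau>) at_top at_top"
    using q c by (intro filterlim_tendsto_pos_mult_at_top[OF tendsto_const _ filterlim_ident]) simp
  from filterlim_compose[OF lim' this]
  have "((\<lambda>\<tau>. (q / c) * (integral {q / c * \<tau>..reverse_iter y0 \<mu> T0 (q / c * \<tau>)} zeta_sq / (q / c * \<tau>))) \<longlongrightarrow> (q / c) * c) at_top"
    by (intro tendsto_intros)
  moreover have "\<forall>\<^sub>F \<tau> in at_top. (q / c) * (integral {q / c * \<tau>..reverse_iter y0 \<mu> T0 (q / c * \<tau>)} zeta_sq / (q / c * \<tau>)) = zeta_mean y0 \<mu> T0 q \<tau>"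
    using eventually_gt_at_top[of 0]
    by eventually_elim (use q c in \<open>simp add: zeta_mean_def Let_def c_def[symmetric]\<close>)
  ultimately have "(zeta_mean y0 \<mu> T0 q \<longlongrightarrow> (q / c) * c) at_top"
    by (rule Lim_transform_eventually)
  then show ?thesis using c by simp
qed

text \<open>Each limit is the Fermat rational itself, which equals 1 exactly at a solution. The
  condition asks for a limit that exists and differs from 1, so a divergent mean would not satisfy
  it. The range \<open>n \<ge> 3\<close> is that of the Fermat-Wiles theorem; for smaller exponents
  the rational 1 does occur, as for 3, 4, 5.\<close>

theorem theorem4:
  fixes \<mu> :: "real \<Rightarrow> real" and y0 T0 :: real
  assumes "jacob_weight y0 \<mu>"
    and "strict_mono_on {T0..} (jacob_ladder y0 \<mu>)"
  shows "(\<forall>x y z n :: nat. x > 0 \<and> y > 0 \<and> z > 0 \<and> n \<ge> 3 \<longrightarrow>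
            (\<exists>L. (zeta_mean y0 \<mu> T0 (fermat_rational x y z n) \<longlongrightarrow> L) at_top \<and> L \<noteq> 1))
         \<longleftrightarrow> fermat_wiles"
proof -
  have lim: "(zeta_mean y0 \<mu> T0 (fermat_rational x y z n) \<longlongrightarrow> fermat_rational x y z n) at_top"
    if "x > 0" "y > 0" "z > 0" for x y z n
    using that by (intro zeta_mean_tendsto assms) (simp add: fermat_rational_def add_pos_pos)
  have one: "fermat_rational x y z n = 1 \<longleftrightarrow> x ^ n + y ^ n = z ^ n" if "z > 0" for x y z n
  proof -
    have "fermat_rational x y z n = 1 \<longleftrightarrow> real (x ^ n + y ^ n) = real (z ^ n)"
      using that by (auto simp: fermat_rational_def)
    then show ?thesis by (simp only: of_nat_eq_iff)
  qed
  have key: "(\<exists>L. (zeta_mean y0 \<mu> T0 (fermat_rational x y z n) \<longlongrightarrow> L) at_top \<and> L \<noteq> 1) \<longleftrightarrow> x ^ n + y ^ n \<noteq> z ^ n"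
    if "x > 0" "y > 0" "z > 0" for x y z n
    using lim[OF that] one[OF that(3)] tendsto_unique[OF trivial_limit_at_top_linorder] by metis
  have "(\<forall>x y z n :: nat. x > 0 \<and> y > 0 \<and> z > 0 \<and> n \<ge> 3 \<longrightarrow>
            (\<exists>L. (zeta_mean y0 \<mu> T0 (fermat_rational x y z n) \<longlongrightarrow> L) at_top \<and> L \<noteq> 1))
      \<longleftrightarrow> (\<forall>(x :: nat) (y :: nat) (z :: nat) n. x > 0 \<and> y > 0 \<and> z > 0 \<and> n \<ge> 3 \<longrightarrow> x ^ n + y ^ n \<noteq> z ^ n)"
    using key by (simp cong: imp_cong)
  also have "\<dots> \<longleftrightarrow> fermat_wiles" unfolding fermat_wiles_def by blast
  finally show ?thesis .
qed

end
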